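(* Let $q>0$ and $u\ge 0$, and let $\omega:(0,\infty)^2\to[0,\infty)$ be bounded and measurable. Let $GS_\omega^\epsilon(u,q)$ be the Gerber–Shiu function given by the formula $$GS_\omega^\epsilon(u,q)=A(q)\,\lambda^{(-)}\int_{[0,\infty)}\int_{[0,\infty)}\omega(y,z)\Big(\mathbf W^{(q)}_\epsilon(u)e^{-\mathbf R^{(q)}_\epsilon z}-\mathbf W^{(q)}_\epsilon(u-z)\Big)_{(1,1)}F^{(-)}_\epsilon(z+dy)\,dz ,$$ and let $GS_\omega(u,q)$ be its value at $\epsilon=0$. Then, as $\epsilon\downarrow 0$, $$\begin{aligned}GS_\omega^\epsilon(u,q)=\;&GS_\omega(u,q)+\epsilon A(q)\lambda^{(-)}\Bigg(\int_{[0,\infty)}\int_{[0,\infty)}\omega(y,z)\,\mathbf r^{(q)}(u,z)_{(1,1)}\Big(F_h(z+dy)-F_p(z+dy)\Big)dz\\&+\int_{[0,\infty)}\int_{[0,\infty)}\omega(y,z)\,v^{(q)}(u,z)\,F_p(z+dy)\,dz\Bigg)+O(\epsilon^2),\end{aligned}$$ where $\mathbf r^{(q)}(u,z)=\mathbf W^{(q)}(u)e^{-\mathbf R^{(q)}z}-\mathbf W^{(q)}(u-z)$ and $$\begin{aligned}v^{(q)}(u,z)=\;&\lambda^{(-)}\big(\mu_hF_h^e(u)-\mu_pF_p^e(u)\big)*\big(\mathbf W^{(q)}(du)\big)_{(1,1)}*\big(\mathbf W^{(q)}(du)\big)_{1\bullet}\cdot\Big(e^{-\mathbf R^{(q)}z}\Big)_{\bullet1}\\&+\big(\mathbf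 W^{(q)}(u)\big)_{1\bullet}\cdot\Big((\mathbf L^{(q)})^{-1}e^{-\mathbf\Lambda^{(q)}z}\mathbf H^{(q)}_1-z(\mathbf L^{(q)})^{-1}e^{-\mathbf\Lambda^{(q)}z}\mathbf\Delta^{(q)}_1\mathbf L^{(q)}-(\mathbf L^{(q)})^{-1}\mathbf H^{(q)}_1e^{-\mathbf R^{(q)}z}\Big)_{\bullet1}\\&-\lambda^{(-)}\int_0^{u-z}\big(\mu_hF_h^e(u-z-x)-\mu_pF_p^e(u-z-x)\big)\big(\mathbf W^{(q)}(dx)\big)_{(1,1)}^{*2}.\end{aligned}$$
   Context: **Model.** The risk reserve process is $X_\epsilon(t)=u+ct+\sum_{k=1}^{N^{(+)}(t)}U^{(+)}_k-\sum_{k=1}^{N^{(-)}_\epsilon(t)}U^{(-)}_{\epsilon,k}$, with $u\ge0$ the initial surplus, $c>0$ the premium rate, and independent Poisson processes $N^{(+)}$ (gains, rate $\lambda^{(+)}$) and $N^{(-)}_\epsilon$ (claims, rate $\lambda^{(-)}$). Gains are i.i.d. of phase type with $m=m^{(+)}$ phases and representation $(\boldsymbol\alpha^{(+)},\mathbf T^{(+)})$: $\boldsymbol\alpha^{(+)}$ is a probability row vector, $\mathbf T^{(+)}$ an invertible subintensity matrix, $\mathbf t^{(+)}=-\mathbf T^{(+)}\mathbf 1$. Claims are i.i.d. with distribution $F^{(-)}_\epsilon=(1-\epsilon)F_p+\epsilon F_h$, $\epsilon\in[0,1]$, where $F_p$ (phase-type) and $F_h$ (heavy-tailed) are absolutely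 continuous distributions on $(0,\infty)$ with finite means $\mu_p,\mu_h$. All these are independent, and the safety loading condition $c+\lambda^{(+)}\mathbb E U^{(+)}-\lambda^{(-)}\mathbb E U^{(-)}_\epsilon>0$ holds. For $i\in\{p,h\}$, $F_i^e(x)=\mu_i^{-1}\int_0^x(1-F_i(y))dy$ is the stationary-excess distribution and $\tilde F_i^e$ its Laplace–Stieltjes transform. $F(z+dy)$ denotes the measure $B\mapsto F(z+B)$ on $[0,\infty)$. **Matrix exponents.** $\phi_\epsilon(s)=cs-\lambda^{(-)}s\big((1-\epsilon)\mu_p\tilde F_p^e(s)+\epsilon\mu_h\tilde F_h^e(s)\big)$, $k(s)=\lambda^{(-)}(\mu_h\tilde F_h^e(s)-\mu_p\tilde F_p^e(s))$, $$\mathbf F^{(q)}_\epsilon(s)=\begin{bmatrix}\phi_\epsilon(s)-\lambda^{(+)}-q&\lambda^{(+)}\boldsymbol\alpha^{(+)}\\ \mathbf t^{(+)}&\mathbf T^{(+)}+s\mathbf I\end{bmatrix}\in\mathbb C^{(m+1)\times(m+1)},\qquad \mathbf F_\epsilon(s)=\mathbf F^{(0)}_\epsilon(s).$$ Objects without the subscript $\epsilon$ are those with $\epsilon=0$. $A(q)=\big[q\,\big((q\mathbf I-\mathbf F_\epsilon(0))^{-1}\big)_{(1,1)}\big]^{-1}$ (which does not depend on $\epsilon$). **Scale matrix.** $\mathbf W^{(q)}_\epsilon:[0,\infty)\to\mathbb R^{(m+1)\times(m+1)}$ is the continuous function with $\int_0^\infty e^{-sx}\mathbf W^{(q)}_\epsilon(x)dx=(\mathbf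 F^{(q)}_\epsilon(s))^{-1}$ for all sufficiently large $s$; it is $\mathbf 0$ for negative arguments. $\mathbf W^{(q)}(dx)$ is the matrix of (signed) measures on $[0,\infty)$ with $\int_{[0,\infty)}e^{-sx}\mathbf W^{(q)}(dx)=s(\mathbf F^{(q)}(s))^{-1}$ (so it has an atom $\mathbf W^{(q)}(0)$ at $0$). **Eigenvalues.** For $q>0$, $\det\mathbf F^{(q)}(s)=0$ has $m+1$ roots $\rho^{(q)}_i$ with positive real part, $i=1,\dots,m+1$, assumed simple; each extends to a root $\rho^{(q)}_{\epsilon,i}=\rho^{(q)}_i+\epsilon\delta^{(q)}_{i,1}+O(\epsilon^2)$ of $\det\mathbf F^{(q)}_\epsilon(s)=0$, where $$\delta^{(q)}_{i,1}=\frac{\rho_i^{(q)}k(\rho_i^{(q)})\det(\mathbf T^{(+)}+\rho_i^{(q)}\mathbf I)}{\frac{d}{ds}\det\mathbf F^{(q)}(s)\big|_{s=\rho_i^{(q)}}}.$$ $\mathbf\Lambda^{(q)}_\epsilon=\mathrm{diag}(\rho^{(q)}_{\epsilon,i})_i$, $\mathbf\Delta^{(q)}_1=\mathrm{diag}(\delta^{(q)}_{i,1})_i$. **Eigenvectors.** Let $\mathbf w(s)=\big(\det(\mathbf T^{(+)}+s\mathbf I)\;\big|\;-\lambda^{(+)}\boldsymbol\alpha^{(+)}\mathrm{adj}(\mathbf T^{(+)}+s\mathbf I)\big)$ (row vector of length $m+1$; adj = adjugate). $\mathbf L^{(q)}_\epsilon$ is the matrix with $i$th row $\mathbf w(\rho^{(q)}_{\epsilon,i})$,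 assumed invertible. $\mathbf H^{(q)}_1$ has $i$th row $\delta^{(q)}_{i,1}\mathbf w'(\rho^{(q)}_i)$. $\mathbf R^{(q)}_\epsilon=(\mathbf L^{(q)}_\epsilon)^{-1}\mathbf\Lambda^{(q)}_\epsilon\mathbf L^{(q)}_\epsilon$ (the left solution of $\mathbf F_\epsilon^{(q)}(\mathbf R^{(q)}_\epsilon)=\mathbf 0$). **Notation.** $\mathbf A_{i\bullet}$, $\mathbf A_{\bullet j}$ are the $i$th row and $j$th column of $\mathbf A$. For a function $g$ on $[0,\infty)$ and measures $\nu_1,\nu_2$ on $[0,\infty)$, $g(u)*\nu_1(du)*\nu_2(du)=\int_{[0,u]}g(u-x)(\nu_1*\nu_2)(dx)$; $\nu^{*2}=\nu*\nu$. Integrals $\int_0^{u-z}$ against measures include the endpoint $0$ and are $0$ if $z>u$. *)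

theory Defs
  imports "HOL-Probability.Probability" "HOL-Library.Landau_Symbols"
begin

section \<open>Matrices\<close>

primrec mat_pow :: "'a::comm_ring_1^'n^'n \<Rightarrow> nat \<Rightarrow> 'a^'n^'n" where
  "mat_pow A 0 = mat 1"
| "mat_pow A (Suc n) = A ** mat_pow A n"

definition mat_exp :: "'a::{real_normed_field,banach}^'n^'n \<Rightarrow> 'a^'n^'n" where
  "mat_exp A = (\<chi> i j. \<Sum>n. mat_pow A n $ i $ j /\<^sub>R fact n)"

text \<open>The \<open>(i,j)\<close> entry of the adjugate is the \<open>(j,i)\<close> cofactor. The index type is unordered, so
  the cofactor is the determinant with row \<open>j\<close> and column \<open>i\<close> replaced by unit vectors, which
  is the minor together with its sign.\<close>

definition adjugate :: "'a::comm_ring_1^'n^'n \<Rightarrow> 'a^'n^'n" where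
  "adjugate A = (\<chi> i j. det (\<chi> k l. if k = j \<and> l = i then 1
                                     else if k = j \<or> l = i then 0 else A $ k $ l))"

definition diag_mat :: "'a::zero^'n \<Rightarrow> 'a^'n^'n" where
  "diag_mat d = (\<chi> i j. if i = j then d $ i else 0)"

abbreviation cmat :: "real^'n^'m \<Rightarrow> complex^'n^'m" where
  "cmat \<equiv> map_matrix complex_of_real"


section \<open>Measures and distributions\<close>

abbreviation mean :: "real measure \<Rightarrow> real" where
  "mean F \<equiv> LINT x|F. x"

definition lincomb_measure :: "real \<Rightarrow> real measure \<Rightarrow> real \<Rightarrow> real measure \<Rightarrow> real measure" where
  "lincomb_measure a \<mu> b \<nu> =
     measure_of UNIV (sets borel) (\<lambda>B. ennreal a * emeasure \<mu> B + ennreal b * emeasure \<nu> B)"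

text \<open>\<open>shifted F z\<close> is \<open>F(z + dy)\<close>, i.e. \<open>B \<mapsto> F(z + B)\<close>. It also charges negative sets; all
  integrals against it are taken over \<open>{0..}\<close>.\<close>

definition shifted :: "real measure \<Rightarrow> real \<Rightarrow> real measure" where
  "shifted F z = distr F borel (\<lambda>x. x - z)"

definition stationary_excess :: "real measure \<Rightarrow> real \<Rightarrow> real" where
  "stationary_excess F x = inverse (mean F) * (LINT y:{0..x}|lborel. 1 - cdf F y)"

text \<open>Laplace--Stieltjes transform of a distribution function.\<close>

definition lst :: "(real \<Rightarrow> real) \<Rightarrow> complex \<Rightarrow> complex" where
  "lst G s = (LINT x:{0..}|interval_measure G. exp (- s * complex_of_real x))"

definition ac_pos_distribution :: "real measure \<Rightarrow> bool" where
  "ac_pos_distribution F \<longleftrightarrow> real_distribution F \<and> absolutely_continuous lborel F \<and>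
     emeasure F {..0} = 0 \<and> integrable F (\<lambda>x. x)"

definition heavy_tailed :: "real measure \<Rightarrow> bool" where
  "heavy_tailed F \<longleftrightarrow> (\<forall>s>0. (\<integral>\<^sup>+x. ennreal (exp (s * x)) \<partial>F) = \<infinity>)"

definition phase_type :: "real^'n \<Rightarrow> real^'n^'n \<Rightarrow> real measure \<Rightarrow> bool" where
  "phase_type \<alpha> T F \<longleftrightarrow>
     (\<forall>i. 0 \<le> \<alpha> $ i) \<and> (\<Sum>i\<in>UNIV. \<alpha> $ i) = 1 \<and>
     (\<forall>i j. i \<noteq> j \<longrightarrow> 0 \<le> T $ i $ j) \<and> (\<forall>i. (\<Sum>j\<in>UNIV. T $ i $ j) \<le> 0) \<and> invertible T \<and>
     real_distribution F \<and>
     (\<forall>x\<ge>0. cdf F x = 1 - (\<Sum>i\<in>UNIV. \<Sum>j\<in>UNIV. \<alpha> $ i * mat_exp (x *\<^sub>R T) $ i $ j))"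

text \<open>A signed measure is a pair \<open>(\<nu>\<^sub>1, \<nu>\<^sub>2)\<close> of measures standing for \<open>\<nu>\<^sub>1 - \<nu>\<^sub>2\<close>. The two parts
  need not be mutually singular, and both may have infinite total mass (the scale measures grow
  exponentially), as long as the integrands in use are integrable for each part.\<close>

type_synonym signed_measure = "real measure \<times> real measure"

definition sm_integral :: "signed_measure \<Rightarrow> real set \<Rightarrow> (real \<Rightarrow> real) \<Rightarrow> real" where
  "sm_integral \<nu> S g = (LINT x:S|fst \<nu>. g x) - (LINT x:S|snd \<nu>. g x)"

definition sm_convolution :: "signed_measure \<Rightarrow> signed_measure \<Rightarrow> signed_measure" where
  "sm_convolution \<nu> \<kappa> =
     (lincomb_measure 1 (fst \<nu> \<star> fst \<kappa>) 1 (snd \<nu> \<star> snd \<kappa>),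
      lincomb_measure 1 (fst \<nu> \<star> snd \<kappa>) 1 (snd \<nu> \<star> fst \<kappa>))"


section \<open>The risk model\<close>

record ('m::finite) risk_model =
  premium :: real
  gain_rate :: real
  claim_rate :: real
  gain_init :: "real^'m"
  gain_gen :: "real^'m^'m"
  gain_dist :: "real measure"
  claim_p :: "real measure"
  claim_h :: "real measure"

definition claim_dist :: "'m::finite risk_model \<Rightarrow> real \<Rightarrow> real measure" where
  "claim_dist M \<epsilon> = lincomb_measure (1 - \<epsilon>) (claim_p M) \<epsilon> (claim_h M)"

definition valid_model :: "'m::finite risk_model \<Rightarrow> bool" where
  "valid_model M \<longleftrightarrow> 0 < premium M \<and> 0 < gain_rate M \<and> 0 < claim_rate M \<and>
     phase_type (gain_init M) (gain_gen M) (gain_dist M) \<and>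
     ac_pos_distribution (claim_p M) \<and> ac_pos_distribution (claim_h M) \<and>
     heavy_tailed (claim_h M)"

definition safety_loading :: "'m::finite risk_model \<Rightarrow> real \<Rightarrow> bool" where
  "safety_loading M \<epsilon> \<longleftrightarrow>
     premium M + gain_rate M * mean (gain_dist M) - claim_rate M * mean (claim_dist M \<epsilon>) > 0"

definition exit_vec :: "'m::finite risk_model \<Rightarrow> real^'m" where
  "exit_vec M = - (gain_gen M *v vec 1)"


section \<open>Matrix exponent and scale matrix\<close>

definition phi :: "'m::finite risk_model \<Rightarrow> real \<Rightarrow> complex \<Rightarrow> complex" where
  "phi M \<epsilon> s = of_real (premium M) * s - of_real (claim_rate M) * s *
     (of_real ((1 - \<epsilon>) * mean (claim_p M)) * lst (stationary_excess (claim_p M)) s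
      + of_real (\<epsilon> * mean (claim_h M)) * lst (stationary_excess (claim_h M)) s)"

definition kfun :: "'m::finite risk_model \<Rightarrow> complex \<Rightarrow> complex" where
  "kfun M s = of_real (claim_rate M) *
     (of_real (mean (claim_h M)) * lst (stationary_excess (claim_h M)) s
      - of_real (mean (claim_p M)) * lst (stationary_excess (claim_p M)) s)"

definition T_plus :: "'m::finite risk_model \<Rightarrow> complex \<Rightarrow> complex^'m^'m" where
  "T_plus M s = cmat (gain_gen M) + mat s"

text \<open>Matrices of size \<open>m + 1\<close> are indexed by \<open>'m option\<close>: \<open>None\<close> is the first index, \<open>Some i\<close>
  belongs to phase \<open>i\<close>.\<close>

definition exponent :: "'m::finite risk_model \<Rightarrow> real \<Rightarrow> real \<Rightarrow> complex \<Rightarrow> complex^'m option^'m option"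
  where
  "exponent M \<epsilon> q s = (\<chi> i j. case i of
       None \<Rightarrow> (case j of
           None \<Rightarrow> phi M \<epsilon> s - of_real (gain_rate M) - of_real q
         | Some b \<Rightarrow> of_real (gain_rate M * gain_init M $ b))
     | Some a \<Rightarrow> (case j of
           None \<Rightarrow> of_real (exit_vec M $ a)
         | Some b \<Rightarrow> T_plus M s $ a $ b))"

definition A_coef :: "'m::finite risk_model \<Rightarrow> real \<Rightarrow> real \<Rightarrow> complex" where
  "A_coef M \<epsilon> q =
     inverse (of_real q * matrix_inv (mat (of_real q) - exponent M \<epsilon> 0 0) $ None $ None)"

lemma A_coef_indep: "A_coef M \<epsilon> q = A_coef M 0 q"
proof -
  have "phi M \<epsilon> 0 = phi M 0 0"
    by (simp add: phi_def)
  then show ?thesis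
    by (simp only: A_coef_def exponent_def)
qed

definition is_scale_matrix ::
    "'m::finite risk_model \<Rightarrow> real \<Rightarrow> real \<Rightarrow> (real \<Rightarrow> real^'m option^'m option) \<Rightarrow> bool" where
  "is_scale_matrix M \<epsilon> q W \<longleftrightarrow> continuous_on {0..} W \<and> (\<forall>x<0. W x = 0) \<and>
     (\<exists>s0. \<forall>s>s0. invertible (exponent M \<epsilon> q (of_real s)) \<and>
        (\<forall>i j. set_integrable lborel {0..} (\<lambda>x. exp (- s * x) * W x $ i $ j) \<and>
           complex_of_real (LINT x:{0..}|lborel. exp (- s * x) * W x $ i $ j)
             = matrix_inv (exponent M \<epsilon> q (of_real s)) $ i $ j))"

text \<open>The matrix of signed measures \<open>W(dx)\<close>, for \<open>\<epsilon> = 0\<close>.\<close>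

definition is_scale_measure ::
    "'m::finite risk_model \<Rightarrow> real \<Rightarrow> signed_measure^'m option^'m option \<Rightarrow> bool" where
  "is_scale_measure M q Wd \<longleftrightarrow>
     (\<forall>i j. \<forall>\<nu>\<in>{fst (Wd $ i $ j), snd (Wd $ i $ j)}. sets \<nu> = sets borel \<and> emeasure \<nu> {..<0} = 0) \<and>
     (\<exists>s0. \<forall>s>s0. invertible (exponent M 0 q (of_real s)) \<and>
        (\<forall>i j. set_integrable (fst (Wd $ i $ j)) {0..} (\<lambda>x. exp (- s * x)) \<and>
           set_integrable (snd (Wd $ i $ j)) {0..} (\<lambda>x. exp (- s * x)) \<and>
           complex_of_real (sm_integral (Wd $ i $ j) {0..} (\<lambda>x. exp (- s * x)))
             = of_real s * matrix_inv (exponent M 0 q (of_real s)) $ i $ j))"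


section \<open>Eigenvalues and eigenvectors\<close>

text \<open>A family of \<open>m + 1\<close> roots is a vector \<open>r\<close> indexed by \<open>'m option\<close>.\<close>

definition positive_simple_roots ::
    "'m::finite risk_model \<Rightarrow> real \<Rightarrow> complex^'m option \<Rightarrow> bool" where
  "positive_simple_roots M q r \<longleftrightarrow>
     inj (\<lambda>i. r $ i) \<and>
     range (\<lambda>i. r $ i) = {s. 0 < Re s \<and> det (exponent M 0 q s) = 0} \<and>
     (\<forall>i. deriv (\<lambda>s. det (exponent M 0 q s)) (r $ i) \<noteq> 0)"

definition delta1 :: "'m::finite risk_model \<Rightarrow> real \<Rightarrow> complex^'m option \<Rightarrow> complex^'m option" where
  "delta1 M q r = (\<chi> i. r $ i * kfun M (r $ i) * det (T_plus M (r $ i))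
                        / deriv (\<lambda>s. det (exponent M 0 q s)) (r $ i))"

definition wvec :: "'m::finite risk_model \<Rightarrow> complex \<Rightarrow> complex^'m option" where
  "wvec M s = (\<chi> j. case j of
       None \<Rightarrow> det (T_plus M s)
     | Some b \<Rightarrow> - of_real (gain_rate M) *
         (\<Sum>a\<in>UNIV. of_real (gain_init M $ a) * adjugate (T_plus M s) $ a $ b))"

definition L_mat :: "'m::finite risk_model \<Rightarrow> complex^'m option \<Rightarrow> complex^'m option^'m option" where
  "L_mat M r = (\<chi> i. wvec M (r $ i))"

definition H1_mat ::
    "'m::finite risk_model \<Rightarrow> real \<Rightarrow> complex^'m option \<Rightarrow> complex^'m option^'m option" where
  "H1_mat M q r = (\<chi> i j. delta1 M q r $ i * deriv (\<lambda>s. wvec M s $ j) (r $ i))"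

definition R_mat :: "'m::finite risk_model \<Rightarrow> complex^'m option \<Rightarrow> complex^'m option^'m option" where
  "R_mat M r = matrix_inv (L_mat M r) ** diag_mat r ** L_mat M r"


section \<open>The Gerber--Shiu function and its expansion\<close>

text \<open>The eigenvalues may be complex, so the formulas below are read in the complex numbers.
  In \<open>r_mat\<close> and \<open>GS\<close>, \<open>W\<close> and \<open>r\<close> are the scale matrix and the family of roots
  for the value of \<open>\<epsilon>\<close> in question; in \<open>v_fun\<close> they are those for \<open>\<epsilon> = 0\<close>.\<close>

definition r_mat ::
    "'m::finite risk_model \<Rightarrow> (real \<Rightarrow> real^'m option^'m option) \<Rightarrow> complex^'m option
       \<Rightarrow> real \<Rightarrow> real \<Rightarrow> complex^'m option^'m option" where
  "r_mat M W r u z = cmat (W u) ** mat_exp ((- z) *\<^sub>R R_mat M r) - cmat (W (u - z))"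

definition GS ::
    "'m::finite risk_model \<Rightarrow> (real \<Rightarrow> real \<Rightarrow> real) \<Rightarrow> real \<Rightarrow> real \<Rightarrow> real
       \<Rightarrow> (real \<Rightarrow> real^'m option^'m option) \<Rightarrow> complex^'m option \<Rightarrow> complex" where
  "GS M \<omega> u q \<epsilon> W r = A_coef M \<epsilon> q * of_real (claim_rate M) *
     (LINT z:{0..}|lborel. LINT y:{0..}|shifted (claim_dist M \<epsilon>) z.
        complex_of_real (\<omega> y z) * r_mat M W r u z $ None $ None)"

definition excess_diff :: "'m::finite risk_model \<Rightarrow> real \<Rightarrow> real" where
  "excess_diff M x = mean (claim_h M) * stationary_excess (claim_h M) x
                   - mean (claim_p M) * stationary_excess (claim_p M) x"

definition v_fun ::
    "'m::finite risk_model \<Rightarrow> real \<Rightarrow> (real \<Rightarrow> real^'m option^'m option)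
       \<Rightarrow> signed_measure^'m option^'m option \<Rightarrow> complex^'m option \<Rightarrow> real \<Rightarrow> real \<Rightarrow> complex" where
  "v_fun M q W Wd r u z =
    (let L = L_mat M r; Li = matrix_inv L; H = H1_mat M q r; \<Delta> = diag_mat (delta1 M q r);
         eR = mat_exp ((- z) *\<^sub>R R_mat M r); e\<Lambda> = mat_exp ((- z) *\<^sub>R diag_mat r)
     in (\<Sum>j\<in>UNIV. complex_of_real (claim_rate M *
            sm_integral (sm_convolution (Wd $ None $ None) (Wd $ None $ j)) {0..u}
              (\<lambda>x. excess_diff M (u - x))) * eR $ j $ None)
      + (\<Sum>j\<in>UNIV. complex_of_real (W u $ None $ j) *
            (Li ** e\<Lambda> ** H - z *\<^sub>R (Li ** e\<Lambda> ** \<Delta> ** L) - Li ** H ** eR) $ j $ None)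
      - complex_of_real (claim_rate M *
            sm_integral (sm_convolution (Wd $ None $ None) (Wd $ None $ None)) {0..u - z}
              (\<lambda>x. excess_diff M (u - z - x))))"

end

theory Submission
  imports Defs "HOL-Complex_Analysis.Cauchy_Integral_Formula"
begin

text \<open>Only the first row of the scale matrix enters. The matrix exponents for \<open>\<epsilon>\<close> and \<open>0\<close> differ by
  \<open>- \<epsilon> * s * k(s)\<close> in the \<open>(1,1)\<close> entry, where \<open>k\<close> is the Laplace transform of the difference of the claim
  distribution functions times the claim rate. By the resolvent identity and the uniqueness of Laplace
  transforms, the first row of \<open>W\<^sub>\<epsilon>\<close> solves a Volterra equation whose kernel is the convolution of that
  difference with \<open>W(dx)\<^sub>1\<^sub>1\<close>; one iteration gives the row up to \<open>O(\<epsilon>\<^sup>2)\<close>, uniformly on compact sets.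
  The determinant changes by \<open>- \<epsilon> * s * k(s) * det (T + s I)\<close>, which gives the first-order expansion of the
  simple roots, hence of \<open>L\<^sub>\<epsilon>\<close>, of its inverse and of \<open>exp (- R z) = L\<^sup>-\<^sup>1 exp (- \<Lambda> z) L\<close>. As the roots have positive real
  parts, the remainder is uniform in \<open>z \<ge> 0\<close>, and it can be integrated against the
  penalty because the tails of the claim distributions are integrable.\<close>

section \<open>Measures of exponential growth on the half-line\<close>

text \<open>Each scale matrix is given by continuity and by its Laplace transform beyond an abscissa
  of its own, so nothing uniform in the perturbation parameter is available at the start. The
  Volterra equation supplies the uniformity, because its kernel belongs to the unperturbed problem.
  The measures \<open>W(dx)\<close> are likewise tied to \<open>W\<close> only through transforms.
  This explains the double convolution in \<open>v_fun\<close>: writing w for the entries of F^-1,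
  the first iterate of the Volterra equation has transform (k s w_11) w_1j, the stated term has (k /
  s) (s w_11) (s w_1j), and the division by s integrates the distribution functions into stationary
  excess distributions. Of the perturbed roots only convergence is assumed. Dividing the determinant
  by s - r turns the root equation into rho - r = t Q(rho), which produces the rate of
  convergence.\<close>

definition exp_meas :: "real \<Rightarrow> real measure \<Rightarrow> bool" where
  "exp_meas a \<mu> \<longleftrightarrow> sets \<mu> = sets borel \<and> emeasure \<mu> {..<0} = 0 \<and> integrable \<mu> (\<lambda>x. exp (- a * x))"

text \<open>Continuity on the whole line and vanishing on the negative axis force the value 0 at 0.
  Entries of \<open>W\<close> may jump at 0, so they enter convolutions as densities, through
  \<open>sm_density\<close>.\<close>

definition exp_fun :: "real \<Rightarrow> (real \<Rightarrow> real) \<Rightarrow> bool" where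
  "exp_fun a f \<longleftrightarrow> continuous_on UNIV f \<and> (\<forall>x<0. f x = 0) \<and> (\<exists>C. \<forall>x. \<bar>f x\<bar> \<le> C * exp (a * x))"

definition laplace_m :: "real measure \<Rightarrow> real \<Rightarrow> real" where
  "laplace_m \<mu> s = (LINT x|\<mu>. exp (- s * x))"

definition laplace :: "(real \<Rightarrow> real) \<Rightarrow> real \<Rightarrow> real" where
  "laplace f s = (LINT x|lborel. exp (- s * x) * f x)"

text \<open>This is the convolution over [0, x] as soon as \<open>f\<close> vanishes on the negative
  axis and the measure does not charge it.\<close>

definition mconv :: "(real \<Rightarrow> real) \<Rightarrow> real measure \<Rightarrow> real \<Rightarrow> real" where
  "mconv f \<mu> x = (LINT y|\<mu>. f (x - y))"

lemma exp_measD: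
  assumes "exp_meas a \<mu>"
  shows "sets \<mu> = sets borel" "space \<mu> = UNIV" "AE x in \<mu>. 0 \<le> x" "integrable \<mu> (\<lambda>x. exp (- a * x))"
proof -
  show s: "sets \<mu> = sets borel" using assms by (simp add: exp_meas_def)
  show "space \<mu> = UNIV" using sets_eq_imp_space_eq[OF s] by simp
  have "emeasure \<mu> {..<0} = 0" using assms unfolding exp_meas_def by blast
  then have "{..<0} \<in> null_sets \<mu>" by (intro null_setsI) (simp_all add: s)
  then show "AE x in \<mu>. 0 \<le> x" by (rule AE_I') (simp add: subset_eq)
  show "integrable \<mu> (\<lambda>x. exp (- a * x))" using assms by (simp add: exp_meas_def)
qed

lemma exp_meas_mono:
  assumes "exp_meas a \<mu>" "a \<le> b" shows "exp_meas b \<mu>"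
proof -
  note D = exp_measD[OF assms(1)]
  have [measurable_cong]: "sets \<mu> = sets borel" by fact
  have "integrable \<mu> (\<lambda>x. exp (- b * x))"
  proof (rule Bochner_Integration.integrable_bound[OF D(4)])
    show "AE x in \<mu>. norm (exp (- b * x)) \<le> norm (exp (- a * x))"
      using D(3) by eventually_elim (use assms(2) in \<open>auto intro: mult_right_mono\<close>)
  qed measurable
  then show ?thesis using assms(1) by (simp add: exp_meas_def)
qed

text \<open>Weighting by exp (- a x) gives a finite measure, with respect to which the original one
  has the finite density exp (a x).\<close>

lemma exp_meas_sigma_finite:
  assumes "exp_meas a \<mu>" shows "sigma_finite_measure \<mu>"
proof -
  note D = exp_measD[OF assms]
  have [measurable_cong]: "sets \<mu> = sets borel" by fact
  define \<nu> where "\<nu> = density \<mu> (\<lambda>x. ennreal (exp (- a * x)))"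
  have "emeasure \<nu> (space \<nu>) = (\<integral>\<^sup>+x. ennreal (exp (- a * x)) \<partial>\<mu>)"
    by (auto simp: \<nu>_def emeasure_density intro!: nn_integral_cong)
  also have "\<dots> < \<infinity>"
    using D(4) by (simp add: integrable_iff_bounded)
  finally interpret finite_measure \<nu> by (intro finite_measureI) auto
  have "density \<nu> (\<lambda>x. ennreal (exp (a * x))) = density \<mu> (\<lambda>x. ennreal (exp (- a * x)) * ennreal (exp (a * x)))"
    unfolding \<nu>_def by (rule density_density_eq) measurable
  also have "\<dots> = \<mu>"
    by (simp add: ennreal_mult[symmetric] exp_minus density_1)
  finally have "density \<nu> (\<lambda>x. ennreal (exp (a * x))) = \<mu>" .
  moreover have "sigma_finite_measure (density \<nu> (\<lambda>x. ennreal (exp (a * x))))"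
    by (subst sigma_finite_iff_density_finite) (auto simp: \<nu>_def)
  ultimately show ?thesis by simp
qed

lemma exp_funD:
  assumes "exp_fun a f"
  shows "f \<in> borel_measurable borel" "\<And>x. x < 0 \<Longrightarrow> f x = 0" "isCont f x"
proof -
  have c: "continuous_on UNIV f" using assms by (simp add: exp_fun_def)
  then show "f \<in> borel_measurable borel" by (rule borel_measurable_continuous_onI)
  show "isCont f x" using c by (simp add: continuous_on_eq_continuous_at)
  show "\<And>x. x < 0 \<Longrightarrow> f x = 0" using assms by (simp add: exp_fun_def)
qed

lemma exp_funE:
  assumes "exp_fun a f" obtains C where "0 \<le> C" "\<And>x. \<bar>f x\<bar> \<le> C * exp (a * x)"
proof -
  obtain C where C: "\<And>x. \<bar>f x\<bar> \<le> C * exp (a * x)" using assms by (auto simp: exp_fun_def)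
  have "0 \<le> C" using order_trans[OF abs_ge_zero C[of 0]] by simp
  with C that show thesis by blast
qed

lemma integrable_exp_halfline:
  assumes "0 < (c::real)" shows "integrable lborel (\<lambda>x::real. indicator {0..} x * exp (- c * x))"
proof -
  have "set_integrable lborel {0<..} (\<lambda>x. exp (- (x * c)))"
    using integrable_I0i_exp_mscale[OF assms] by (simp add: mult.commute)
  then have "integrable lborel (\<lambda>x. indicator {0<..} x * exp (- c * x))"
    by (simp add: set_integrable_def mult.commute)
  then show ?thesis
    by (rule integrable_cong_AE_imp, measurable)
       (use AE_lborel_singleton[of "0::real"] in \<open>eventually_elim, auto simp: indicator_def\<close>)
qed

lemma exp_bounded_integrable:
  fixes f :: "real \<Rightarrow> real"
  assumes [measurable]: "f \<in> borel_measurable borel" and z: "\<And>x. x < 0 \<Longrightarrow> f x = 0"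
    and C: "\<And>x. \<bar>f x\<bar> \<le> C * exp (a * x)" and s: "a < s"
  shows "integrable lborel (\<lambda>x. exp (- s * x) * f x)"
proof (rule Bochner_Integration.integrable_bound)
  show "integrable lborel (\<lambda>x. C * (indicator {0..} x * exp (- (s - a) * x)))"
    using integrable_mult_right[OF integrable_exp_halfline[of "s - a"], of C] s by simp
  have "0 \<le> C" using order_trans[OF abs_ge_zero C[of 0]] by simp
  have "\<bar>exp (- s * x) * f x\<bar> \<le> C * (indicator {0..} x * exp (- (s - a) * x))" for x
  proof (cases "x < 0")
    case False
    have "\<bar>exp (- s * x) * f x\<bar> \<le> exp (- s * x) * (C * exp (a * x))"
      using C[of x] by (simp add: abs_mult)
    also have "\<dots> = C * exp (- (s - a) * x)"
      by (simp add: exp_add[symmetric] algebra_simps)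
    finally show ?thesis using False by simp
  qed (simp add: z)
  then show "AE x in lborel. norm (exp (- s * x) * f x) \<le> norm (C * (indicator {0..} x * exp (- (s - a) * x)))"
    using \<open>0 \<le> C\<close> by (auto simp: abs_mult)
qed measurable

lemma exp_fun_integrable:
  assumes "exp_fun a f" "a < s" shows "integrable lborel (\<lambda>x. exp (- s * x) * f x)"
proof -
  obtain C where "\<And>x. \<bar>f x\<bar> \<le> C * exp (a * x)" using exp_funE[OF assms(1)] by blast
  from exp_bounded_integrable[OF exp_funD(1)[OF assms(1)] exp_funD(2)[OF assms(1)] this assms(2)] show ?thesis by simp
qed

text \<open>The growth of \<open>f\<close> is matched with the weight of the measure: |f (x - y)| is
  at most C exp (a x) exp (- a y) for every y, and the last factor is integrable.\<close>

lemma mconv_integrable: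
  assumes \<mu>: "exp_meas a \<mu>" and [measurable]: "f \<in> borel_measurable borel" and C: "\<And>x. \<bar>f x\<bar> \<le> C * exp (a * x)"
  shows "integrable \<mu> (\<lambda>y. f (x - y))"
proof (rule Bochner_Integration.integrable_bound)
  note D = exp_measD[OF \<mu>]
  have [measurable_cong]: "sets \<mu> = sets borel" by fact
  show "integrable \<mu> (\<lambda>y. (C * exp (a * x)) * exp (- a * y))"
    using D(4) by (rule integrable_mult_right)
  have "0 \<le> C" using order_trans[OF abs_ge_zero C[of 0]] by simp
  have "\<bar>f (x - y)\<bar> \<le> (C * exp (a * x)) * exp (- a * y)" for y
    using C[of "x - y"] by (simp add: mult.assoc exp_add[symmetric] algebra_simps)
  then show "AE y in \<mu>. norm (f (x - y)) \<le> norm ((C * exp (a * x)) * exp (- a * y))"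
    using \<open>0 \<le> C\<close> by (auto simp: abs_mult)
  show "(\<lambda>y. f (x - y)) \<in> borel_measurable \<mu>" by measurable
qed

text \<open>Fubini and the substitution x -> x - y. Stated for measurable \<open>f\<close>, so that
  it covers the indicator of the half-line, which jumps at 0.\<close>

lemma laplace_mconv:
  assumes \<mu>: "exp_meas a \<mu>" and [measurable]: "f \<in> borel_measurable borel" and z: "\<And>x. x < 0 \<Longrightarrow> f x = 0"
    and C: "\<And>x. \<bar>f x\<bar> \<le> C * exp (a * x)" and s: "a < s"
  shows "integrable lborel (\<lambda>x. exp (- s * x) * mconv f \<mu> x)"
    and "laplace (mconv f \<mu>) s = laplace f s * laplace_m \<mu> s"
proof -
  note D = exp_measD[OF \<mu>] and Ds = exp_measD[OF exp_meas_mono[OF \<mu> less_imp_le[OF s]]]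
  have [measurable_cong]: "sets \<mu> = sets borel" by fact
  interpret \<mu>: sigma_finite_measure \<mu> by (rule exp_meas_sigma_finite[OF \<mu>])
  interpret P: pair_sigma_finite \<mu> lborel ..
  let ?g = "\<lambda>x. exp (- s * x) * f x"
  note int = exp_bounded_integrable[OF assms(2) z C s]
  \<comment> \<open>The argument keeps the affine form \<open>- y + 1 * x\<close>, in which
    \<open>lborel_integral_real_affine\<close> applies.\<close>
  have shift: "exp (- s * x) * f (x - y) = exp (- s * y) * ?g (- y + 1 * x)" for x y
  proof -
    have "- s * x = - s * y + - s * (- y + 1 * x)" by (simp add: algebra_simps)
    then have "exp (- s * x) = exp (- s * y) * exp (- s * (- y + 1 * x))" by (metis exp_add)
    then show ?thesis by simp
  qed
  have inner: "integrable lborel (\<lambda>x. exp (- s * x) * f (x - y))" for y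
    unfolding shift by (intro integrable_mult_right lborel_integrable_real_affine int) auto
  have ival: "(LINT x|lborel. exp (- s * x) * f (x - y)) = exp (- s * y) * laplace f s" for y
    unfolding shift laplace_def
    using lborel_integral_real_affine[of 1 ?g "- y"] by simp
  have inorm: "(LINT x|lborel. norm (exp (- s * x) * f (x - y))) = exp (- s * y) * (LINT x|lborel. norm (?g x))" for y
  proof -
    have "norm (exp (- s * x) * f (x - y)) = exp (- s * y) * norm (?g (- y + 1 * x))" for x
      unfolding shift by (simp add: abs_mult)
    then show ?thesis using lborel_integral_real_affine[of 1 "\<lambda>x. norm (?g x)" "- y"] by simp
  qed
  have pint: "integrable (\<mu> \<Otimes>\<^sub>M lborel) (\<lambda>(y, x). exp (- s * x) * f (x - y))"
  proof (rule P.Fubini_integrable)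
    show "integrable \<mu> (\<lambda>y. LINT x|lborel. norm (case (y, x) of (y, x) \<Rightarrow> exp (- s * x) * f (x - y)))"
      using Ds(4) by (simp only: split_conv inorm) (rule integrable_mult_left)
    show "AE y in \<mu>. integrable lborel (\<lambda>x. case (y, x) of (y, x) \<Rightarrow> exp (- s * x) * f (x - y))"
      using inner by simp
  qed measurable
  show "integrable lborel (\<lambda>x. exp (- s * x) * mconv f \<mu> x)"
    using P.integrable_snd[OF pint] by (simp add: mconv_def)
  have "laplace (mconv f \<mu>) s = (LINT x|lborel. LINT y|\<mu>. exp (- s * x) * f (x - y))"
    by (simp add: laplace_def mconv_def)
  also have "\<dots> = (LINT y|\<mu>. LINT x|lborel. exp (- s * x) * f (x - y))"
    using P.Fubini_integral[OF pint] .
  also have "\<dots> = laplace f s * laplace_m \<mu> s"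
    unfolding ival laplace_m_def by simp
  finally show "laplace (mconv f \<mu>) s = laplace f s * laplace_m \<mu> s" .
qed

text \<open>Continuity comes from dominated convergence along a convergent, hence bounded, sequence
  of arguments. As \<open>0 \<le> a\<close>, the factor exp (a x) is monotone, and one dominating
  function serves the whole sequence.\<close>

lemma mconv_exp_fun:
  assumes \<mu>: "exp_meas a \<mu>" and f: "exp_fun a f" and a: "0 \<le> a"
  shows "exp_fun a (mconv f \<mu>)"
proof -
  note D = exp_measD[OF \<mu>]
  have [measurable_cong]: "sets \<mu> = sets borel" by fact
  have [measurable]: "f \<in> borel_measurable borel" using exp_funD(1)[OF f] .
  obtain C where C0: "0 \<le> C" and C: "\<And>x. \<bar>f x\<bar> \<le> C * exp (a * x)" using exp_funE[OF f] by blast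
  have C': "\<bar>f (x - y)\<bar> \<le> (C * exp (a * x)) * exp (- a * y)" for x y
    using C[of "x - y"] by (simp add: mult.assoc exp_add[symmetric] algebra_simps)
  note int = mconv_integrable[OF \<mu> exp_funD(1)[OF f] C]
  have bound: "\<bar>mconv f \<mu> x\<bar> \<le> (C * laplace_m \<mu> a) * exp (a * x)" for x
  proof -
    have "\<bar>mconv f \<mu> x\<bar> \<le> (LINT y|\<mu>. \<bar>f (x - y)\<bar>)"
      unfolding mconv_def by (rule integral_abs_bound)
    also have "\<dots> \<le> (LINT y|\<mu>. (C * exp (a * x)) * exp (- a * y))"
      using int C' D(4) by (intro integral_mono integrable_abs integrable_mult_right) auto
    finally show ?thesis by (simp add: laplace_m_def mult_ac)
  qed
  have neg: "mconv f \<mu> x = 0" if "x < 0" for x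
  proof -
    have "mconv f \<mu> x = (LINT y|\<mu>. 0)" unfolding mconv_def
      by (rule integral_cong_AE, measurable)
         (use D(3) in \<open>eventually_elim, use that exp_funD(2)[OF f] in auto\<close>)
    then show ?thesis by simp
  qed
  have cont: "isCont (mconv f \<mu>) x" for x
  proof (unfold continuous_at_sequentially, intro allI impI)
    fix X :: "nat \<Rightarrow> real" assume X: "X \<longlonglongrightarrow> x"
    then obtain U where U: "\<And>n. \<bar>X n\<bar> \<le> U" using convergent_imp_Bseq[OF convergentI[OF X]] by (auto simp: Bseq_def)
    show "(mconv f \<mu> \<circ> X) \<longlonglongrightarrow> mconv f \<mu> x"
      unfolding comp_def mconv_def
    proof (rule integral_dominated_convergence)
      show "integrable \<mu> (\<lambda>y. (C * exp (a * U)) * exp (- a * y))"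
        using D(4) by (rule integrable_mult_right)
      show "AE y in \<mu>. (\<lambda>n. f (X n - y)) \<longlonglongrightarrow> f (x - y)"
        by (intro AE_I2 isCont_tendsto_compose[OF exp_funD(3)[OF f]] tendsto_intros X)
      have "\<bar>f (X n - y)\<bar> \<le> (C * exp (a * U)) * exp (- a * y)" for n y
      proof -
        have "a * X n \<le> a * U" using U[of n] a by (intro mult_left_mono) auto
        then have "C * exp (a * X n) \<le> C * exp (a * U)" using C0 by (intro mult_left_mono) auto
        then have "(C * exp (a * X n)) * exp (- a * y) \<le> (C * exp (a * U)) * exp (- a * y)"
          by (intro mult_right_mono) auto
        with C'[of "X n" y] show ?thesis by linarith
      qed
      then show "AE y in \<mu>. norm (f (X n - y)) \<le> (C * exp (a * U)) * exp (- a * y)" for n by simp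
    qed measurable
  qed
  show ?thesis
    unfolding exp_fun_def using bound neg cont by (metis continuous_at_imp_continuous_on)
qed

text \<open>Both measures may have infinite mass. Sigma-finiteness is enough for Fubini, and exp (-
  s (x + y)) splits into a product.\<close>

lemma exp_meas_convolution:
  assumes \<mu>: "exp_meas a \<mu>" and \<nu>: "exp_meas a \<nu>"
  shows "exp_meas a (\<mu> \<star> \<nu>)" and "a \<le> s \<Longrightarrow> laplace_m (\<mu> \<star> \<nu>) s = laplace_m \<mu> s * laplace_m \<nu> s"
proof -
  note D = exp_measD[OF \<mu>] and D' = exp_measD[OF \<nu>]
  have [measurable_cong]: "sets \<mu> = sets borel" "sets \<nu> = sets borel" by fact+
  interpret \<mu>: sigma_finite_measure \<mu> by (rule exp_meas_sigma_finite[OF \<mu>])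
  interpret \<nu>: sigma_finite_measure \<nu> by (rule exp_meas_sigma_finite[OF \<nu>])
  interpret P: pair_sigma_finite \<mu> \<nu> ..
  have ind: "integrable (\<mu> \<Otimes>\<^sub>M \<nu>) (\<lambda>(x, y). exp (- s * (x + y)))" if "a \<le> s" for s
  proof -
    have e: "exp (- s * (x + y)) = exp (- s * x) * exp (- s * y)" for x y
      by (simp add: exp_add[symmetric] distrib_left)
    note I = exp_measD(4)[OF exp_meas_mono[OF \<mu> that]] and I' = exp_measD(4)[OF exp_meas_mono[OF \<nu> that]]
    show ?thesis
    proof (rule P.Fubini_integrable)
      show "AE x in \<mu>. integrable \<nu> (\<lambda>y. case (x, y) of (x, y) \<Rightarrow> exp (- s * (x + y)))"
        using I' by (simp only: e split_conv) simp
      show "integrable \<mu> (\<lambda>x. LINT y|\<nu>. norm (case (x, y) of (x, y) \<Rightarrow> exp (- s * (x + y))))"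
        using I by (simp only: e split_conv) simp
    qed measurable
  qed
  have int: "integrable (\<mu> \<star> \<nu>) (\<lambda>x. exp (- a * x))"
    unfolding convolution_def using ind[of a] by (subst integrable_distr_eq) (simp_all add: split_beta')
  have "AE z in \<mu> \<Otimes>\<^sub>M \<nu>. \<not> fst z + snd z < 0"
  proof (rule P.AE_pair_measure)
    show "{x \<in> space (\<mu> \<Otimes>\<^sub>M \<nu>). \<not> fst x + snd x < 0} \<in> sets (\<mu> \<Otimes>\<^sub>M \<nu>)" by measurable
    show "AE x in \<mu>. AE y in \<nu>. \<not> fst (x, y) + snd (x, y) < 0"
      using D(3) by eventually_elim (use D'(3) in \<open>eventually_elim, auto\<close>)
  qed
  then have "emeasure (\<mu> \<star> \<nu>) {..<0} = 0"
    unfolding convolution_def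
    by (subst emeasure_distr)
       (auto simp: vimage_def case_prod_beta Int_def conj_commute dest!: emeasure_eq_0_AE)
  with int show "exp_meas a (\<mu> \<star> \<nu>)" by (simp add: exp_meas_def)
  show "laplace_m (\<mu> \<star> \<nu>) s = laplace_m \<mu> s * laplace_m \<nu> s" if "a \<le> s"
  proof -
    have "laplace_m (\<mu> \<star> \<nu>) s = (LINT (x, y)|(\<mu> \<Otimes>\<^sub>M \<nu>). exp (- s * (x + y)))"
      unfolding laplace_m_def convolution_def by (subst integral_distr) (simp_all add: split_beta')
    also have "\<dots> = (LINT x|\<mu>. LINT y|\<nu>. exp (- s * (x + y)))"
      using P.integral_fst[OF ind[OF that]] by simp
    also have "\<dots> = laplace_m \<mu> s * laplace_m \<nu> s"
      by (simp add: laplace_m_def distrib_left exp_add exp_diff exp_minus divide_inverse)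
    finally show ?thesis .
  qed
qed

section \<open>Signed measures\<close>

lemma sets_lincomb [simp, measurable_cong]: "sets (lincomb_measure a \<mu> b \<nu>) = sets borel"
  by (simp add: lincomb_measure_def sets.sigma_sets_eq[of borel, simplified])

lemma emeasure_lincomb:
  assumes [simp]: "sets \<mu> = sets borel" "sets \<nu> = sets borel" and A: "A \<in> sets borel"
  shows "emeasure (lincomb_measure a \<mu> b \<nu>) A = ennreal a * emeasure \<mu> A + ennreal b * emeasure \<nu> A"
proof (rule emeasure_measure_of[OF lincomb_measure_def])
  let ?m = "\<lambda>B. ennreal a * emeasure \<mu> B + ennreal b * emeasure \<nu> B"
  show "positive (sets (lincomb_measure a \<mu> b \<nu>)) ?m" by (simp add: positive_def)
  show "countably_additive (sets (lincomb_measure a \<mu> b \<nu>)) ?m"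
  proof (rule countably_additiveI)
    fix X :: "nat \<Rightarrow> real set"
    assume X: "range X \<subseteq> sets (lincomb_measure a \<mu> b \<nu>)" "disjoint_family X"
    then have "(\<Sum>i. emeasure \<mu> (X i)) = emeasure \<mu> (\<Union>i. X i)" "(\<Sum>i. emeasure \<nu> (X i)) = emeasure \<nu> (\<Union>i. X i)"
      by (auto intro!: suminf_emeasure)
    then show "(\<Sum>i. ?m (X i)) = ?m (\<Union>i. X i)"
      by (simp add: suminf_add[symmetric])
  qed
qed (use A in auto)

lemma nn_integral_lincomb:
  assumes s: "sets \<mu> = sets borel" "sets \<nu> = sets borel" and f: "f \<in> borel_measurable borel"
  shows "(\<integral>\<^sup>+x. f x \<partial>lincomb_measure a \<mu> b \<nu>) = ennreal a * (\<integral>\<^sup>+x. f x \<partial>\<mu>) + ennreal b * (\<integral>\<^sup>+x. f x \<partial>\<nu>)"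
proof -
  have [measurable_cong]: "sets \<mu> = sets borel" "sets \<nu> = sets borel" by fact+
  have sp: "space \<mu> = UNIV" "space \<nu> = UNIV" using s[THEN sets_eq_imp_space_eq] by auto
  from f show ?thesis
  proof (induction rule: borel_measurable_induct)
    case (cong f g)
    then have "f = g" by auto
    with cong show ?case by simp
  next
    case (set A)
    then show ?case using s by (simp add: emeasure_lincomb)
  next
    case (mult u c)
    then show ?case by (simp add: nn_integral_cmult algebra_simps)
  next
    case (add u v)
    then show ?case by (simp add: nn_integral_add algebra_simps)
  next
    case (seq U)
    have m: "U i \<in> borel_measurable \<mu>" "U i \<in> borel_measurable \<nu>" "U i \<in> borel_measurable (lincomb_measure a \<mu> b \<nu>)" for i
      using \<open>\<And>i. U i \<in> borel_measurable borel\<close>[of i] by measurable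
    have i: "incseq (\<lambda>i. integral\<^sup>N \<mu> (U i))" "incseq (\<lambda>i. integral\<^sup>N \<nu> (U i))"
      by (auto simp: incseq_def intro!: nn_integral_mono incseqD[OF \<open>incseq U\<close>, THEN le_funD])
    show ?case
      unfolding SUP_apply
      using \<open>incseq U\<close> i m
      by (simp add: nn_integral_monotone_convergence_SUP seq.IH SUP_mult_left_ennreal
          ennreal_SUP_add incseq_def mult_left_mono)
  qed
qed

lemma integral_lincomb:
  fixes f :: "real \<Rightarrow> real"
  assumes s: "sets \<mu> = sets borel" "sets \<nu> = sets borel" and ab: "0 \<le> a" "0 \<le> b"
    and i: "integrable \<mu> f" "integrable \<nu> f"
  shows "integrable (lincomb_measure a \<mu> b \<nu>) f"
    and "(LINT x|lincomb_measure a \<mu> b \<nu>. f x) = a * (LINT x|\<mu>. f x) + b * (LINT x|\<nu>. f x)"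
proof -
  have f: "f \<in> borel_measurable borel" using i(1) s(1) by (metis borel_measurable_integrable measurable_cong_sets)
  have fm: "f \<in> borel_measurable (lincomb_measure a \<mu> b \<nu>)" using f by measurable
  have n: "(\<integral>\<^sup>+x. ennreal (g x) \<partial>lincomb_measure a \<mu> b \<nu>)
      = ennreal a * (\<integral>\<^sup>+x. ennreal (g x) \<partial>\<mu>) + ennreal b * (\<integral>\<^sup>+x. ennreal (g x) \<partial>\<nu>)"
    if "g \<in> borel_measurable borel" for g :: "real \<Rightarrow> real"
    using that by (intro nn_integral_lincomb s) measurable
  have fin: "(\<integral>\<^sup>+x. ennreal (norm (f x)) \<partial>\<mu>) < \<infinity>" "(\<integral>\<^sup>+x. ennreal (norm (f x)) \<partial>\<nu>) < \<infinity>"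
    using i by (auto simp: integrable_iff_bounded)
  have [measurable]: "f \<in> borel_measurable borel" by fact
  show I: "integrable (lincomb_measure a \<mu> b \<nu>) f"
    unfolding integrable_iff_bounded
  proof (intro conjI fm)
    have "(\<integral>\<^sup>+x. ennreal (norm (f x)) \<partial>lincomb_measure a \<mu> b \<nu>)
        = ennreal a * (\<integral>\<^sup>+x. ennreal (norm (f x)) \<partial>\<mu>) + ennreal b * (\<integral>\<^sup>+x. ennreal (norm (f x)) \<partial>\<nu>)"
      by (rule n) measurable
    also have "\<dots> < \<infinity>" using fin by (auto simp: ennreal_mult_less_top)
    finally show "(\<integral>\<^sup>+x. ennreal (norm (f x)) \<partial>lincomb_measure a \<mu> b \<nu>) < \<infinity>" .
  qed
  \<comment> \<open>Applied to \<open>f\<close> and to its negative, whose nonnegative integrals are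
    the two parts of the real integral.\<close>
  have e: "enn2real (\<integral>\<^sup>+x. ennreal (g x) \<partial>lincomb_measure a \<mu> b \<nu>)
      = a * enn2real (\<integral>\<^sup>+x. ennreal (g x) \<partial>\<mu>) + b * enn2real (\<integral>\<^sup>+x. ennreal (g x) \<partial>\<nu>)"
    if [measurable]: "g \<in> borel_measurable borel" and g: "\<And>x. g x \<le> norm (f x)" for g :: "real \<Rightarrow> real"
  proof -
    have "(\<integral>\<^sup>+x. ennreal (g x) \<partial>m) \<le> (\<integral>\<^sup>+x. ennreal (norm (f x)) \<partial>m)" for m
      by (intro nn_integral_mono ennreal_leI g)
    then have "(\<integral>\<^sup>+x. ennreal (g x) \<partial>\<mu>) < \<infinity>" "(\<integral>\<^sup>+x. ennreal (g x) \<partial>\<nu>) < \<infinity>"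
      using fin by (metis le_less_trans)+
    then show ?thesis using ab
      by (subst n) (auto simp: enn2real_plus ennreal_mult_less_top enn2real_mult)
  qed
  show "(LINT x|lincomb_measure a \<mu> b \<nu>. f x) = a * (LINT x|\<mu>. f x) + b * (LINT x|\<nu>. f x)"
    unfolding real_lebesgue_integral_def[OF I] real_lebesgue_integral_def[OF i(1)] real_lebesgue_integral_def[OF i(2)]
    by (subst (1 2) e) (auto simp: algebra_simps)
qed

lemma exp_meas_lincomb:
  assumes \<mu>: "exp_meas a \<mu>" and \<nu>: "exp_meas a \<nu>"
  shows "exp_meas a (lincomb_measure 1 \<mu> 1 \<nu>)"
    and "a \<le> s \<Longrightarrow> laplace_m (lincomb_measure 1 \<mu> 1 \<nu>) s = laplace_m \<mu> s + laplace_m \<nu> s"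
proof -
  note D = exp_measD[OF \<mu>] and D' = exp_measD[OF \<nu>]
  show "exp_meas a (lincomb_measure 1 \<mu> 1 \<nu>)"
    using \<mu> \<nu> integral_lincomb(1)[OF D(1) D'(1) _ _ D(4) D'(4)]
    by (simp add: exp_meas_def emeasure_lincomb)
  show "laplace_m (lincomb_measure 1 \<mu> 1 \<nu>) s = laplace_m \<mu> s + laplace_m \<nu> s" if "a \<le> s"
    using exp_measD(4)[OF exp_meas_mono[OF \<mu> that]] exp_measD(4)[OF exp_meas_mono[OF \<nu> that]]
    by (simp add: laplace_m_def integral_lincomb D(1) D'(1))
qed

definition sexp_meas :: "real \<Rightarrow> signed_measure \<Rightarrow> bool" where
  "sexp_meas a N \<longleftrightarrow> exp_meas a (fst N) \<and> exp_meas a (snd N)"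

definition laplace_sm :: "signed_measure \<Rightarrow> real \<Rightarrow> real" where
  "laplace_sm N s = laplace_m (fst N) s - laplace_m (snd N) s"

definition sconv :: "(real \<Rightarrow> real) \<Rightarrow> signed_measure \<Rightarrow> real \<Rightarrow> real" where
  "sconv f N x = mconv f (fst N) x - mconv f (snd N) x"

lemma exp_fun_diff: "exp_fun a f \<Longrightarrow> exp_fun a g \<Longrightarrow> exp_fun a (\<lambda>x. f x - g x)"
proof -
  assume f: "exp_fun a f" and g: "exp_fun a g"
  obtain C where C: "\<And>x. \<bar>f x\<bar> \<le> C * exp (a * x)" using exp_funE[OF f] by blast
  obtain D where D: "\<And>x. \<bar>g x\<bar> \<le> D * exp (a * x)" using exp_funE[OF g] by blast
  have "\<bar>f x - g x\<bar> \<le> (C + D) * exp (a * x)" for x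
    using C[of x] D[of x] by (simp add: distrib_right)
  then show ?thesis using f g by (auto simp: exp_fun_def intro: continuous_on_diff)
qed

lemma sconv_exp_fun: "sexp_meas a N \<Longrightarrow> exp_fun a f \<Longrightarrow> 0 \<le> a \<Longrightarrow> exp_fun a (sconv f N)"
  unfolding sconv_def by (intro exp_fun_diff mconv_exp_fun) (auto simp: sexp_meas_def)

lemma laplace_sconv_measurable:
  assumes N: "sexp_meas a N" and f: "f \<in> borel_measurable borel" and z: "\<And>x. x < 0 \<Longrightarrow> f x = 0"
    and C: "\<And>x. \<bar>f x\<bar> \<le> C * exp (a * x)" and s: "a < s"
  shows "integrable lborel (\<lambda>x. exp (- s * x) * sconv f N x)"
    and "laplace (sconv f N) s = laplace f s * laplace_sm N s"
proof -
  have N1: "exp_meas a (fst N)" and N2: "exp_meas a (snd N)" using N by (auto simp: sexp_meas_def)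
  note L1 = laplace_mconv[OF N1 f z C s] and L2 = laplace_mconv[OF N2 f z C s]
  show "integrable lborel (\<lambda>x. exp (- s * x) * sconv f N x)"
    using L1(1) L2(1) by (simp add: sconv_def right_diff_distrib)
  have "laplace (sconv f N) s = laplace (mconv f (fst N)) s - laplace (mconv f (snd N)) s"
    using L1(1) L2(1) by (simp add: laplace_def sconv_def right_diff_distrib)
  with L1(2) L2(2) show "laplace (sconv f N) s = laplace f s * laplace_sm N s"
    by (simp add: laplace_sm_def right_diff_distrib)
qed

lemma laplace_sconv:
  assumes N: "sexp_meas a N" and f: "exp_fun a f" and s: "a < s"
  shows "laplace (sconv f N) s = laplace f s * laplace_sm N s"
proof -
  obtain C where C: "\<And>x. \<bar>f x\<bar> \<le> C * exp (a * x)" using exp_funE[OF f] by blast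
  from laplace_sconv_measurable(2)[OF N exp_funD(1,2)[OF f] C s] show ?thesis by simp
qed

lemma sexp_meas_convolution:
  assumes N: "sexp_meas a N" and K: "sexp_meas a K"
  shows "sexp_meas a (sm_convolution N K)" and "a \<le> s \<Longrightarrow> laplace_sm (sm_convolution N K) s = laplace_sm N s * laplace_sm K s"
proof -
  have N: "exp_meas a (fst N)" "exp_meas a (snd N)" "exp_meas a (fst K)" "exp_meas a (snd K)"
    using assms by (auto simp: sexp_meas_def)
  then show "sexp_meas a (sm_convolution N K)"
    by (simp add: sexp_meas_def sm_convolution_def exp_meas_lincomb exp_meas_convolution)
  show "laplace_sm (sm_convolution N K) s = laplace_sm N s * laplace_sm K s" if "a \<le> s"
    using that N by (simp add: laplace_sm_def sm_convolution_def exp_meas_lincomb(2)[where a = a]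
        exp_meas_convolution[where a = a] algebra_simps)
qed

text \<open>Points beyond \<open>u\<close> contribute nothing because \<open>f\<close> vanishes on
  the negative axis. For negative \<open>u\<close> the interval is empty and both sides are 0, which
  is the convention for z > u in the last term of \<open>v_fun\<close>.\<close>

lemma sm_integral_eq_sconv:
  assumes N: "sexp_meas a N" and f: "exp_fun a f"
  shows "sm_integral N {0..u} (\<lambda>x. f (u - x)) = sconv f N u"
proof -
  have [measurable]: "f \<in> borel_measurable borel" using exp_funD(1)[OF f] .
  have "(LINT x:{0..u}|\<mu>. f (u - x)) = mconv f \<mu> u" if "exp_meas a \<mu>" for \<mu>
  proof -
    note D = exp_measD[OF that]
    have [measurable_cong]: "sets \<mu> = sets borel" by fact
    show ?thesis unfolding set_lebesgue_integral_def mconv_def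
      by (rule integral_cong_AE, measurable)
         (use D(3) in \<open>eventually_elim, use exp_funD(2)[OF f] in \<open>auto simp: indicator_def\<close>\<close>)
  qed
  then show ?thesis using N by (simp add: sm_integral_def sconv_def sexp_meas_def)
qed

text \<open>The parts are the densities max(b, 0) and max(- b, 0). In this way a merely measurable
  function becomes the measure factor of \<open>sconv\<close>, and the other factor provides
  continuity.\<close>

definition sm_density :: "(real \<Rightarrow> real) \<Rightarrow> signed_measure" where
  "sm_density b = (density lborel (\<lambda>x. ennreal (max 0 (b x))), density lborel (\<lambda>x. ennreal (max 0 (- b x))))"

lemma sexp_meas_sm_density:
  assumes [measurable]: "b \<in> borel_measurable borel" and z: "\<And>x. x < 0 \<Longrightarrow> b x = 0"
    and i: "integrable lborel (\<lambda>x. exp (- a * x) * b x)"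
  shows "sexp_meas a (sm_density b)"
proof -
  \<comment> \<open>Meant for \<open>c = b\<close> and \<open>c = - b\<close>, whose positive parts
    are the two densities.\<close>
  have p: "integrable lborel (\<lambda>x. max 0 (c x) * exp (- a * x))"
    if [measurable]: "c \<in> borel_measurable borel" and c: "\<And>x. \<bar>c x\<bar> = \<bar>b x\<bar>" for c
    by (rule Bochner_Integration.integrable_bound[OF i]) (auto simp: abs_mult c[symmetric])
  have "exp_meas a (density lborel (\<lambda>x. ennreal (max 0 (c x))))"
    if [measurable]: "c \<in> borel_measurable borel" and c: "\<And>x. \<bar>c x\<bar> = \<bar>b x\<bar>" for c
  proof -
    have "c x = 0" if "x < 0" for x using c[of x] z[OF that] by simp
    then have "emeasure (density lborel (\<lambda>x. ennreal (max 0 (c x)))) {..<0} = 0"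
      by (subst emeasure_density) (auto simp: nn_integral_0_iff_AE indicator_def)
    moreover have "integrable (density lborel (\<lambda>x. ennreal (max 0 (c x)))) (\<lambda>x. exp (- a * x))"
      by (subst integrable_real_density) (use p[OF that] in auto)
    ultimately show ?thesis unfolding exp_meas_def by simp
  qed
  from this[of b] this[of "\<lambda>x. - b x"] show ?thesis by (simp add: sexp_meas_def sm_density_def)
qed

lemma sm_density_integral:
  assumes [measurable]: "b \<in> borel_measurable borel" "g \<in> borel_measurable borel"
    and i: "integrable lborel (\<lambda>x. g x * b x)"
  shows "(LINT x|fst (sm_density b). g x) - (LINT x|snd (sm_density b). g x) = (LINT x|lborel. g x * b x)"
proof -
  have p: "integrable lborel (\<lambda>x. max 0 (c x) * g x)"
    if [measurable]: "c \<in> borel_measurable borel" and c: "\<And>x. \<bar>c x\<bar> = \<bar>b x\<bar>" for c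
  proof (rule Bochner_Integration.integrable_bound[OF i])
    have "max 0 (c x) * \<bar>g x\<bar> \<le> \<bar>b x\<bar> * \<bar>g x\<bar>" for x
      unfolding c[symmetric] by (rule mult_right_mono) auto
    then show "AE x in lborel. norm (max 0 (c x) * g x) \<le> norm (g x * b x)"
      by (simp add: abs_mult mult.commute)
  qed measurable
  have "(LINT x|fst (sm_density b). g x) - (LINT x|snd (sm_density b). g x)
      = (LINT x|lborel. max 0 (b x) * g x - max 0 (- b x) * g x)"
    using p[of b] p[of "\<lambda>x. - b x"]
    by (simp add: sm_density_def integral_real_density del: ennreal_max_0 ennreal_max_0')
  also have "\<dots> = (LINT x|lborel. g x * b x)"
    by (rule Bochner_Integration.integral_cong) (auto simp: max_def)
  finally show ?thesis .
qed

lemma laplace_sm_sm_density: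
  assumes [measurable]: "b \<in> borel_measurable borel" and "integrable lborel (\<lambda>x. exp (- s * x) * b x)"
  shows "laplace_sm (sm_density b) s = laplace b s"
  unfolding laplace_sm_def laplace_m_def laplace_def by (rule sm_density_integral) (use assms in measurable)

lemma mconv_sm_density_integrable:
  fixes b f :: "real \<Rightarrow> real"
  assumes [measurable]: "b \<in> borel_measurable borel" "f \<in> borel_measurable borel"
    and i: "integrable lborel (\<lambda>x. exp (- a * x) * b x)" and C: "\<And>x. \<bar>f x\<bar> \<le> C * exp (a * x)"
  shows "integrable lborel (\<lambda>y. f (x - y) * b y)"
proof (rule Bochner_Integration.integrable_bound)
  show "integrable lborel (\<lambda>y. (C * exp (a * x)) * (exp (- a * y) * b y))"
    using i by (rule integrable_mult_right)
  have "0 \<le> C" using order_trans[OF abs_ge_zero C[of 0]] by simp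
  have "\<bar>f (x - y)\<bar> \<le> (C * exp (a * x)) * exp (- a * y)" for y
    using C[of "x - y"] by (simp add: mult.assoc exp_add[symmetric] algebra_simps)
  then have "\<bar>f (x - y)\<bar> * \<bar>b y\<bar> \<le> (C * exp (a * x)) * exp (- a * y) * \<bar>b y\<bar>" for y
    by (rule mult_right_mono) simp
  then show "AE y in lborel. norm (f (x - y) * b y) \<le> norm ((C * exp (a * x)) * (exp (- a * y) * b y))"
    using \<open>0 \<le> C\<close> by (auto simp: abs_mult mult.assoc)
qed measurable

lemma sconv_sm_density:
  fixes b f :: "real \<Rightarrow> real"
  assumes [measurable]: "b \<in> borel_measurable borel" "f \<in> borel_measurable borel"
    and i: "integrable lborel (\<lambda>x. exp (- a * x) * b x)" and C: "\<And>x. \<bar>f x\<bar> \<le> C * exp (a * x)"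
  shows "sconv f (sm_density b) x = (LINT y|lborel. f (x - y) * b y)"
  unfolding sconv_def mconv_def by (rule sm_density_integral) (use mconv_sm_density_integrable[OF assms] in measurable)

section \<open>Uniqueness of Laplace transforms\<close>

lemma borel_measurable_halfline:
  fixes f :: "real \<Rightarrow> real"
  assumes c: "continuous_on {0..} f" and z: "\<And>x. x < 0 \<Longrightarrow> f x = 0"
  shows "f \<in> borel_measurable borel"
proof -
  have "(\<lambda>x. indicator {0..} x *\<^sub>R f x) \<in> borel_measurable borel"
    using c by (intro borel_measurable_continuous_on_indicator) auto
  also have "(\<lambda>x. indicator {0..} x *\<^sub>R f x) = f"
    using z by (fastforce simp: indicator_def)
  finally show ?thesis .
qed

lemma primitive_eq_0D:
  fixes f :: "real \<Rightarrow> real"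
  assumes c: "continuous_on {0..} f" and F: "\<And>x. 0 \<le> x \<Longrightarrow> integral {0..x} f = 0" and x: "0 \<le> x"
  shows "f x = 0"
proof -
  \<comment> \<open>One unit past x keeps the interval nondegenerate, also for x = 0, where the
    derivative is one-sided.\<close>
  let ?b = "x + 1"
  have "((\<lambda>u. integral {0..u} f) has_vector_derivative f x) (at x within {0..?b})"
    using c x by (intro integral_has_vector_derivative) (auto intro: continuous_on_subset)
  then have "((\<lambda>u. 0) has_vector_derivative f x) (at x within {0..?b})"
    by (rule has_vector_derivative_transform[rotated -1]) (use x F in auto)
  then show ?thesis
    using vector_derivative_unique_within_closed_interval[of 0 ?b x "\<lambda>u. 0" "f x" 0] x by auto
qed

lemma square_integral_eq_0D:
  fixes g :: "real \<Rightarrow> real"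
  assumes c: "continuous_on {0..} g" and z: "\<And>x. x < 0 \<Longrightarrow> g x = 0"
    and i: "integrable lborel (\<lambda>x. g x * g x)" and e: "(LINT x|lborel. g x * g x) = 0"
  shows "g x = 0"
proof (cases "x < 0")
  case False
  let ?b = "x + 1"
  have si: "set_integrable lborel {0..?b} (\<lambda>x. g x * g x)"
    unfolding set_integrable_def using integrable_mult_indicator[OF _ i, of "{0..?b}"] by simp
  have cg: "continuous_on {0..?b} (\<lambda>x. g x * g x)"
    using c by (intro continuous_on_mult) (auto intro: continuous_on_subset)
  have "(LINT x:{0..?b}|lborel. g x * g x) \<le> (LINT x|lborel. g x * g x)"
    unfolding set_lebesgue_integral_def using si i
    by (intro integral_mono) (auto simp: set_integrable_def indicator_def)
  then have "integral {0..?b} (\<lambda>x. g x * g x) \<le> 0"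
    using e set_borel_integral_eq_integral(2)[OF si] by simp
  moreover have "0 \<le> integral {0..?b} (\<lambda>x. g x * g x)"
    by (rule Henstock_Kurzweil_Integration.integral_nonneg[OF set_borel_integral_eq_integral(1)[OF si]]) auto
  ultimately have "integral {0..?b} (\<lambda>x. g x * g x) = 0" by simp
  then have "\<forall>y\<in>{0..?b}. g y * g y = 0"
    using integral_eq_0_iff[OF cg] False by auto
  then show ?thesis using False by auto
qed (use z in auto)

text \<open>Lerch's theorem. The primitive of \<open>f\<close>, damped by an exponential, is a continuous function of
  \<open>exp (- x)\<close> on \<open>[0, 1]\<close> that is orthogonal to all polynomials in \<open>exp (- x)\<close>.\<close>

lemma laplace_eq_0D:
  fixes f :: "real \<Rightarrow> real"
  assumes c: "continuous_on {0..} f" and z: "\<And>x. x < 0 \<Longrightarrow> f x = 0"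
    and i: "\<And>s. s > s0 \<Longrightarrow> integrable lborel (\<lambda>x. exp (- s * x) * f x)"
    and l: "\<And>s. s > s0 \<Longrightarrow> laplace f s = 0"
  shows "f x = 0"
proof (cases "x < 0")
  case False
  have m [measurable]: "f \<in> borel_measurable borel" by (rule borel_measurable_halfline[OF c z])
  \<comment> \<open>Above \<open>s0\<close>, so that \<open>f\<close> has a transform at
    \<open>a\<close>, and positive, so that exp (a x) dominates the indicator of the
    half-line.\<close>
  define a where "a = max s0 0 + 1"
  have a: "a > s0" "a \<ge> 1" by (auto simp: a_def)
  let ?I = "indicator {0..} :: real \<Rightarrow> real"
  have Im: "?I \<in> borel_measurable borel" by measurable
  have IC: "\<bar>?I x\<bar> \<le> 1 * exp (a * x)" for x using a by (auto simp: indicator_def)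
  note N = sexp_meas_sm_density[OF m z i[OF a(1)]]
  \<comment> \<open>Convolution with the Heaviside function is the primitive of \<open>f\<close>. It
    still has vanishing transforms, and it satisfies the pointwise bound K exp (a x), which is not
    assumed of \<open>f\<close>.\<close>
  define F where "F = sconv ?I (sm_density f)"
  have F_eq: "F x = (LINT y|lborel. ?I (x - y) * f y)" for x
    unfolding F_def by (rule sconv_sm_density[OF m Im i[OF a(1)] IC])
  have si: "set_integrable lborel {0..x} f" for x
  proof -
    have "continuous_on {0..x} f" using c by (rule continuous_on_subset) auto
    then show ?thesis by (rule borel_integrable_atLeastAtMost')
  qed
  have F_int: "F x = integral {0..x} f" for x
  proof -
    have "F x = (LINT y:{0..x}|lborel. f y)"
      unfolding F_eq set_lebesgue_integral_def
      by (rule Bochner_Integration.integral_cong) (use z in \<open>auto simp: indicator_def not_le\<close>)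
    then show ?thesis using set_borel_integral_eq_integral(2)[OF si] by simp
  qed
  have Fz: "F x = 0" if "x < 0" for x using that by (simp add: F_int)
  have Fc: "continuous_on {0..} F"
  proof -
    have "continuous_on {0..b} F" for b
      unfolding F_int[abs_def] by (rule indefinite_integral_continuous_1[OF set_borel_integral_eq_integral(1)[OF si]])
    \<comment> \<open>Continuity within [0, oo) is local, so it may be tested inside
      [0, x + 1].\<close>
    then have "continuous (at x within {0..x + 1}) F" if "0 \<le> x" for x
      using that by (meson atLeastAtMost_iff continuous_on_eq_continuous_within le_add_same_cancel1 order_refl zero_le_one)
    moreover have "at x within {0..} = at x within {0..x + 1}" for x :: real
      by (rule at_within_nhd[of x "{..<x + 1}"]) auto
    ultimately show ?thesis by (auto simp: continuous_on_eq_continuous_within)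
  qed
  have F_lap: "integrable lborel (\<lambda>x. exp (- s * x) * F x)" "laplace F s = 0" if "s > a" for s
  proof -
    have zI: "?I x = 0" if "x < 0" for x using that by (simp add: indicator_def)
    note L = laplace_sconv_measurable[OF N Im zI IC that]
    have "laplace_sm (sm_density f) s = 0" using that a by (subst laplace_sm_sm_density[OF m i]) (auto intro: l)
    then show "integrable lborel (\<lambda>x. exp (- s * x) * F x)" "laplace F s = 0" using L by (simp_all add: F_def)
  qed
  define K where "K = (LINT y|lborel. \<bar>exp (- a * y) * f y\<bar>)"
  have K: "\<bar>F x\<bar> \<le> K * exp (a * x)" for x
  proof -
    have "\<bar>F x\<bar> \<le> (LINT y|lborel. \<bar>?I (x - y) * f y\<bar>)"
      unfolding F_eq by (rule integral_abs_bound)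
    also have "\<dots> \<le> (LINT y|lborel. exp (a * x) * \<bar>exp (- a * y) * f y\<bar>)"
    proof (rule integral_mono)
      show "integrable lborel (\<lambda>y. \<bar>?I (x - y) * f y\<bar>)"
        using mconv_sm_density_integrable[OF m Im i[OF a(1)] IC] by (rule integrable_abs)
      show "integrable lborel (\<lambda>y. exp (a * x) * \<bar>exp (- a * y) * f y\<bar>)"
        using i[OF a(1)] by (intro integrable_mult_right integrable_abs)
      fix y
      have "\<bar>?I (x - y)\<bar> * \<bar>f y\<bar> \<le> exp (a * (x - y)) * \<bar>f y\<bar>"
        using IC[of "x - y"] by (intro mult_right_mono) auto
      also have "exp (a * (x - y)) = exp (a * x) * exp (- a * y)" by (simp add: exp_add[symmetric] algebra_simps)
      finally show "\<bar>?I (x - y) * f y\<bar> \<le> exp (a * x) * \<bar>exp (- a * y) * f y\<bar>" by (simp add: abs_mult)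
    qed
    finally show ?thesis by (simp add: K_def mult.commute)
  qed
  have K0: "0 \<le> K" unfolding K_def by simp
  \<comment> \<open>One power of exp (- x) more than the growth of \<open>F\<close> requires: then
    |g x| is at most K exp (- x), and \<open>g\<close>, read as a function of exp (- x), tends to 0
    at 0.\<close>
  define g where "g x = exp (- (a + 1) * x) * F x" for x
  have gz: "g x = 0" if "x < 0" for x using Fz[OF that] by (simp add: g_def)
  have gc: "continuous_on {0..} g" unfolding g_def by (intro continuous_intros Fc)
  have gm [measurable]: "g \<in> borel_measurable borel" by (rule borel_measurable_halfline[OF gc gz])
  have gK: "\<bar>g x\<bar> \<le> K * exp (- x)" for x
  proof -
    have "\<bar>g x\<bar> \<le> exp (- (a + 1) * x) * (K * exp (a * x))"
      using K[of x] by (simp add: g_def abs_mult)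
    also have "\<dots> = K * exp (- x)" by (simp add: exp_add[symmetric] algebra_simps)
    finally show ?thesis .
  qed
  \<comment> \<open>The moments of \<open>g\<close> against powers of exp (- x) are transforms of
    \<open>F\<close> at the points n + a + 1, all beyond \<open>a\<close>.\<close>
  have gi: "integrable lborel (\<lambda>x. exp (- real n * x) * g x)"
    and g0: "(LINT x|lborel. exp (- real n * x) * g x) = 0" for n
  proof -
    have e: "exp (- real n * x) * g x = exp (- (real n + a + 1) * x) * F x" for x
      by (simp add: g_def exp_add[symmetric] algebra_simps)
    have n: "real n + a + 1 > a" by simp
    show "integrable lborel (\<lambda>x. exp (- real n * x) * g x)" "(LINT x|lborel. exp (- real n * x) * g x) = 0"
      unfolding e using F_lap[OF n] by (simp_all add: laplace_def)
  qed
  have gi0: "integrable lborel g" using gi[of 0] by simp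
  have gg: "integrable lborel (\<lambda>x. g x * g x)"
  proof (rule Bochner_Integration.integrable_bound)
    show "integrable lborel (\<lambda>x. K * g x)" using gi0 by (rule integrable_mult_right)
    have "\<bar>g x\<bar> \<le> K" for x
    proof (cases "x < 0")
      case False
      then have "K * exp (- x) \<le> K * 1" using K0 by (intro mult_left_mono) auto
      with gK[of x] show ?thesis by simp
    qed (use gz K0 in auto)
    then have "\<bar>g x\<bar> * \<bar>g x\<bar> \<le> K * \<bar>g x\<bar>" for x by (rule mult_right_mono) simp
    then show "AE x in lborel. norm (g x * g x) \<le> norm (K * g x)"
      using K0 by (simp add: abs_mult)
  qed measurable
  \<comment> \<open>The substitution t = exp (- x); the value 0 is the continuous extension to t =
    0.\<close>
  define \<phi> where "\<phi> t = (if t \<le> 0 then 0 else g (- ln t))" for t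
  have \<phi>_exp: "\<phi> (exp (- x)) = g x" for x by (simp add: \<phi>_def)
  have \<phi>_bound: "\<bar>\<phi> t\<bar> \<le> K * \<bar>t\<bar>" for t
    using gK[of "- ln t"] K0 by (cases "t \<le> 0") (auto simp: \<phi>_def mult_le_0_iff)
  have \<phi>c: "continuous_on {0..1} \<phi>"
  proof -
    have "continuous (at t within {0..1}) \<phi>" if t: "t \<in> {0..1}" for t
    proof (cases "t = 0")
      case True
      have "((\<lambda>t. K * \<bar>t\<bar>) \<longlongrightarrow> K * \<bar>0\<bar>) (at 0 within {0..1})" by (intro tendsto_intros)
      then have "(\<phi> \<longlongrightarrow> 0) (at 0 within {0..1})"
        using \<phi>_bound by (intro Lim_null_comparison[of \<phi> "\<lambda>t. K * \<bar>t\<bar>"]) auto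
      then show ?thesis using True by (simp add: continuous_within \<phi>_def)
    next
      case False
      have "continuous_on {0<..1} (\<lambda>t. g (- ln t))"
        by (rule continuous_on_compose2[OF gc]) (auto intro!: continuous_intros)
      then have "continuous_on {0<..1} \<phi>"
        by (rule continuous_on_cong[THEN iffD1, rotated -1]) (auto simp: \<phi>_def)
      then have "continuous (at t within {0<..1}) \<phi>"
        using t False by (auto simp: continuous_on_eq_continuous_within)
      moreover have "at t within {0<..1} = at t within {0..1}"
        using t False by (intro at_within_nhd[of t "{0<..}"]) auto
      ultimately show ?thesis by simp
    qed
    then show ?thesis by (simp add: continuous_on_eq_continuous_within)
  qed
  \<comment> \<open>Polynomials p in exp (- x) integrate to 0 against \<open>g\<close>. Hence the
    integral of g^2 equals that of g (g - p), and a uniform Weierstrass approximation makes it at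
    most e times the L1 norm of \<open>g\<close>.\<close>
  have approx: "(LINT x|lborel. g x * g x) \<le> e * (LINT x|lborel. \<bar>g x\<bar>)" if e: "e > 0" for e
  proof -
    obtain p where p: "real_polynomial_function p" "\<And>t. t \<in> {0..1} \<Longrightarrow> \<bar>\<phi> t - p t\<bar> < e"
      using Stone_Weierstrass_real_polynomial_function[OF compact_Icc \<phi>c e] by blast
    obtain c n where pc: "p = (\<lambda>t. \<Sum>i\<le>n. c i * t ^ i)"
      using p(1) by (auto simp: real_polynomial_function_iff_sum)
    have pg: "p (exp (- x)) * g x = (\<Sum>i\<le>n. c i * (exp (- real i * x) * g x))" for x
      by (simp add: pc sum_distrib_right exp_of_nat_mult[symmetric] mult.assoc)
    have pgi: "integrable lborel (\<lambda>x. p (exp (- x)) * g x)" "(LINT x|lborel. p (exp (- x)) * g x) = 0"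
      unfolding pg using gi g0 by (simp_all add: integrable_sum integrable_mult_right)
    have "(LINT x|lborel. g x * g x) = (LINT x|lborel. g x * g x - p (exp (- x)) * g x)"
      using gg pgi by simp
    also have "\<dots> \<le> (LINT x|lborel. e * \<bar>g x\<bar>)"
    proof (rule integral_mono)
      show "integrable lborel (\<lambda>x. g x * g x - p (exp (- x)) * g x)" using gg pgi by simp
      show "integrable lborel (\<lambda>x. e * \<bar>g x\<bar>)" using gi0 by simp
      fix x :: real
      show "g x * g x - p (exp (- x)) * g x \<le> e * \<bar>g x\<bar>"
      proof (cases "x < 0")
        case False
        then have "\<bar>g x - p (exp (- x))\<bar> \<le> e" using p(2)[of "exp (- x)"] by (simp add: \<phi>_exp)
        then have "\<bar>g x - p (exp (- x))\<bar> * \<bar>g x\<bar> \<le> e * \<bar>g x\<bar>" by (rule mult_right_mono) simp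
        then show ?thesis by (simp add: left_diff_distrib[symmetric] abs_mult[symmetric])
      qed (use gz in auto)
    qed
    finally show ?thesis by simp
  qed
  have "(LINT x|lborel. g x * g x) \<le> 0"
  proof (rule field_le_epsilon)
    fix e :: real assume e: "e > 0"
    define J where "J = (LINT x|lborel. \<bar>g x\<bar>)"
    have J: "0 \<le> J" unfolding J_def by simp
    \<comment> \<open>The denominator J + 1 avoids a division by zero when J = 0.\<close>
    have "(LINT x|lborel. g x * g x) \<le> e / (J + 1) * J" using approx[of "e / (J + 1)", folded J_def] e J by simp
    also have "\<dots> \<le> e" using e J by (simp add: divide_le_eq)
    finally show "(LINT x|lborel. g x * g x) \<le> 0 + e" by simp
  qed
  moreover have "0 \<le> (LINT x|lborel. g x * g x)" by simp
  ultimately have gg0: "(LINT x|lborel. g x * g x) = 0" by linarith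
  have "g x = 0" for x by (rule square_integral_eq_0D[OF gc gz gg gg0])
  then have "F x = 0" for x by (simp add: g_def)
  then show ?thesis using primitive_eq_0D[OF c] F_int False by simp
qed (use z in auto)

text \<open>Continuity is asked on the closed half-line only: the functions compared may jump at
  0.\<close>

corollary laplace_unique:
  fixes f g :: "real \<Rightarrow> real"
  assumes "continuous_on {0..} f" "\<And>x. x < 0 \<Longrightarrow> f x = 0" "continuous_on {0..} g" "\<And>x. x < 0 \<Longrightarrow> g x = 0"
    and i: "\<And>s. s > s0 \<Longrightarrow> integrable lborel (\<lambda>x. exp (- s * x) * f x)"
      "\<And>s. s > s0 \<Longrightarrow> integrable lborel (\<lambda>x. exp (- s * x) * g x)"
    and l: "\<And>s. s > s0 \<Longrightarrow> laplace f s = laplace g s"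
  shows "f = g"
proof
  fix x
  have d: "integrable lborel (\<lambda>x. exp (- s * x) * (f x - g x))" "laplace (\<lambda>x. f x - g x) s = 0" if "s > s0" for s
    using i(1)[OF that] i(2)[OF that] l[OF that] by (simp_all add: right_diff_distrib laplace_def)
  have "f x - g x = 0"
  proof (rule laplace_eq_0D[where f = "\<lambda>x. f x - g x" and ?s0.0 = s0 and x = x])
    show "continuous_on {0..} (\<lambda>x. f x - g x)" by (intro continuous_on_diff assms(1,3))
    show "\<And>y. y < 0 \<Longrightarrow> f y - g y = 0" by (simp add: assms(2,4))
    show "\<And>s. s > s0 \<Longrightarrow> integrable lborel (\<lambda>x. exp (- s * x) * (f x - g x))" by (rule d(1))
    show "\<And>s. s > s0 \<Longrightarrow> laplace (\<lambda>x. f x - g x) s = 0" by (rule d(2))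
  qed
  then show "f x = g x" by simp
qed

section \<open>Claim distributions\<close>

text \<open>Cut off at 0, so that transforms and primitives of the survival function are integrals
  over the whole line.\<close>

definition tail :: "real measure \<Rightarrow> real \<Rightarrow> real" where
  "tail F x = indicator {0..} x * (1 - cdf F x)"

lemma ac_posD:
  assumes "ac_pos_distribution F"
  shows "real_distribution F" "sets F = sets borel" "space F = UNIV" "\<And>x. measure F {x} = 0"
    "emeasure F {..0} = 0" "AE x in F. 0 < x" "integrable F (\<lambda>x. x)"
proof -
  show rd: "real_distribution F" and e: "emeasure F {..0} = 0" and "integrable F (\<lambda>x. x)"
    using assms by (auto simp: ac_pos_distribution_def)
  interpret real_distribution F by fact
  show s: "sets F = sets borel" and "space F = UNIV" by simp_all
  show "measure F {x} = 0" for x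
  proof -
    have "{x} \<in> null_sets lborel" by (simp add: null_sets_def)
    then have "{x} \<in> null_sets F" using assms by (auto simp: ac_pos_distribution_def absolutely_continuous_def)
    then show ?thesis by (simp add: null_sets_def measure_def)
  qed
  have "{..0} \<in> null_sets F" using e by (intro null_setsI) auto
  then show "AE x in F. 0 < x" by (rule AE_I') (simp add: subset_eq)
qed

lemma cdf_ac_pos:
  assumes "ac_pos_distribution F"
  shows "continuous_on UNIV (cdf F)" "\<And>x. x \<le> 0 \<Longrightarrow> cdf F x = 0" "\<And>x. 0 \<le> cdf F x" "\<And>x. cdf F x \<le> 1"
proof -
  note D = ac_posD[OF assms]
  interpret real_distribution F by (rule D(1))
  show "continuous_on UNIV (cdf F)" using D(4) isCont_cdf by (simp add: continuous_on_eq_continuous_at)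
  show "cdf F x = 0" if "x \<le> 0" for x
  proof -
    have "emeasure F {..x} \<le> emeasure F {..0}" using that by (intro emeasure_mono) auto
    then show ?thesis using D(5) by (simp add: cdf_def2 measure_def)
  qed
  show "0 \<le> cdf F x" "cdf F x \<le> 1" for x by (simp_all add: cdf_nonneg cdf_bounded_prob)
qed

lemma cdf_measurable: "ac_pos_distribution F \<Longrightarrow> cdf F \<in> borel_measurable borel"
  by (rule borel_measurable_continuous_onI) (rule cdf_ac_pos)

lemma tail_measurable: "ac_pos_distribution F \<Longrightarrow> tail F \<in> borel_measurable borel"
  using cdf_measurable unfolding tail_def[abs_def] by measurable

lemma tail_bounds:
  assumes "ac_pos_distribution F" shows "0 \<le> tail F x" "tail F x \<le> 1"
  using cdf_ac_pos(3,4)[OF assms, of x] by (auto simp: tail_def indicator_def)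

text \<open>Without atoms the open and the closed half-line have the same mass.\<close>

lemma tail_eq: "ac_pos_distribution F \<Longrightarrow> 0 \<le> x \<Longrightarrow> tail F x = measure F {x..}"
proof -
  assume F: "ac_pos_distribution F" and x: "0 \<le> x"
  note D = ac_posD[OF F]
  interpret real_distribution F by (rule D(1))
  have "measure F {x..} = measure F {x<..}"
  proof -
    have "{x..} = {x} \<union> {x<..}" by auto
    moreover have "measure F ({x} \<union> {x<..}) = measure F {x} + measure F {x<..}"
      by (rule finite_measure_Union) auto
    ultimately show ?thesis using D(4)[of x] by simp
  qed
  also have "\<dots> = 1 - cdf F x"
    using prob_compl[of "{..x}"] by (simp add: cdf_def2 Compl_eq_Diff_UNIV[symmetric])
  finally show ?thesis using x by (simp add: tail_def)
qed

section \<open>Mean, stationary excess and its transform\<close>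

lemma mean_pos: assumes "ac_pos_distribution F" shows "0 < mean F"
proof -
  note D = ac_posD[OF assms]
  interpret real_distribution F by (rule D(1))
  have "0 \<le> mean F" using D(6) by (intro integral_nonneg_AE) (auto elim: eventually_mono)
  moreover have "mean F \<noteq> 0"
  proof
    assume "mean F = 0"
    moreover have "AE x in F. 0 \<le> x" using D(6) by eventually_elim simp
    ultimately have "AE x in F. x = 0"
      using integral_nonneg_eq_0_iff_AE[OF D(7)] by simp
    with D(6) have "AE x in F. False" by eventually_elim simp
    then show False by simp
  qed
  ultimately show ?thesis by simp
qed

text \<open>Layer-cake formula: x > 0 is the length of the set of t with 0 <= t <= x, and Tonelli
  exchanges the two integrations.\<close>

lemma nn_integral_tail:
  assumes "ac_pos_distribution F" shows "(\<integral>\<^sup>+t. ennreal (tail F t) \<partial>lborel) = ennreal (mean F)"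
proof -
  note D = ac_posD[OF assms]
  interpret F: real_distribution F by (rule D(1))
  interpret P: pair_sigma_finite F lborel ..
  have [measurable_cong]: "sets F = sets borel" by (rule D(2))
  have "(\<integral>\<^sup>+t. ennreal (tail F t) \<partial>lborel) = (\<integral>\<^sup>+t. \<integral>\<^sup>+x. indicator {(x, t). 0 \<le> t \<and> t \<le> x} (x, t) \<partial>F \<partial>lborel)"
  proof (rule nn_integral_cong)
    fix t :: real
    show "ennreal (tail F t) = (\<integral>\<^sup>+x. indicator {(x, t). 0 \<le> t \<and> t \<le> x} (x, t) \<partial>F)"
    proof (cases "0 \<le> t")
      case True
      have "(\<integral>\<^sup>+x. indicator {(x, t). 0 \<le> t \<and> t \<le> x} (x, t) \<partial>F) = (\<integral>\<^sup>+x. indicator {t..} x \<partial>F)"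
        using True by (intro nn_integral_cong) (auto simp: indicator_def)
      then show ?thesis using True by (simp add: tail_eq[OF assms] F.emeasure_eq_measure)
    qed (simp add: tail_def)
  qed
  also have "\<dots> = (\<integral>\<^sup>+x. \<integral>\<^sup>+t. indicator {(x, t). 0 \<le> t \<and> t \<le> x} (x, t) \<partial>lborel \<partial>F)"
    by (rule P.Fubini') measurable
  also have "\<dots> = (\<integral>\<^sup>+x. ennreal x \<partial>F)"
  proof (rule nn_integral_cong_AE)
    show "AE x in F. (\<integral>\<^sup>+t. indicator {(x, t). 0 \<le> t \<and> t \<le> x} (x, t) \<partial>lborel) = ennreal x"
      using D(6)
    proof eventually_elim
      case (elim x)
      have "(\<integral>\<^sup>+t. indicator {(x, t). 0 \<le> t \<and> t \<le> x} (x, t) \<partial>lborel) = (\<integral>\<^sup>+t. indicator {0..x} t \<partial>lborel)"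
        by (intro nn_integral_cong) (auto simp: indicator_def)
      then show ?case using elim by simp
    qed
  qed
  also have "\<dots> = ennreal (mean F)"
    by (rule nn_integral_eq_integral[OF D(7)]) (use D(6) in \<open>auto elim: eventually_mono\<close>)
  finally show ?thesis .
qed

lemma tail_integrable:
  assumes "ac_pos_distribution F" shows "integrable lborel (tail F)" "(LINT x|lborel. tail F x) = mean F"
proof -
  have "integral\<^sup>L lborel (tail F) = mean F \<and> integrable lborel (tail F)"
    using nn_integral_tail[OF assms] tail_measurable[OF assms] tail_bounds(1)[OF assms] mean_pos[OF assms]
    by (intro conjI nn_integral_eq_integrable[THEN iffD1, THEN conjunct2] integrableI_nn_integral_finite[where x = "mean F"])
       (auto simp: integral_eq_nn_integral)
  then show "integrable lborel (tail F)" "(LINT x|lborel. tail F x) = mean F" by auto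
qed

text \<open>The excess distribution in the shape of a convolution with the indicator of the
  half-line, as it also appears in \<open>mconv_half_lborel\<close>.\<close>

lemma mean_stationary_excess:
  assumes "ac_pos_distribution F"
  shows "mean F * stationary_excess F x = (LINT y|lborel. indicator {0..} (x - y) * tail F y)"
proof -
  have "(LINT y:{0..x}|lborel. 1 - cdf F y) = (LINT y|lborel. indicator {0..} (x - y) * tail F y)"
    unfolding set_lebesgue_integral_def by (rule Bochner_Integration.integral_cong) (auto simp: tail_def indicator_def)
  then show ?thesis using mean_pos[OF assms] by (simp add: stationary_excess_def)
qed

lemma interval_measure_cdf:
  assumes "real_distribution D" shows "interval_measure (cdf D) = D"
proof -
  interpret real_distribution D by fact
  note c = cdf_nondecreasing cdf_is_right_cont cdf_lim_at_bot cdf_lim_at_top_prob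
  have "cdf (interval_measure (cdf D)) = cdf D" by (rule cdf_interval_measure) (use c in auto)
  moreover have "real_distribution (interval_measure (cdf D))"
    by (rule real_distribution_interval_measure) (use c in auto)
  ultimately show ?thesis using cdf_unique assms by blast
qed

text \<open>The density \<open>tail F x / mean F\<close> defines a probability measure with
  distribution function \<open>stationary_excess F\<close>. Since a distribution function determines
  its measure, the Stieltjes measure inside \<open>lst\<close> is this one.\<close>

lemma mean_lst_stationary_excess:
  assumes F: "ac_pos_distribution F"
  shows "of_real (mean F) * lst (stationary_excess F) s = (LINT x|lborel. tail F x *\<^sub>R exp (- s * of_real x))"
proof -
  have [measurable]: "tail F \<in> borel_measurable borel" by (rule tail_measurable[OF F])
  note m = mean_pos[OF F] and t = tail_bounds(1)[OF F]
  define D where "D = density lborel (\<lambda>x. ennreal (tail F x / mean F))"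
  have tD: "(\<integral>\<^sup>+x. ennreal (tail F x / mean F) \<partial>lborel) = 1"
  proof -
    have "(\<integral>\<^sup>+x. ennreal (tail F x / mean F) \<partial>lborel) = (\<integral>\<^sup>+x. ennreal (tail F x) * ennreal (inverse (mean F)) \<partial>lborel)"
      using m t by (intro nn_integral_cong) (simp add: ennreal_mult[symmetric] divide_inverse)
    also have "\<dots> = ennreal (mean F) * ennreal (inverse (mean F))"
      by (subst nn_integral_multc) (auto simp: nn_integral_tail[OF F])
    also have "\<dots> = 1" using m by (simp add: ennreal_mult[symmetric])
    finally show ?thesis .
  qed
  have "prob_space D"
    by (rule prob_spaceI) (use tD in \<open>simp add: D_def emeasure_density\<close>)
  then have "real_distribution D"
    by (simp add: real_distribution_def real_distribution_axioms_def D_def)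
  have cdfD: "cdf D = stationary_excess F"
  proof
    fix x
    have "cdf D x = (LINT y|D. indicator {..x} y)"
      by (simp add: cdf_def2 D_def)
    also have "\<dots> = (LINT y|lborel. (tail F y / mean F) * indicator {..x} y)"
      unfolding D_def using m t by (intro integral_real_density) auto
    also have "\<dots> = (LINT y|lborel. (indicator {0..} (x - y) * tail F y) * inverse (mean F))"
      by (rule Bochner_Integration.integral_cong) (auto simp: indicator_def divide_inverse)
    also have "\<dots> = stationary_excess F x"
      using m mean_stationary_excess[OF F, of x] by (simp add: field_simps)
    finally show "cdf D x = stationary_excess F x" .
  qed
  have "lst (stationary_excess F) s = (LINT x|D. indicator {0..} x *\<^sub>R exp (- s * of_real x))"
    unfolding lst_def set_lebesgue_integral_def cdfD[symmetric] interval_measure_cdf[OF \<open>real_distribution D\<close>] ..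
  also have "\<dots> = (LINT x|lborel. (tail F x / mean F) *\<^sub>R (indicator {0..} x *\<^sub>R exp (- s * of_real x)))"
    unfolding D_def using m t by (intro integral_density) auto
  also have "\<dots> = (LINT x|lborel. inverse (mean F) *\<^sub>R (tail F x *\<^sub>R exp (- s * of_real x)))"
    by (rule Bochner_Integration.integral_cong) (auto simp: tail_def indicator_def divide_inverse)
  finally show ?thesis using m by (simp add: scaleR_conv_of_real)
qed

text \<open>For |w| at most c / 2 the second-order Taylor remainder of exp (- w x) uses up half of
  the decay exp (- c x), and the other half absorbs x^2. The bound is uniform in x >= 0; it serves
  both differentiation under the integral and the motion of the roots.\<close>

lemma norm_exp_remainder:
  fixes s w :: complex
  assumes "0 < c" "c \<le> Re s" "norm w \<le> c / 2" "0 \<le> x"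
  shows "norm (exp (- (s + w) * of_real x) - exp (- s * of_real x) + w * of_real x * exp (- s * of_real x))
    \<le> 16 / c\<^sup>2 * (norm w)\<^sup>2"
proof -
  let ?z = "- (w * of_real x)"
  have T: "norm (exp ?z - (1 + ?z)) \<le> exp \<bar>Re ?z\<bar> * norm ?z ^ 2"
    using Taylor_exp[of ?z 1] by (simp add: atMost_Suc numeral_2_eq_2)
  have nz: "norm ?z = norm w * x" using assms by (simp add: norm_mult)
  have "\<bar>Re ?z\<bar> \<le> c / 2 * x"
    using abs_Re_le_cmod[of ?z] assms(3,4) nz mult_right_mono[of "norm w" "c/2" x] by linarith
  then have "exp \<bar>Re ?z\<bar> * norm ?z ^ 2 \<le> exp (c / 2 * x) * (norm w * x)\<^sup>2"
    unfolding nz by (intro mult_right_mono) auto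
  with T have T': "norm (exp ?z - (1 + ?z)) \<le> exp (c / 2 * x) * (norm w * x)\<^sup>2" by linarith
  have n: "norm (exp (- s * of_real x)) \<le> exp (- c * x)"
    using assms by (simp add: mult_right_mono)
  have "exp (- (s + w) * of_real x) - exp (- s * of_real x) + w * of_real x * exp (- s * of_real x)
      = exp (- s * of_real x) * (exp ?z - (1 + ?z))"
    by (simp add: algebra_simps exp_add[symmetric])
  then have "norm (exp (- (s + w) * of_real x) - exp (- s * of_real x) + w * of_real x * exp (- s * of_real x))
      \<le> exp (- c * x) * (exp (c / 2 * x) * (norm w * x)\<^sup>2)"
    using n T' by (simp only: norm_mult) (intro mult_mono; simp)
  also have "\<dots> = (norm w)\<^sup>2 * (x\<^sup>2 * exp (- (c / 2 * x)))"
    by (simp add: exp_add[symmetric] power_mult_distrib mult.assoc mult.left_commute)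
  finally have le: "norm (exp (- (s + w) * of_real x) - exp (- s * of_real x) + w * of_real x * exp (- s * of_real x))
      \<le> (norm w)\<^sup>2 * (x\<^sup>2 * exp (- (c / 2 * x)))" .
  \<comment> \<open>The inequality y <= exp y at y = c x / 4, squared; hence the constant
    16.\<close>
  have "x\<^sup>2 * exp (- (c / 2 * x)) \<le> 16 / c\<^sup>2"
  proof -
    have "c * x / 4 \<le> exp (c * x / 4)" using exp_ge_add_one_self[of "c * x / 4"] by linarith
    then have "(c * x / 4)\<^sup>2 \<le> (exp (c * x / 4))\<^sup>2" using assms by (intro power_mono) auto
    also have "\<dots> = exp (c / 2 * x)" by (simp add: power2_eq_square exp_add[symmetric])
    finally show ?thesis using assms by (simp add: exp_minus field_simps power2_eq_square)
  qed
  then have "(norm w)\<^sup>2 * (x\<^sup>2 * exp (- (c / 2 * x))) \<le> (norm w)\<^sup>2 * (16 / c\<^sup>2)"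
    by (rule mult_left_mono) simp
  with le show ?thesis by (simp add: mult.commute)
qed

lemma mult_exp_decay_bound:
  fixes c x :: real assumes "0 < c" shows "x * exp (- c * x) \<le> 1 / c"
proof -
  have "c * x \<le> exp (c * x)" using exp_ge_add_one_self[of "c * x"] by linarith
  then show ?thesis using assms by (simp add: exp_minus field_simps)
qed

lemma has_field_derivative_quadraticI:
  fixes f :: "complex \<Rightarrow> complex"
  assumes "0 < d" and "\<And>w. norm w \<le> d \<Longrightarrow> norm (f (s + w) - f s - w * D) \<le> K * (norm w)\<^sup>2"
  shows "(f has_field_derivative D) (at s)"
proof -
  have "((\<lambda>w. (f (s + w) - f s) / w - D) \<longlongrightarrow> 0) (at 0)"
  proof (rule Lim_null_comparison)
    have "((\<lambda>w::complex. K * norm w) \<longlongrightarrow> K * norm (0::complex)) (at 0)" by (intro tendsto_intros)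
    then show "((\<lambda>w::complex. K * norm w) \<longlongrightarrow> 0) (at 0)" by simp
    have "norm ((f (s + w) - f s) / w - D) \<le> K * norm w" if "w \<noteq> 0" "norm w \<le> d" for w
    proof -
      have "(f (s + w) - f s) / w - D = (f (s + w) - f s - w * D) / w" using that by (simp add: field_simps)
      then show ?thesis
        using assms(2)[OF that(2)] that by (simp add: norm_divide divide_le_eq power2_eq_square mult.assoc)
    qed
    moreover have "\<forall>\<^sub>F w in at 0. w \<noteq> 0 \<and> norm w < d"
      using assms(1) by (auto simp: eventually_at dist_norm intro!: exI[of _ d])
    ultimately show "\<forall>\<^sub>F w in at 0. norm ((f (s + w) - f s) / w - D) \<le> K * norm w"
      by (auto elim!: eventually_mono)
  qed
  then show ?thesis by (simp add: DERIV_def LIM_zero_iff)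
qed

text \<open>Differentiation under the integral with an explicit remainder: by
  \<open>norm_exp_remainder\<close> it is at most 16 / c^2 |w|^2 times the tail, and the tail is
  integrable because the mean is finite.\<close>

lemma holomorphic_tail_transform:
  assumes F: "ac_pos_distribution F"
  shows "(\<lambda>s. of_real (mean F) * lst (stationary_excess F) s) holomorphic_on {s. 0 < Re s}"
  unfolding mean_lst_stationary_excess[OF F]
proof (subst holomorphic_on_open)
  show "open {s. 0 < Re s}" by (rule open_halfspace_Re_gt)
  have [measurable]: "tail F \<in> borel_measurable borel" by (rule tail_measurable[OF F])
  note t = tail_bounds[OF F] and ti = tail_integrable[OF F]
  let ?e = "\<lambda>s x. exp (- s * complex_of_real x)"
  have z: "tail F x = 0" if "x < 0" for x using that by (simp add: tail_def)
  have I: "integrable lborel (\<lambda>x. tail F x *\<^sub>R ?e s x)" if "0 < Re s" for s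
  proof (rule Bochner_Integration.integrable_bound[OF ti(1)])
    have "tail F x * exp (- (Re s * x)) \<le> tail F x" for x
      using that t(1)[of x] z by (cases "x < 0") (auto intro!: mult_left_le)
    then show "AE x in lborel. norm (tail F x *\<^sub>R ?e s x) \<le> norm (tail F x)"
      using t by (auto simp: abs_mult)
  qed measurable
  show "\<forall>s\<in>{s. 0 < Re s}. \<exists>f'. ((\<lambda>s. LINT x|lborel. tail F x *\<^sub>R ?e s x) has_field_derivative f') (at s)"
  proof (intro ballI exI)
    fix s :: complex assume "s \<in> {s. 0 < Re s}"
    then have s: "0 < Re s" by simp
    define c where "c = Re s"
    have c: "0 < c" "c \<le> Re s" using s by (auto simp: c_def)
    have I': "integrable lborel (\<lambda>x. tail F x *\<^sub>R (- of_real x * ?e s x))"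
    proof (rule Bochner_Integration.integrable_bound)
      show "integrable lborel (\<lambda>x. (1 / c) * tail F x)" using ti(1) by simp
      have "tail F x * (\<bar>x\<bar> * exp (- (c * x))) \<le> (1 / c) * tail F x" for x
      proof (cases "x < 0")
        case False
        then have "\<bar>x\<bar> * exp (- (c * x)) \<le> 1 / c" using mult_exp_decay_bound[OF c(1), of x] by simp
        then have "tail F x * (\<bar>x\<bar> * exp (- (c * x))) \<le> tail F x * (1 / c)"
          by (rule mult_left_mono) (rule t)
        then show ?thesis by simp
      qed (simp add: z)
      then show "AE x in lborel. norm (tail F x *\<^sub>R (- of_real x * ?e s x)) \<le> norm ((1 / c) * tail F x)"
        using t c by (auto simp: norm_mult c_def abs_mult)
    qed measurable
    show "((\<lambda>s. LINT x|lborel. tail F x *\<^sub>R ?e s x) has_field_derivative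
        (LINT x|lborel. tail F x *\<^sub>R (- of_real x * ?e s x))) (at s)"
    proof (rule has_field_derivative_quadraticI)
      show "0 < c / 2" using c by simp
      fix w :: complex assume w: "norm w \<le> c / 2"
      then have "0 < Re (s + w)" using abs_Re_le_cmod[of w] c by (simp add: c_def)
      note Isw = I[OF this]
      let ?r = "\<lambda>x. tail F x *\<^sub>R (?e (s + w) x - ?e s x + w * of_real x * ?e s x)"
      have r: "norm (?r x) \<le> 16 / c\<^sup>2 * (norm w)\<^sup>2 * tail F x" for x
      proof (cases "x < 0")
        case False
        then have "norm (?e (s + w) x - ?e s x + w * of_real x * ?e s x) \<le> 16 / c\<^sup>2 * (norm w)\<^sup>2"
          using norm_exp_remainder[OF c w, of x] False by linarith
        then have "tail F x * norm (?e (s + w) x - ?e s x + w * of_real x * ?e s x) \<le> tail F x * (16 / c\<^sup>2 * (norm w)\<^sup>2)"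
          by (rule mult_left_mono) (rule t)
        then show ?thesis using t(1)[of x] by (simp add: mult_ac)
      qed (simp add: z)
      have lin: "(LINT x|lborel. a x) - (LINT x|lborel. b x) - w * (LINT x|lborel. d x)
          = (LINT x|lborel. a x - b x - w * d x)"
        if "integrable lborel a" "integrable lborel b" "integrable lborel d" for a b d :: "real \<Rightarrow> complex"
        using that by simp
      have "(LINT x|lborel. tail F x *\<^sub>R ?e (s + w) x) - (LINT x|lborel. tail F x *\<^sub>R ?e s x)
          - w * (LINT x|lborel. tail F x *\<^sub>R (- of_real x * ?e s x))
        = (LINT x|lborel. tail F x *\<^sub>R ?e (s + w) x - tail F x *\<^sub>R ?e s x
            - w * (tail F x *\<^sub>R (- of_real x * ?e s x)))"
        by (rule lin[OF Isw I[OF s] I'])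
      also have "\<dots> = (LINT x|lborel. ?r x)"
        by (rule Bochner_Integration.integral_cong) (auto simp: algebra_simps scaleR_conv_of_real)
      also have "norm \<dots> \<le> (LINT x|lborel. 16 / c\<^sup>2 * (norm w)\<^sup>2 * tail F x)"
      proof (rule order_trans[OF Bochner_Integration.integral_norm_bound], rule integral_mono)
        show gi: "integrable lborel (\<lambda>x. 16 / c\<^sup>2 * (norm w)\<^sup>2 * tail F x)"
          using ti(1) by (rule integrable_mult_right)
        show "integrable lborel (\<lambda>x. norm (?r x))"
          by (rule integrable_norm, rule Bochner_Integration.integrable_bound[OF gi]) (use r t in \<open>auto simp: abs_mult\<close>)
      qed (rule r)
      also have "\<dots> = 16 / c\<^sup>2 * mean F * (norm w)\<^sup>2" by (simp add: ti)
      finally show "norm ((LINT x|lborel. tail F x *\<^sub>R ?e (s + w) x) - (LINT x|lborel. tail F x *\<^sub>R ?e s x)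
          - w * (LINT x|lborel. tail F x *\<^sub>R (- of_real x * ?e s x))) \<le> 16 / c\<^sup>2 * mean F * (norm w)\<^sup>2" .
    qed
  qed
qed

text \<open>Convolution with this measure is integration from 0, hence division of the transform by
  s. It leads from \<open>claim_diff\<close> to \<open>excess_diff\<close>.\<close>

definition half_lborel :: "real measure" where
  "half_lborel = density lborel (\<lambda>x. ennreal (indicator {0..} x))"

lemma exp_meas_half_lborel: "0 < a \<Longrightarrow> exp_meas a half_lborel"
  unfolding exp_meas_def half_lborel_def
  using integrable_exp_halfline[of a]
  by (auto simp: emeasure_density nn_integral_0_iff_AE indicator_def integrable_real_density simp del: ennreal_indicator)

lemma laplace_m_half_lborel: assumes "0 < s" shows "laplace_m half_lborel s = 1 / s"
proof -
  have "laplace_m half_lborel s = (LINT x|lborel. indicator {0..} x * exp (- s * x))"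
    unfolding laplace_m_def half_lborel_def by (rule integral_real_density) auto
  also have "\<dots> = (LINT x|lborel. indicator {0<..} x *\<^sub>R exp (- (x * s)))"
    by (rule integral_cong_AE) (use AE_lborel_singleton[of "0::real"] in \<open>auto elim!: eventually_mono simp: indicator_def mult.commute\<close>)
  also have "\<dots> = 1 / s"
    using LBINT_I0i_exp_mscale[OF assms] by (simp add: interval_lebesgue_integral_0_infty set_lebesgue_integral_def)
  finally show ?thesis .
qed

lemma mconv_half_lborel:
  assumes [measurable]: "f \<in> borel_measurable borel"
  shows "mconv f half_lborel x = (LINT y|lborel. indicator {0..} (x - y) * f y)"
proof -
  have "mconv f half_lborel x = (LINT y|lborel. indicator {0..} y * f (x - y))"
    unfolding mconv_def half_lborel_def by (rule integral_real_density) auto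
  also have "\<dots> = (LINT y|lborel. indicator {0..} (x - y) * f y)"
    using lborel_integral_real_affine[of "-1" "\<lambda>y. indicator {0..} y * f (x - y)" x] by simp
  finally show ?thesis .
qed

text \<open>The order p minus h makes this the claim rate times the tail of h minus the tail of p,
  so that its Laplace transform is \<open>kfun\<close> with the right sign.\<close>

definition claim_diff :: "'m::finite risk_model \<Rightarrow> real \<Rightarrow> real" where
  "claim_diff M x = claim_rate M * (cdf (claim_p M) x - cdf (claim_h M) x)"

section \<open>The perturbation of the exponent for a fixed model\<close>

locale risk =
  fixes M :: "'m::finite risk_model"
  assumes valid: "valid_model M"
begin

lemma ac_p: "ac_pos_distribution (claim_p M)" and ac_h: "ac_pos_distribution (claim_h M)"
  and rate_pos: "0 < claim_rate M"
  using valid by (auto simp: valid_model_def)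

lemma claim_diff_tail: "claim_diff M x = claim_rate M * (tail (claim_h M) x - tail (claim_p M) x)"
  using cdf_ac_pos(2)[OF ac_p, of x] cdf_ac_pos(2)[OF ac_h, of x]
  by (cases "x < 0") (auto simp: claim_diff_def tail_def)

text \<open>Absence of atoms makes the distribution functions continuous through 0. The difference
  is bounded, so every rate \<open>a \<ge> 0\<close> is admissible.\<close>

lemma claim_diff_exp_fun: assumes "0 \<le> a" shows "exp_fun a (claim_diff M)"
  unfolding exp_fun_def
proof (intro conjI exI allI impI)
  show "continuous_on UNIV (claim_diff M)"
    unfolding claim_diff_def[abs_def] by (intro continuous_intros cdf_ac_pos ac_p ac_h)
  show z: "claim_diff M x = 0" if "x < 0" for x
    using that by (simp add: claim_diff_tail tail_def)
  fix x :: real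
  have "\<bar>cdf (claim_p M) x - cdf (claim_h M) x\<bar> \<le> 1"
    using cdf_ac_pos(3,4)[OF ac_p, of x] cdf_ac_pos(3,4)[OF ac_h, of x] by linarith
  then have le: "\<bar>claim_diff M x\<bar> \<le> claim_rate M * 1"
    unfolding claim_diff_def abs_mult using rate_pos by (intro mult_mono) auto
  show "\<bar>claim_diff M x\<bar> \<le> claim_rate M * exp (a * x)"
  proof (cases "x < 0")
    case False
    then have "claim_rate M * 1 \<le> claim_rate M * exp (a * x)"
      using assms rate_pos by (intro mult_left_mono) auto
    with le show ?thesis by linarith
  qed (use z rate_pos in auto)
qed

lemma kfun_of_real: assumes "0 < s" shows "kfun M (of_real s) = of_real (laplace (claim_diff M) s)"
proof -
  have T: "of_real (mean F) * lst (stationary_excess F) (of_real s) = of_real (LINT x|lborel. exp (- s * x) * tail F x)"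
    if F: "ac_pos_distribution F" for F
  proof -
    have "of_real (mean F) * lst (stationary_excess F) (of_real s)
        = (LINT x|lborel. complex_of_real (exp (- s * x) * tail F x))"
      unfolding mean_lst_stationary_excess[OF F]
      by (rule Bochner_Integration.integral_cong) (auto simp: scaleR_conv_of_real exp_of_real[symmetric])
    then show ?thesis by (simp only: integral_complex_of_real)
  qed
  have I: "integrable lborel (\<lambda>x. exp (- s * x) * tail F x)" if F: "ac_pos_distribution F" for F
  proof -
    have [measurable]: "tail F \<in> borel_measurable borel" by (rule tail_measurable[OF F])
    show ?thesis
    proof (rule exp_bounded_integrable[where a = 0 and C = 1])
      show "\<bar>tail F x\<bar> \<le> 1 * exp (0 * x)" for x using tail_bounds[OF F, of x] by simp
      show "tail F x = 0" if "x < 0" for x using that by (simp add: tail_def)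
    qed (use assms in auto)
  qed
  have "laplace (claim_diff M) s
      = claim_rate M * ((LINT x|lborel. exp (- s * x) * tail (claim_h M) x) - (LINT x|lborel. exp (- s * x) * tail (claim_p M) x))"
  proof -
    have "exp (- s * x) * claim_diff M x
        = claim_rate M * (exp (- s * x) * tail (claim_h M) x - exp (- s * x) * tail (claim_p M) x)" for x
      by (simp add: claim_diff_tail algebra_simps)
    then show ?thesis using I[OF ac_h] I[OF ac_p] by (simp add: laplace_def)
  qed
  then show ?thesis by (simp add: kfun_def T[OF ac_h] T[OF ac_p])
qed

text \<open>Each product \<open>mean F * stationary_excess F x\<close> is the primitive of the tail
  of \<open>F\<close>.\<close>

lemma excess_diff_eq: "claim_rate M * excess_diff M x = mconv (claim_diff M) half_lborel x"
proof -
  have [measurable]: "claim_diff M \<in> borel_measurable borel"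
    by (rule exp_funD(1)[OF claim_diff_exp_fun[of 0]]) simp
  have I: "integrable lborel (\<lambda>y. indicator {0..} (x - y) * tail F y)" if F: "ac_pos_distribution F" for F
  proof (rule Bochner_Integration.integrable_bound[OF tail_integrable(1)[OF F]])
    have [measurable]: "tail F \<in> borel_measurable borel" by (rule tail_measurable[OF F])
    show "(\<lambda>y. indicator {0..} (x - y) * tail F y) \<in> borel_measurable lborel" by measurable
  qed (auto simp: indicator_def)
  have "indicator {0..} (x - y) * claim_diff M y
      = claim_rate M * (indicator {0..} (x - y) * tail (claim_h M) y - indicator {0..} (x - y) * tail (claim_p M) y)" for y
    by (simp add: claim_diff_tail algebra_simps)
  then show ?thesis
    using I[OF ac_h] I[OF ac_p]
    by (simp add: excess_diff_def mean_stationary_excess ac_p ac_h mconv_half_lborel)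
qed

lemma excess_diff_exp_fun: "0 < a \<Longrightarrow> exp_fun a (\<lambda>x. claim_rate M * excess_diff M x)"
  unfolding excess_diff_eq by (rule mconv_exp_fun) (auto intro: exp_meas_half_lborel claim_diff_exp_fun)

lemma laplace_excess_diff: assumes "0 < s" shows "laplace (\<lambda>x. claim_rate M * excess_diff M x) s = laplace (claim_diff M) s / s"
proof -
  \<comment> \<open>The rate s / 2 is positive, as \<open>exp_meas_half_lborel\<close> demands, and
    strictly below s, as \<open>laplace_mconv\<close> demands.\<close>
  have "exp_fun (s / 2) (claim_diff M)" using assms by (intro claim_diff_exp_fun) simp
  then obtain C where C: "\<And>x. \<bar>claim_diff M x\<bar> \<le> C * exp (s / 2 * x)" and f: "exp_fun (s / 2) (claim_diff M)"
    using exp_funE by blast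
  have "laplace (mconv (claim_diff M) half_lborel) s = laplace (claim_diff M) s * laplace_m half_lborel s"
    using assms by (intro laplace_mconv(2)[OF exp_meas_half_lborel exp_funD(1,2)[OF f] C]) auto
  then show ?thesis using assms unfolding excess_diff_eq by (simp add: laplace_m_half_lborel)
qed

lemma kfun_holomorphic: "kfun M holomorphic_on {s. 0 < Re s}"
  unfolding kfun_def[abs_def]
  by (intro holomorphic_intros holomorphic_tail_transform ac_p ac_h)

lemma phi_holomorphic: "phi M \<epsilon> holomorphic_on {s. 0 < Re s}"
proof -
  have "phi M \<epsilon> = (\<lambda>s. of_real (premium M) * s - of_real (claim_rate M) * s *
     (of_real (1 - \<epsilon>) * (of_real (mean (claim_p M)) * lst (stationary_excess (claim_p M)) s)
      + of_real \<epsilon> * (of_real (mean (claim_h M)) * lst (stationary_excess (claim_h M)) s)))"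
    by (rule ext) (simp add: phi_def mult.assoc)
  then show ?thesis
    by (simp only:) (intro holomorphic_intros holomorphic_tail_transform ac_p ac_h)
qed

lemma phi_eps: "phi M \<epsilon> s = phi M 0 s - of_real \<epsilon> * s * kfun M s"
  by (simp add: phi_def kfun_def algebra_simps)

end

section \<open>Perturbation of the scale matrix\<close>

lemma matrix_inv_left: "invertible A \<Longrightarrow> matrix_inv A ** A = mat 1"
  and matrix_inv_right: "invertible A \<Longrightarrow> A ** matrix_inv A = mat 1"
  for A :: "'a::semiring_1^'n^'m"
  unfolding matrix_inv_def invertible_def by (rule someI2_ex; blast)+

lemma matrix_mult_diff_distrib:
  fixes A :: "'a::comm_ring_1^('n::finite)^'m" and C :: "'a^'k^'n"
  shows "A ** (C - D) = A ** C - A ** D" "(A - B) ** C = A ** C - B ** C"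
  by (simp_all add: vec_eq_iff matrix_matrix_mult_def sum_subtractf algebra_simps)

text \<open>In G^-1 - F^-1 = F^-1 (F - G) G^-1 the middle factor is supported at (k, k). Only the
  entry (k, k) of F^-1 and row k of G^-1 survive, so each entry of that row satisfies a scalar
  equation of its own.\<close>

lemma resolvent_first_row:
  fixes F G :: "'a::comm_ring_1^('n::finite)^'n"
  assumes F: "invertible F" and G: "invertible G"
    and d: "\<And>i j. G $ i $ j = F $ i $ j - (if i = k \<and> j = k then d else 0)"
  shows "matrix_inv G $ k $ j = matrix_inv F $ k $ j + d * matrix_inv F $ k $ k * matrix_inv G $ k $ j"
proof -
  let ?D = "(\<chi> i j. if i = k \<and> j = k then d else 0) :: 'a^'n^'n"
  have "G = F - ?D" using d by (simp add: vec_eq_iff)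
  then have "?D = F - G" by simp
  have "matrix_inv F ** ?D ** matrix_inv G
      = matrix_inv F ** F ** matrix_inv G - matrix_inv F ** (G ** matrix_inv G)"
    unfolding \<open>?D = F - G\<close>
    by (simp add: matrix_mult_diff_distrib matrix_mul_assoc)
  also have "\<dots> = matrix_inv G - matrix_inv F"
    by (simp add: matrix_inv_left[OF F] matrix_inv_right[OF G])
  finally have "matrix_inv G = matrix_inv F + matrix_inv F ** ?D ** matrix_inv G" by simp
  then have "matrix_inv G $ k $ j = matrix_inv F $ k $ j + (matrix_inv F ** ?D ** matrix_inv G) $ k $ j"
    by (metis vector_add_component)
  also have "(matrix_inv F ** ?D ** matrix_inv G) $ k $ j = d * matrix_inv F $ k $ k * matrix_inv G $ k $ j"
  proof -
    have "(matrix_inv F ** ?D) $ k $ l = (if l = k then matrix_inv F $ k $ k * d else 0)" for l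
      by (auto simp: matrix_matrix_mult_def if_distrib[of "\<lambda>x. _ * x"] sum.delta cong: if_cong)
    then show ?thesis
      unfolding matrix_matrix_mult_def[of "matrix_inv F ** ?D"]
      by (simp add: if_distrib[of "\<lambda>x. x * _"] sum.delta cong: if_cong)
  qed
  finally show ?thesis .
qed

lemma exponent_eps:
  assumes "risk M"
  shows "exponent M t q s $ i $ j
    = exponent M 0 q s $ i $ j - (if i = None \<and> j = None then of_real t * s * kfun M s else 0)"
  using risk.phi_eps[OF assms, of t s] by (auto simp: exponent_def split: option.split)

lemma halfline_integrable:
  fixes f :: "real \<Rightarrow> real"
  assumes "\<And>x. x < 0 \<Longrightarrow> f x = 0"
  shows "set_integrable lborel {0..} (\<lambda>x. exp (- s * x) * f x) \<longleftrightarrow> integrable lborel (\<lambda>x. exp (- s * x) * f x)"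
    and "(LINT x:{0..}|lborel. exp (- s * x) * f x) = laplace f s"
proof -
  have e: "(\<lambda>x. indicator {0..} x *\<^sub>R (exp (- s * x) * f x)) = (\<lambda>x. exp (- s * x) * f x)"
    using assms by (fastforce simp: indicator_def)
  show "set_integrable lborel {0..} (\<lambda>x. exp (- s * x) * f x) \<longleftrightarrow> integrable lborel (\<lambda>x. exp (- s * x) * f x)"
    "(LINT x:{0..}|lborel. exp (- s * x) * f x) = laplace f s"
    unfolding set_integrable_def set_lebesgue_integral_def laplace_def e by (rule refl)+
qed

lemma scale_matrixD:
  assumes "is_scale_matrix M t q W"
  obtains s0 where "\<And>s. s > s0 \<Longrightarrow> invertible (exponent M t q (of_real s))"
    "\<And>s i j. s > s0 \<Longrightarrow> integrable lborel (\<lambda>x. exp (- s * x) * W x $ i $ j)"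
    "\<And>s i j. s > s0 \<Longrightarrow> complex_of_real (laplace (\<lambda>x. W x $ i $ j) s) = matrix_inv (exponent M t q (of_real s)) $ i $ j"
proof -
  have z: "W x $ i $ j = 0" if "x < 0" for x i j using assms that by (simp add: is_scale_matrix_def)
  from assms obtain s0 where s0: "\<forall>s>s0. invertible (exponent M t q (of_real s)) \<and>
        (\<forall>i j. set_integrable lborel {0..} (\<lambda>x. exp (- s * x) * W x $ i $ j) \<and>
           complex_of_real (LINT x:{0..}|lborel. exp (- s * x) * W x $ i $ j)
             = matrix_inv (exponent M t q (of_real s)) $ i $ j)"
    unfolding is_scale_matrix_def by blast
  show thesis
  proof (rule that[of s0])
    fix s assume s: "s0 < s"
    then show "invertible (exponent M t q (of_real s))" using s0 by blast
    fix i j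
    note h = halfline_integrable[of "\<lambda>x. W x $ i $ j" s, OF z]
    have "set_integrable lborel {0..} (\<lambda>x. exp (- s * x) * W x $ i $ j)"
      "complex_of_real (LINT x:{0..}|lborel. exp (- s * x) * W x $ i $ j) = matrix_inv (exponent M t q (of_real s)) $ i $ j"
      using s s0 by blast+
    then show "integrable lborel (\<lambda>x. exp (- s * x) * W x $ i $ j)"
      "complex_of_real (laplace (\<lambda>x. W x $ i $ j) s) = matrix_inv (exponent M t q (of_real s)) $ i $ j"
      by (simp_all only: h)
  qed
qed

lemma scale_matrix_entry:
  assumes "is_scale_matrix M t q W"
  shows "continuous_on {0..} (\<lambda>x. W x $ i $ j)" "\<And>x. x < 0 \<Longrightarrow> W x $ i $ j = 0"
    "(\<lambda>x. W x $ i $ j) \<in> borel_measurable borel"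
proof -
  show c: "continuous_on {0..} (\<lambda>x. W x $ i $ j)"
    using assms by (intro continuous_on_component) (simp add: is_scale_matrix_def)
  show z: "W x $ i $ j = 0" if "x < 0" for x using assms that by (simp add: is_scale_matrix_def)
  show "(\<lambda>x. W x $ i $ j) \<in> borel_measurable borel" by (rule borel_measurable_halfline[OF c z])
qed

text \<open>\<open>is_scale_measure\<close> speaks of set integrals over [0, oo),
  \<open>laplace_m\<close> of integrals over the line; the measures do not charge the
  difference.\<close>

lemma exp_meas_halflineI:
  assumes s: "sets \<nu> = sets borel" and e: "emeasure \<nu> {..<0} = 0" and i: "set_integrable \<nu> {0..} (\<lambda>x. exp (- s * x))"
  shows "exp_meas s \<nu>" "(LINT x:{0..}|\<nu>. exp (- s * x)) = laplace_m \<nu> s"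
proof -
  have [measurable_cong]: "sets \<nu> = sets borel" by fact
  have "{..<0} \<in> null_sets \<nu>" by (intro null_setsI e) (simp add: s)
  then have AE: "AE x in \<nu>. 0 \<le> x" by (rule AE_I') (simp add: subset_eq)
  then have ae: "AE x in \<nu>. indicator {0..} x *\<^sub>R exp (- s * x) = exp (- s * x)"
    by eventually_elim simp
  have "integrable \<nu> (\<lambda>x. exp (- s * x))"
    using i unfolding set_integrable_def by (rule integrable_cong_AE_imp[OF _ _ ae]) measurable
  then show "exp_meas s \<nu>" using s e by (simp add: exp_meas_def)
  show "(LINT x:{0..}|\<nu>. exp (- s * x)) = laplace_m \<nu> s"
    unfolding set_lebesgue_integral_def laplace_m_def by (rule integral_cong_AE[OF _ _ ae]) measurable
qed

lemma scale_measureD: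
  assumes "is_scale_measure M q Wd"
  obtains s0 where "\<And>s. s > s0 \<Longrightarrow> invertible (exponent M 0 q (of_real s))"
    "\<And>s i j. s > s0 \<Longrightarrow> sexp_meas s (Wd $ i $ j)"
    "\<And>s i j. s > s0 \<Longrightarrow> complex_of_real (laplace_sm (Wd $ i $ j) s) = of_real s * matrix_inv (exponent M 0 q (of_real s)) $ i $ j"
proof -
  from assms have b: "sets \<nu> = sets borel \<and> emeasure \<nu> {..<0} = 0"
    if "\<nu> = fst (Wd $ i $ j) \<or> \<nu> = snd (Wd $ i $ j)" for \<nu> i j
    using that unfolding is_scale_measure_def by blast
  from assms obtain s0 where s0: "\<forall>s>s0. invertible (exponent M 0 q (of_real s)) \<and>
        (\<forall>i j. set_integrable (fst (Wd $ i $ j)) {0..} (\<lambda>x. exp (- s * x)) \<and>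
           set_integrable (snd (Wd $ i $ j)) {0..} (\<lambda>x. exp (- s * x)) \<and>
           complex_of_real (sm_integral (Wd $ i $ j) {0..} (\<lambda>x. exp (- s * x)))
             = of_real s * matrix_inv (exponent M 0 q (of_real s)) $ i $ j)"
    unfolding is_scale_measure_def by blast
  show thesis
  proof (rule that[of s0])
    fix s i j assume s: "s0 < s"
    then show "invertible (exponent M 0 q (of_real s))" using s0 by blast
    have i: "set_integrable (fst (Wd $ i $ j)) {0..} (\<lambda>x. exp (- s * x))"
      "set_integrable (snd (Wd $ i $ j)) {0..} (\<lambda>x. exp (- s * x))" using s s0 by blast+
    note E1 = exp_meas_halflineI[OF b[THEN conjunct1] b[THEN conjunct2] i(1), of i j i j]
      and E2 = exp_meas_halflineI[OF b[THEN conjunct1] b[THEN conjunct2] i(2), of i j i j]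
    show "sexp_meas s (Wd $ i $ j)" using E1 E2 by (simp add: sexp_meas_def)
    have "complex_of_real (sm_integral (Wd $ i $ j) {0..} (\<lambda>x. exp (- s * x)))
             = of_real s * matrix_inv (exponent M 0 q (of_real s)) $ i $ j" using s s0 by blast
    then show "complex_of_real (laplace_sm (Wd $ i $ j) s) = of_real s * matrix_inv (exponent M 0 q (of_real s)) $ i $ j"
      using E1 E2 by (simp add: sm_integral_def laplace_sm_def)
  qed
qed

lemma exp_fun_halfline: "exp_fun a f \<Longrightarrow> continuous_on {0..} f"
  unfolding exp_fun_def by (blast intro: continuous_on_subset)

text \<open>Both factors vanish on the negative axis, so the integrand lives on 0 <= y <= x, where y
  and x - y are both at most \<open>U\<close>; the factor \<open>U\<close> is the length of the
  range of integration.\<close>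

lemma convolution_bound:
  fixes \<kappa> h :: "real \<Rightarrow> real"
  assumes K: "\<And>x. x \<le> U \<Longrightarrow> \<bar>\<kappa> x\<bar> \<le> K" and z: "\<And>x. x < 0 \<Longrightarrow> \<kappa> x = 0" "\<And>x. x < 0 \<Longrightarrow> h x = 0"
    and h: "\<And>y. 0 \<le> y \<Longrightarrow> y \<le> U \<Longrightarrow> \<bar>h y\<bar> \<le> m" and U: "0 \<le> U" "x \<le> U" and m: "0 \<le> m"
  shows "\<bar>LINT y|lborel. \<kappa> (x - y) * h y\<bar> \<le> K * U * m"
proof -
  have K0: "0 \<le> K" using K[of U] by simp
  have "\<bar>LINT y|lborel. \<kappa> (x - y) * h y\<bar> \<le> (LINT y|lborel. \<bar>\<kappa> (x - y) * h y\<bar>)"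
    by (rule integral_abs_bound)
  also have "\<dots> \<le> (LINT y|lborel. K * m * indicator {0..U} y)"
  proof (rule integral_mono')
    fix y :: real
    show "\<bar>\<kappa> (x - y) * h y\<bar> \<le> K * m * indicator {0..U} y"
    proof (cases "0 \<le> y \<and> y \<le> x")
      case True
      then show ?thesis using K[of "x - y"] h[of y] U K0 by (auto simp: abs_mult intro!: mult_mono)
    next
      case False
      then have "\<kappa> (x - y) * h y = 0" using z by (auto simp: not_le)
      then show ?thesis by (simp only: abs_zero) (use K0 m in auto)
    qed
    show "0 \<le> K * m * indicator {0..U} y" using K0 m by simp
  next
    show "integrable lborel (\<lambda>y. K * m * indicator {0..U} y)"
      by (intro integrable_mult_right integrable_real_indicator) (use U in auto)
  qed
  also have "\<dots> = K * U * m" using U by simp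
  finally show ?thesis .
qed

section \<open>The Volterra equation for the first row\<close>

locale risk_scale = risk M for M :: "'m::finite risk_model" +
  fixes q :: real and W0 :: "real \<Rightarrow> real^'m option^'m option" and Wd :: "signed_measure^'m option^'m option"
  assumes scale0: "is_scale_matrix M 0 q W0" and scale_measure: "is_scale_measure M q Wd"
begin

definition kernel :: "real \<Rightarrow> real" where
  "kernel = sconv (claim_diff M) (Wd $ None $ None)"

text \<open>The derivative of the first row with respect to the perturbation, in the form used by
  \<open>v_fun\<close>, where it occurs as \<open>corr j u\<close> and, in the last term, as
  \<open>corr None (u - z)\<close>.\<close>

definition corr :: "'m option \<Rightarrow> real \<Rightarrow> real" where
  "corr j x = claim_rate M * sm_integral (sm_convolution (Wd $ None $ None) (Wd $ None $ j)) {0..x}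
     (\<lambda>y. excess_diff M (x - y))"

lemma corr_eq_sconv:
  assumes N: "sexp_meas a (Wd $ None $ None)" "sexp_meas a (Wd $ None $ j)" and a: "0 < a"
  shows "corr j = sconv (\<lambda>x. claim_rate M * excess_diff M x) (sm_convolution (Wd $ None $ None) (Wd $ None $ j))"
proof
  fix x
  let ?N = "sm_convolution (Wd $ None $ None) (Wd $ None $ j)"
  have "corr j x = sm_integral ?N {0..x} (\<lambda>y. claim_rate M * excess_diff M (x - y))"
    by (simp add: corr_def sm_integral_def right_diff_distrib)
  also have "\<dots> = sconv (\<lambda>x. claim_rate M * excess_diff M x) ?N x"
    using sm_integral_eq_sconv[OF sexp_meas_convolution(1)[OF N] excess_diff_exp_fun[OF a]] .
  finally show "corr j x = sconv (\<lambda>x. claim_rate M * excess_diff M x) ?N x" .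
qed

lemma corr_exp_fun: "\<exists>a. exp_fun a (corr j)"
proof -
  obtain s0 where "\<And>s. s > s0 \<Longrightarrow> invertible (exponent M 0 q (of_real s))"
    and s0: "\<And>s i j. s > s0 \<Longrightarrow> sexp_meas s (Wd $ i $ j)"
    "\<And>s i j. s > s0 \<Longrightarrow> complex_of_real (laplace_sm (Wd $ i $ j) s) = of_real s * matrix_inv (exponent M 0 q (of_real s)) $ i $ j"
    by (rule scale_measureD[OF scale_measure]) (rule that; blast)
  define a where "a = max s0 0 + 1"
  have a: "a > s0" "a > 0" by (auto simp: a_def)
  note N = s0(1)[OF a(1), of None None] s0(1)[OF a(1), of None j]
  show ?thesis unfolding corr_eq_sconv[OF N a(2)]
    by (intro exI[of _ a] sconv_exp_fun sexp_meas_convolution N excess_diff_exp_fun) (use a in auto)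
qed

lemma kernel_exp_fun: "\<exists>a>0. exp_fun a kernel"
proof -
  obtain s0 where "\<And>s. s > s0 \<Longrightarrow> invertible (exponent M 0 q (of_real s))"
    and s0: "\<And>s i j. s > s0 \<Longrightarrow> sexp_meas s (Wd $ i $ j)"
    "\<And>s i j. s > s0 \<Longrightarrow> complex_of_real (laplace_sm (Wd $ i $ j) s) = of_real s * matrix_inv (exponent M 0 q (of_real s)) $ i $ j"
    by (rule scale_measureD[OF scale_measure]) (rule that; blast)
  define a where "a = max s0 0 + 1"
  have a: "a > s0" "a > 0" by (auto simp: a_def)
  show ?thesis unfolding kernel_def
    by (intro exI[of _ a] conjI sconv_exp_fun s0(1) claim_diff_exp_fun) (use a in auto)
qed

lemma laplace_kernel:
  "\<exists>s0. \<forall>s>s0. complex_of_real (laplace kernel s)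
      = kfun M (of_real s) * of_real s * matrix_inv (exponent M 0 q (of_real s)) $ None $ None"
proof -
  obtain s0 where "\<And>s. s > s0 \<Longrightarrow> invertible (exponent M 0 q (of_real s))"
    and s0: "\<And>s i j. s > s0 \<Longrightarrow> sexp_meas s (Wd $ i $ j)"
    "\<And>s i j. s > s0 \<Longrightarrow> complex_of_real (laplace_sm (Wd $ i $ j) s) = of_real s * matrix_inv (exponent M 0 q (of_real s)) $ i $ j"
    by (rule scale_measureD[OF scale_measure]) (rule that; blast)
  define a where "a = max s0 0 + 1"
  have a: "a > s0" "a > 0" by (auto simp: a_def)
  have "complex_of_real (laplace kernel s)
      = kfun M (of_real s) * of_real s * matrix_inv (exponent M 0 q (of_real s)) $ None $ None" if "s > a" for s
  proof -
    have "laplace kernel s = laplace (claim_diff M) s * laplace_sm (Wd $ None $ None) s"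
      unfolding kernel_def by (rule laplace_sconv[OF s0(1) claim_diff_exp_fun that]) (use a in auto)
    then show ?thesis using that a by (simp add: kfun_of_real s0(2))
  qed
  then show ?thesis by blast
qed

text \<open>Identifies the stated double convolution with the first iterate of the Volterra
  equation. Both sides are continuous in x, so equality of their transforms suffices.\<close>

lemma corr_eq: "corr j x = (LINT y|lborel. kernel (x - y) * W0 y $ None $ j)"
proof -
  obtain s0 where "\<And>s. s > s0 \<Longrightarrow> invertible (exponent M 0 q (of_real s))"
    and s0: "\<And>s i j. s > s0 \<Longrightarrow> sexp_meas s (Wd $ i $ j)"
    "\<And>s i j. s > s0 \<Longrightarrow> complex_of_real (laplace_sm (Wd $ i $ j) s) = of_real s * matrix_inv (exponent M 0 q (of_real s)) $ i $ j"
    by (rule scale_measureD[OF scale_measure]) (rule that; blast)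
  obtain s1 where "\<And>s. s > s1 \<Longrightarrow> invertible (exponent M 0 q (of_real s))"
    and s1: "\<And>s i j. s > s1 \<Longrightarrow> integrable lborel (\<lambda>x. exp (- s * x) * W0 x $ i $ j)"
    "\<And>s i j. s > s1 \<Longrightarrow> complex_of_real (laplace (\<lambda>x. W0 x $ i $ j) s) = matrix_inv (exponent M 0 q (of_real s)) $ i $ j"
    by (rule scale_matrixD[OF scale0]) (rule that; blast)
  define a where "a = Max {s0, s1, 0} + 1"
  have a: "a > s0" "a > s1" "a > 0" by (auto simp: a_def)
  let ?w = "\<lambda>x. W0 x $ None $ j"
  note w = scale_matrix_entry[OF scale0, where i = None and j = j]
  note N = s0(1)[OF a(1), of None None] s0(1)[OF a(1), of None j]
  note N' = sexp_meas_convolution[OF N]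
  have K: "exp_fun a kernel" unfolding kernel_def by (rule sconv_exp_fun[OF N(1) claim_diff_exp_fun]) (use a in auto)
  have D: "sexp_meas a (sm_density ?w)" by (rule sexp_meas_sm_density[OF w(3,2) s1(1)[OF a(2)]])
  obtain C where C: "\<And>x. \<bar>kernel x\<bar> \<le> C * exp (a * x)" using exp_funE[OF K] by blast
  have R: "exp_fun a (sconv kernel (sm_density ?w))" by (rule sconv_exp_fun[OF D K]) (use a in linarith)
  have L: "exp_fun a (corr j)" unfolding corr_eq_sconv[OF N a(3)]
    by (rule sconv_exp_fun[OF N'(1) excess_diff_exp_fun]) (use a in auto)
  have "corr j = sconv kernel (sm_density ?w)"
  proof (rule laplace_unique[where ?s0.0 = a])
    fix s assume s: "a < s"
    show "integrable lborel (\<lambda>x. exp (- s * x) * corr j x)" "integrable lborel (\<lambda>x. exp (- s * x) * sconv kernel (sm_density ?w) x)"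
      by (intro exp_fun_integrable[OF _ s] L R)+
    have "laplace (corr j) s = laplace (claim_diff M) s / s * (laplace_sm (Wd $ None $ None) s * laplace_sm (Wd $ None $ j) s)"
      unfolding corr_eq_sconv[OF N a(3)]
      using laplace_sconv[OF N'(1) excess_diff_exp_fun[OF a(3)] s] N'(2)[of s] s a by (simp add: laplace_excess_diff)
    \<comment> \<open>\<open>Wd\<close> and \<open>W0\<close> are compared through their transforms,
      which share the same entry of the inverse exponent.\<close>
    also have "laplace_sm (Wd $ None $ j) s = s * laplace ?w s"
    proof -
      have "complex_of_real (laplace_sm (Wd $ None $ j) s) = complex_of_real (s * laplace ?w s)"
        using s a by (simp add: s0(2) s1(2))
      then show ?thesis by (simp only: of_real_eq_iff)
    qed
    also have "laplace (claim_diff M) s / s * (laplace_sm (Wd $ None $ None) s * (s * laplace ?w s))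
        = (laplace (claim_diff M) s * laplace_sm (Wd $ None $ None) s) * laplace ?w s"
      using s a by simp
    also have "\<dots> = laplace kernel s * laplace_sm (sm_density ?w) s"
    proof -
      have "laplace kernel s = laplace (claim_diff M) s * laplace_sm (Wd $ None $ None) s"
        unfolding kernel_def by (rule laplace_sconv[OF N(1) claim_diff_exp_fun s]) (use a in auto)
      moreover have "laplace_sm (sm_density ?w) s = laplace ?w s"
        by (rule laplace_sm_sm_density[OF w(3) s1(1)]) (use s a in simp)
      ultimately show ?thesis by simp
    qed
    also have "\<dots> = laplace (sconv kernel (sm_density ?w)) s" using laplace_sconv[OF D K s] by simp
    finally show "laplace (corr j) s = laplace (sconv kernel (sm_density ?w)) s" .
  qed (rule exp_fun_halfline[OF L] exp_funD(2)[OF L] exp_fun_halfline[OF R] exp_funD(2)[OF R], assumption?)+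
  then show ?thesis using sconv_sm_density[OF w(3) exp_funD(1)[OF K] s1(1)[OF a(2)] C] by simp
qed

text \<open>The \<open>(1,1)\<close> entry of the matrix exponent is perturbed by \<open>- t * s * k(s)\<close>; after multiplication with
  \<open>s * (F(s)\<^sup>-\<^sup>1)\<^sub>1\<^sub>1\<close>, the transform of \<open>W(dx)\<^sub>1\<^sub>1\<close>, the factor \<open>s\<close> is absorbed and the resolvent identity
  becomes a Volterra equation.\<close>

lemma scale_volterra:
  assumes W: "is_scale_matrix M t q W"
  shows "W x $ None $ j = W0 x $ None $ j + t * (LINT y|lborel. kernel (x - y) * W y $ None $ j)"
    and "integrable lborel (\<lambda>y. kernel (x - y) * W y $ None $ j)"
proof -
  obtain s0 where s0: "\<forall>s>s0. complex_of_real (laplace kernel s)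
      = kfun M (of_real s) * of_real s * matrix_inv (exponent M 0 q (of_real s)) $ None $ None"
    using laplace_kernel by blast
  obtain s1 where s1: "\<And>s. s > s1 \<Longrightarrow> invertible (exponent M 0 q (of_real s))"
    "\<And>s i j. s > s1 \<Longrightarrow> integrable lborel (\<lambda>x. exp (- s * x) * W0 x $ i $ j)"
    "\<And>s i j. s > s1 \<Longrightarrow> complex_of_real (laplace (\<lambda>x. W0 x $ i $ j) s) = matrix_inv (exponent M 0 q (of_real s)) $ i $ j"
    by (rule scale_matrixD[OF scale0]) (rule that; blast)
  obtain s2 where s2: "\<And>s. s > s2 \<Longrightarrow> invertible (exponent M t q (of_real s))"
    "\<And>s i j. s > s2 \<Longrightarrow> integrable lborel (\<lambda>x. exp (- s * x) * W x $ i $ j)"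
    "\<And>s i j. s > s2 \<Longrightarrow> complex_of_real (laplace (\<lambda>x. W x $ i $ j) s) = matrix_inv (exponent M t q (of_real s)) $ i $ j"
    by (rule scale_matrixD[OF W]) (rule that; blast)
  obtain a0 where a0: "a0 > 0" "exp_fun a0 kernel" using kernel_exp_fun by blast
  define a where "a = Max {s0, s1, s2, a0} + 1"
  have a: "a > s0" "a > s1" "a > s2" "a > a0" "a > 0" using a0 by (auto simp: a_def)
  let ?w = "\<lambda>x. W x $ None $ j" and ?v = "\<lambda>x. W0 x $ None $ j"
  note w = scale_matrix_entry[OF W, where i = None and j = j] and w0 = scale_matrix_entry[OF scale0, where i = None and j = j]
  \<comment> \<open>Raising the rate is harmless: where exp (a x) is the smaller bound, on the
    negative axis, the kernel vanishes.\<close>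
  have K: "exp_fun a kernel"
  proof -
    obtain C where C: "\<And>x. \<bar>kernel x\<bar> \<le> C * exp (a0 * x)" "0 \<le> C" using exp_funE[OF a0(2)] by blast
    have "\<bar>kernel x\<bar> \<le> C * exp (a * x)" for x
    proof (cases "x < 0")
      case False
      then have "C * exp (a0 * x) \<le> C * exp (a * x)" using a C by (intro mult_left_mono) (auto intro: mult_right_mono)
      with C(1)[of x] show ?thesis by linarith
    qed (use exp_funD(2)[OF a0(2)] C in auto)
    then show ?thesis using a0(2) by (auto simp: exp_fun_def)
  qed
  obtain C where C: "\<And>x. \<bar>kernel x\<bar> \<le> C * exp (a * x)" using exp_funE[OF K] by blast
  have D: "sexp_meas a (sm_density ?w)" by (rule sexp_meas_sm_density[OF w(3,2) s2(2)[OF a(3)]])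
  have R: "exp_fun a (sconv kernel (sm_density ?w))" by (rule sconv_exp_fun[OF D K]) (use a in linarith)
  have "?w = (\<lambda>x. ?v x + t * sconv kernel (sm_density ?w) x)"
  proof (rule laplace_unique[where ?s0.0 = a])
    fix s assume s: "a < s"
    have i0: "integrable lborel (\<lambda>x. exp (- s * x) * ?v x)" by (rule s1(2)) (use s a in simp)
    show "integrable lborel (\<lambda>x. exp (- s * x) * ?w x)" by (rule s2(2)) (use s a in simp)
    note iR = exp_fun_integrable[OF R s]
    have e: "exp (- s * x) * (?v x + t * sconv kernel (sm_density ?w) x)
        = exp (- s * x) * ?v x + t * (exp (- s * x) * sconv kernel (sm_density ?w) x)" for x
      by (simp add: algebra_simps)
    show "integrable lborel (\<lambda>x. exp (- s * x) * (?v x + t * sconv kernel (sm_density ?w) x))"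
      unfolding e using i0 iR by simp
    have "laplace (\<lambda>x. ?v x + t * sconv kernel (sm_density ?w) x) s = laplace ?v s + t * laplace (sconv kernel (sm_density ?w)) s"
      unfolding laplace_def e using i0 iR by simp
    also have "laplace (sconv kernel (sm_density ?w)) s = laplace kernel s * laplace ?w s"
      using laplace_sconv[OF D K s] laplace_sm_sm_density[OF w(3) s2(2)] s a by simp
    also have "laplace ?v s + t * (laplace kernel s * laplace ?w s) = laplace ?w s"
    proof -
      have "s1 < s" "s2 < s" "s0 < s" using s a by auto
      note r = resolvent_first_row[OF s1(1)[OF \<open>s1 < s\<close>] s2(1)[OF \<open>s2 < s\<close>], where k = None and j = j, OF exponent_eps[OF risk_axioms]]
      have "complex_of_real (laplace ?v s + t * (laplace kernel s * laplace ?w s)) = complex_of_real (laplace ?w s)"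
        using r s0 \<open>s0 < s\<close> by (simp add: s1(3)[OF \<open>s1 < s\<close>] s2(3)[OF \<open>s2 < s\<close>] mult_ac)
      then show ?thesis by (simp only: of_real_eq_iff)
    qed
    finally show "laplace ?w s = laplace (\<lambda>x. ?v x + t * sconv kernel (sm_density ?w) x) s" ..
  next
    show "continuous_on {0..} (\<lambda>x. ?v x + t * sconv kernel (sm_density ?w) x)"
      by (intro continuous_intros w0(1) exp_fun_halfline[OF R])
    show "\<And>x. x < 0 \<Longrightarrow> ?v x + t * sconv kernel (sm_density ?w) x = 0"
      by (simp add: w0(2) exp_funD(2)[OF R])
  qed (rule w, assumption?)+
  then have "W x $ None $ j = W0 x $ None $ j + t * sconv kernel (sm_density ?w) x" by metis
  then show "W x $ None $ j = W0 x $ None $ j + t * (LINT y|lborel. kernel (x - y) * W y $ None $ j)"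
    using sconv_sm_density[OF w(3) exp_funD(1)[OF K] s2(2)[OF a(3)] C] by simp
  show "integrable lborel (\<lambda>y. kernel (x - y) * W y $ None $ j)"
    by (rule mconv_sm_density_integrable[OF w(3) exp_funD(1)[OF K] s2(2)[OF a(3)] C])
qed

text \<open>The maximum over [0, U] is delivered with a point where it is attained, because the a
  priori bound evaluates the Volterra equation at that point.\<close>

lemma scale_bounded:
  assumes W: "is_scale_matrix M t q W" and U: "0 \<le> U"
  obtains x0 where "0 \<le> x0" "x0 \<le> U" "\<And>x. x \<le> U \<Longrightarrow> \<bar>W x $ None $ j\<bar> \<le> \<bar>W x0 $ None $ j\<bar>"
proof -
  note w = scale_matrix_entry[OF W, where i = None and j = j]
  have "continuous_on {0..U} (\<lambda>x. \<bar>W x $ None $ j\<bar>)"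
    by (intro continuous_intros continuous_on_subset[OF w(1)]) auto
  then obtain x0 where x0: "x0 \<in> {0..U}" "\<And>x. x \<in> {0..U} \<Longrightarrow> \<bar>W x $ None $ j\<bar> \<le> \<bar>W x0 $ None $ j\<bar>"
    using continuous_attains_sup[of "{0..U}" "\<lambda>x. \<bar>W x $ None $ j\<bar>"] U by auto
  show thesis
  proof (rule that[of x0])
    fix x assume "x \<le> U"
    then show "\<bar>W x $ None $ j\<bar> \<le> \<bar>W x0 $ None $ j\<bar>" using x0(2)[of x] w(2)[of x] by (cases "x < 0") auto
  qed (use x0 in auto)
qed

text \<open>Once \<open>t * K * U \<le> 1 / 2\<close>, with \<open>K\<close> a bound of the kernel on \<open>[0, U]\<close>, the Volterra equation bounds the
  perturbed row by twice the unperturbed one; inserting the equation into itself isolates the linear term.\<close>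

theorem scale_expansion:
  assumes U: "0 \<le> U"
  shows "\<exists>C e. 0 < e \<and> (\<forall>t W x. 0 \<le> t \<longrightarrow> t \<le> e \<longrightarrow> is_scale_matrix M t q W \<longrightarrow> x \<le> U \<longrightarrow>
    \<bar>W x $ None $ j - W0 x $ None $ j - t * corr j x\<bar> \<le> C * t\<^sup>2)"
proof -
  obtain a where a: "a > 0" "exp_fun a kernel" using kernel_exp_fun by blast
  obtain C where C: "\<And>x. \<bar>kernel x\<bar> \<le> C * exp (a * x)" "0 \<le> C" using exp_funE[OF a(2)] by blast
  define K where "K = C * exp (a * U)"
  have K: "\<bar>kernel x\<bar> \<le> K" if "x \<le> U" for x
  proof -
    have "C * exp (a * x) \<le> C * exp (a * U)" using that a C by (intro mult_left_mono) auto
    with C(1)[of x] show ?thesis by (simp add: K_def)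
  qed
  have K0: "0 \<le> K" using C by (simp add: K_def)
  note kz = exp_funD(2)[OF a(2)]
  note w0 = scale_matrix_entry[OF scale0, where i = None and j = j]
  obtain x0 where x0: "0 \<le> x0" "x0 \<le> U" "\<And>x. x \<le> U \<Longrightarrow> \<bar>W0 x $ None $ j\<bar> \<le> \<bar>W0 x0 $ None $ j\<bar>"
    using scale_bounded[OF scale0 U] by blast
  define m where "m = \<bar>W0 x0 $ None $ j\<bar>"
  \<comment> \<open>The added 1 keeps the denominator positive when K U = 0. As \<open>K\<close>
    bounds the unperturbed kernel, \<open>e\<close> is common to all perturbed scale
    matrices.\<close>
  define e where "e = 1 / (2 * (K * U + 1))"
  have KU: "0 \<le> K * U" using K0 U by simp
  have e: "0 < e" using KU by (simp add: e_def)
  have "\<bar>W x $ None $ j - W0 x $ None $ j - t * corr j x\<bar> \<le> (2 * m * (K * U)\<^sup>2) * t\<^sup>2"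
    if t: "0 \<le> t" "t \<le> e" and W: "is_scale_matrix M t q W" and x: "x \<le> U" for t W x
  proof -
    note w = scale_matrix_entry[OF W, where i = None and j = j]
    note V = scale_volterra[OF W, of _ j]
    note V0 = scale_volterra(2)[OF scale0, of _ j]
    obtain x1 where x1: "0 \<le> x1" "x1 \<le> U" "\<And>x. x \<le> U \<Longrightarrow> \<bar>W x $ None $ j\<bar> \<le> \<bar>W x1 $ None $ j\<bar>"
      using scale_bounded[OF W U] by blast
    define m1 where "m1 = \<bar>W x1 $ None $ j\<bar>"
    have "t * (2 * (K * U + 1)) \<le> 1" using t(2) KU by (simp add: e_def field_simps)
    then have eKU: "t * (K * U) \<le> 1 / 2" using t(1) by (simp add: algebra_simps)
    have cb: "\<bar>LINT y|lborel. kernel (x - y) * W y $ None $ j\<bar> \<le> K * U * m1" if "x \<le> U" for x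
      by (rule convolution_bound[where h = "\<lambda>y. W y $ None $ j", OF K kz w(2) _ U that]) (use x1 in \<open>auto simp: m1_def\<close>)
    \<comment> \<open>At the maximum point the integral term is at most m1 / 2 and is absorbed by
      the left-hand side.\<close>
    have m1: "m1 \<le> 2 * m"
    proof -
      have "m1 \<le> \<bar>W0 x1 $ None $ j\<bar> + \<bar>t * (LINT y|lborel. kernel (x1 - y) * W y $ None $ j)\<bar>"
        unfolding m1_def by (subst V(1)[of x1]) (rule abs_triangle_ineq)
      also have "\<bar>t * (LINT y|lborel. kernel (x1 - y) * W y $ None $ j)\<bar> \<le> t * (K * U * m1)"
        using cb[OF x1(2)] t(1) by (simp add: abs_mult mult_left_mono)
      also have "\<dots> = (t * (K * U)) * m1" by simp
      also have "\<dots> \<le> 1 / 2 * m1" by (rule mult_right_mono[OF eKU]) (simp add: m1_def)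
      also have "\<bar>W0 x1 $ None $ j\<bar> \<le> m" using x0(3)[OF x1(2)] by (simp add: m_def)
      finally show ?thesis by simp
    qed
    have diff: "\<bar>W y $ None $ j - W0 y $ None $ j\<bar> \<le> t * (K * U * (2 * m))" if "y \<le> U" for y
    proof -
      have "\<bar>W y $ None $ j - W0 y $ None $ j\<bar> = t * \<bar>LINT z|lborel. kernel (y - z) * W z $ None $ j\<bar>"
        using V(1)[of y] t(1) by (simp add: abs_mult)
      also have "\<dots> \<le> t * (K * U * m1)" using cb[OF that] t(1) by (rule mult_left_mono)
      also have "\<dots> \<le> t * (K * U * (2 * m))" using m1 t(1) KU by (intro mult_left_mono) auto
      finally show ?thesis .
    qed
    have "W x $ None $ j - W0 x $ None $ j - t * corr j x
        = t * ((LINT y|lborel. kernel (x - y) * W y $ None $ j) - (LINT y|lborel. kernel (x - y) * W0 y $ None $ j))"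
      using V(1)[of x] by (simp add: corr_eq algebra_simps)
    also have "\<dots> = t * (LINT y|lborel. kernel (x - y) * (W y $ None $ j - W0 y $ None $ j))"
      using V(2)[of x] V0[of x] by (simp add: right_diff_distrib)
    finally have "\<bar>W x $ None $ j - W0 x $ None $ j - t * corr j x\<bar>
        = t * \<bar>LINT y|lborel. kernel (x - y) * (W y $ None $ j - W0 y $ None $ j)\<bar>"
      using t(1) by (simp add: abs_mult)
    also have "\<dots> \<le> t * (K * U * (t * (K * U * (2 * m))))"
    proof (rule mult_left_mono[OF _ t(1)])
      show "\<bar>LINT y|lborel. kernel (x - y) * (W y $ None $ j - W0 y $ None $ j)\<bar> \<le> K * U * (t * (K * U * (2 * m)))"
        by (rule convolution_bound[where h = "\<lambda>y. W y $ None $ j - W0 y $ None $ j", OF K kz _ diff U x])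
           (use w(2) w0(2) t(1) K0 U in \<open>auto simp: m_def\<close>)
    qed
    also have "\<dots> = (2 * m * (K * U)\<^sup>2) * t\<^sup>2" by (simp add: power2_eq_square)
    finally show ?thesis .
  qed
  with e show ?thesis by blast
qed

end

section \<open>Determinants, roots and eigenvectors\<close>

text \<open>In the Leibniz formula every permutation that moves \<open>None\<close> meets a zero of
  row \<open>None\<close>. The others are the permutations of the phases transported along
  \<open>Some\<close>, with the same sign.\<close>

lemma det_option_border:
  fixes A :: "'a::comm_ring_1^('m::finite option)^('m option)"
  assumes row: "\<And>b. A $ None $ Some b = 0"
  shows "det A = A $ None $ None * det (\<chi> a b. A $ Some a $ Some b)"
proof -
  let ?f = "\<lambda>p. of_int (sign p) * (\<Prod>i\<in>UNIV. A $ i $ p i)"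
  let ?B = "(\<chi> a b. A $ Some a $ Some b) :: 'a^'m^'m"
  let ?S = "Some ` (UNIV :: 'm set)"
  let ?\<Phi> = "map_permutation (UNIV :: 'm set) Some"
  have inj: "inj (Some :: 'm \<Rightarrow> _)" by simp
  have U: "(UNIV :: 'm option set) = insert None ?S" by (auto simp: UNIV_option_conv)
  have sub: "p permutes ?S \<longleftrightarrow> p permutes UNIV \<and> p None = None" for p :: "'m option \<Rightarrow> 'm option"
  proof
    assume "p permutes ?S"
    then show "p permutes UNIV \<and> p None = None"
      using permutes_subset[of p ?S UNIV] permutes_not_in[of p ?S None] by auto
  next
    assume p: "p permutes UNIV \<and> p None = None"
    show "p permutes ?S"
      by (rule permutes_superset[of p UNIV]) (use p U in auto)
  qed
  have "det A = sum ?f {p. p permutes (UNIV :: 'm option set)}" by (simp add: det_def)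
  also have "\<dots> = sum ?f {p. p permutes ?S}"
  proof (rule sum.mono_neutral_right)
    show "finite {p. p permutes (UNIV :: 'm option set)}" by simp
    show "{p. p permutes ?S} \<subseteq> {p. p permutes UNIV}" using sub by auto
    show "\<forall>p\<in>{p. p permutes UNIV} - {p. p permutes ?S}. ?f p = 0"
    proof
      fix p assume "p \<in> {p. p permutes (UNIV :: 'm option set)} - {p. p permutes ?S}"
      then have "p None \<noteq> None" using sub by auto
      then have "A $ None $ p None = 0" using row by auto
      then have "(\<Prod>i\<in>UNIV. A $ i $ p i) = 0" by (intro prod_zero) auto
      then show "?f p = 0" by simp
    qed
  qed
  also have "\<dots> = (\<Sum>q | q permutes (UNIV :: 'm set). ?f (?\<Phi> q))"
  proof (rule sum.reindex_bij_betw[symmetric])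
    have "bij_betw (\<lambda>\<pi> i. if i \<in> ?S then Some (\<pi> (inv_into UNIV Some i)) else i) {\<pi>. \<pi> permutes UNIV} {\<pi>. \<pi> permutes ?S}"
      by (rule bij_betw_permutations) (simp add: bij_betw_def)
    also have "(\<lambda>\<pi> i. if i \<in> ?S then Some (\<pi> (inv_into UNIV Some i)) else i) = ?\<Phi>"
      by (simp add: fun_eq_iff map_permutation_def restrict_id_def)
    finally show "bij_betw ?\<Phi> {q. q permutes UNIV} {p. p permutes ?S}" .
  qed
  also have "\<dots> = (\<Sum>q | q permutes (UNIV :: 'm set). A $ None $ None * (of_int (sign q) * (\<Prod>a\<in>UNIV. ?B $ a $ q a)))"
  proof (rule sum.cong[OF refl])
    fix q assume "q \<in> {q. q permutes (UNIV :: 'm set)}"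
    then have q: "q permutes UNIV" by simp
    have sg: "sign (?\<Phi> q) = sign q" by (rule sign_map_permutation[OF inj q]) simp
    have "(\<Prod>i\<in>UNIV. A $ i $ ?\<Phi> q i) = A $ None $ None * (\<Prod>i\<in>?S. A $ i $ ?\<Phi> q i)"
    proof -
      have "?\<Phi> q None = None" by (auto simp: map_permutation_def restrict_id_def)
      then show ?thesis by (subst U) (simp del: UNIV_option_conv)
    qed
    also have "(\<Prod>i\<in>?S. A $ i $ ?\<Phi> q i) = (\<Prod>a\<in>UNIV. ?B $ a $ q a)"
      by (subst prod.reindex) (auto simp: map_permutation_apply)
    finally show "?f (?\<Phi> q) = A $ None $ None * (of_int (sign q) * (\<Prod>a\<in>UNIV. ?B $ a $ q a))"
      by (simp add: sg mult_ac)
  qed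
  also have "\<dots> = A $ None $ None * det ?B" by (simp add: det_def sum_distrib_left)
  finally show ?thesis .
qed

text \<open>The determinant is additive in row \<open>None\<close>. The added row is - d times a
  unit vector, so its contribution is a bordered determinant.\<close>

lemma det_option_rank_one:
  fixes A B :: "'a::comm_ring_1^('m::finite option)^('m option)"
  assumes "\<And>i j. B $ i $ j = A $ i $ j - (if i = None \<and> j = None then d else 0)"
  shows "det B = det A - d * det (\<chi> a b. A $ Some a $ Some b)"
proof -
  let ?E = "(\<chi> j. if j = None then - d else 0) :: 'a^'m option"
  have B: "B = (\<chi> i. if i = None then A $ None + ?E else A $ i)"
    using assms by (auto simp: vec_eq_iff)
  have A: "(\<chi> i. if i = None then A $ None else A $ i) = A" by (auto simp: vec_eq_iff)
  let ?G = "(\<chi> i. if i = None then ?E else A $ i) :: 'a^('m option)^('m option)"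
  have "det B = det A + det ?G"
    unfolding B by (subst det_row_add) (simp only: A)
  also have "det ?G = ?G $ None $ None * det (\<chi> a b. ?G $ Some a $ Some b)"
    by (rule det_option_border) simp
  finally show ?thesis by simp
qed

section \<open>Holomorphy of determinants and eigenvectors\<close>

lemma holomorphic_on_det:
  fixes A :: "complex \<Rightarrow> complex^'n::finite^'n"
  assumes "\<And>i j. (\<lambda>s. A s $ i $ j) holomorphic_on S"
  shows "(\<lambda>s. det (A s)) holomorphic_on S"
  unfolding det_def by (intro holomorphic_intros assms)

lemma T_plus_entry: "T_plus M s $ i $ j = of_real (gain_gen M $ i $ j) + (if i = j then s else 0)"
  by (simp add: T_plus_def mat_def map_matrix_def)

lemma T_plus_holomorphic: "(\<lambda>s. T_plus M s $ i $ j) holomorphic_on S"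
  unfolding T_plus_entry by (cases "i = j") (auto intro!: holomorphic_intros)

lemma wvec_holomorphic: "(\<lambda>s. wvec M s $ j) holomorphic_on S"
proof (cases j)
  case None
  then show ?thesis by (simp add: wvec_def holomorphic_on_det T_plus_holomorphic)
next
  case (Some b)
  have "(\<lambda>s. adjugate (T_plus M s) $ a $ b) holomorphic_on S" for a
    unfolding adjugate_def vec_lambda_beta
  proof (rule holomorphic_on_det)
    fix i j
    show "(\<lambda>s. (\<chi> k l. if k = b \<and> l = a then 1 else if k = b \<or> l = a then 0 else T_plus M s $ k $ l) $ i $ j) holomorphic_on S"
      by (cases "i = b \<and> j = a"; cases "i = b \<or> j = a") (auto intro: T_plus_holomorphic)
  qed
  then show ?thesis using Some by (simp add: wvec_def) (intro holomorphic_intros)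
qed

lemma (in risk) det_exponent_eps:
  "det (exponent M t q s) = det (exponent M 0 q s) - of_real t * s * kfun M s * det (T_plus M s)"
proof -
  have "det (exponent M t q s) = det (exponent M 0 q s)
      - of_real t * s * kfun M s * det (\<chi> a b. exponent M 0 q s $ Some a $ Some b)"
    by (rule det_option_rank_one) (rule exponent_eps[OF risk_axioms])
  also have "(\<chi> a b. exponent M 0 q s $ Some a $ Some b) = T_plus M s"
    by (simp add: exponent_def vec_eq_iff)
  finally show ?thesis .
qed

lemma (in risk) det_exponent_holomorphic: "(\<lambda>s. det (exponent M t q s)) holomorphic_on {s. 0 < Re s}"
proof (rule holomorphic_on_det)
  fix i j
  show "(\<lambda>s. exponent M t q s $ i $ j) holomorphic_on {s. 0 < Re s}"
    by (cases i; cases j) (auto simp: exponent_def intro!: holomorphic_intros phi_holomorphic T_plus_holomorphic)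
qed

section \<open>Simple roots and second-order remainders\<close>

lemma difference_quotient_bound:
  fixes f :: "complex \<Rightarrow> complex"
  assumes "f field_differentiable (at r)"
  obtains L where "0 \<le> L" "\<forall>\<^sub>F s in nhds r. norm (f s - f r) \<le> L * norm (s - r)"
proof -
  obtain D where "(f has_field_derivative D) (at r)" using assms by (auto simp: field_differentiable_def)
  then have "((\<lambda>s. (f s - f r) / (s - r)) \<longlongrightarrow> D) (at r)" by (simp add: has_field_derivative_iff)
  then have "((\<lambda>s. norm ((f s - f r) / (s - r))) \<longlongrightarrow> norm D) (at r)" by (rule tendsto_norm)
  then have "\<forall>\<^sub>F s in at r. norm ((f s - f r) / (s - r)) < norm D + 1" by (rule order_tendstoD) simp
  then have "\<forall>\<^sub>F s in nhds r. s \<noteq> r \<longrightarrow> norm ((f s - f r) / (s - r)) < norm D + 1"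
    by (simp add: eventually_at_filter)
  then have "\<forall>\<^sub>F s in nhds r. norm (f s - f r) \<le> (norm D + 1) * norm (s - r)"
  proof eventually_elim
    case (elim s)
    then show ?case by (cases "s = r") (auto simp: norm_divide divide_less_eq)
  qed
  then show thesis by (intro that[of "norm D + 1"]) auto
qed

text \<open>With D(z) = (z - r) G(z) and Q = K / G, the root equation reads rho - r = t Q(rho).
  Boundedness of Q near r gives rho - r = O(t), and the Lipschitz estimate of Q at r then makes the
  error of t Q(r) quadratic. Convergence of rho to r is all the regularity this takes.\<close>

lemma simple_root_expansion:
  fixes D K :: "complex \<Rightarrow> complex" and \<rho> :: "real \<Rightarrow> complex"
  assumes S: "open S" "r \<in> S" and D: "D holomorphic_on S" and K: "K holomorphic_on S"
    and r: "D r = 0" "deriv D r \<noteq> 0"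
    and lim: "(\<rho> \<longlongrightarrow> r) (at_right 0)" and root: "\<forall>\<^sub>F t in at_right 0. D (\<rho> t) = of_real t * K (\<rho> t)"
  shows "\<exists>C. \<forall>\<^sub>F t in at_right 0. norm (\<rho> t - r - of_real t * (K r / deriv D r)) \<le> C * t\<^sup>2"
proof -
  \<comment> \<open>The difference quotient with its removable singularity filled in; its value at r
    is nonzero because the root is simple.\<close>
  define G where "G z = (if z = r then deriv D r else (D z - D r) / (z - r))" for z
  have G: "G holomorphic_on S" unfolding G_def[abs_def] by (rule pole_lemma_open[OF D S(1)])
  have DG: "D z = (z - r) * G z" for z by (simp add: G_def r)
  have Gr: "G r \<noteq> 0" by (simp add: G_def r)
  define Q where "Q z = K z / G z" for z
  have diff: "f field_differentiable (at r)" if "f holomorphic_on S" for f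
    using that S holomorphic_on_imp_differentiable_at by blast
  have "Q field_differentiable (at r)"
    unfolding Q_def[abs_def] by (intro derivative_intros field_differentiable_divide diff G K Gr)
  then obtain L where L: "0 \<le> L" "\<forall>\<^sub>F s in nhds r. norm (Q s - Q r) \<le> L * norm (s - r)"
    by (rule difference_quotient_bound)
  have limn: "filterlim \<rho> (nhds r) (at_right 0)" by (rule lim)
  have "isCont G r" using diff[OF G] by (rule field_differentiable_imp_continuous_at)
  then have "((\<lambda>t. G (\<rho> t)) \<longlongrightarrow> G r) (at_right 0)" using lim by (rule isCont_tendsto_compose)
  then have e1: "\<forall>\<^sub>F t in at_right 0. G (\<rho> t) \<noteq> 0" using Gr by (rule tendsto_imp_eventually_ne)
  have e2: "\<forall>\<^sub>F t in at_right 0. norm (Q (\<rho> t) - Q r) \<le> L * norm (\<rho> t - r)"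
    using L(2) limn by (rule eventually_compose_filterlim)
  have "((\<lambda>t. norm (\<rho> t - r)) \<longlongrightarrow> norm (r - r)) (at_right 0)" by (intro tendsto_intros lim)
  then have e3: "\<forall>\<^sub>F t in at_right 0. norm (\<rho> t - r) < 1" by (rule order_tendstoD) simp
  have e4: "\<forall>\<^sub>F t in at_right 0. (0::real) < t" by (simp add: eventually_at_right_less)
  have "\<forall>\<^sub>F t in at_right 0. norm (\<rho> t - r - of_real t * Q r) \<le> (L * (norm (Q r) + L)) * t\<^sup>2"
    using e1 e2 e3 e4 root
  proof eventually_elim
    case (elim t)
    have eq: "\<rho> t - r = of_real t * Q (\<rho> t)"
      using elim(1,5) by (simp add: DG Q_def field_simps)
    have "norm (Q (\<rho> t)) \<le> norm (Q r) + L"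
    proof -
      have "norm (Q (\<rho> t)) \<le> norm (Q r) + norm (Q (\<rho> t) - Q r)" by (rule norm_triangle_sub)
      also have "norm (Q (\<rho> t) - Q r) \<le> L * 1"
        using elim(2,3) L(1) mult_left_mono[of "norm (\<rho> t - r)" 1 L] by linarith
      finally show ?thesis by simp
    qed
    then have b: "norm (\<rho> t - r) \<le> t * (norm (Q r) + L)"
      using elim(4) by (simp add: eq norm_mult)
    have "\<rho> t - r - of_real t * Q r = of_real t * (Q (\<rho> t) - Q r)" by (simp add: eq algebra_simps)
    then have "norm (\<rho> t - r - of_real t * Q r) = t * norm (Q (\<rho> t) - Q r)" using elim(4) by (simp add: norm_mult)
    also have "\<dots> \<le> t * (L * (t * (norm (Q r) + L)))"
      using elim(2,4) mult_left_mono[OF b L(1)] by (intro mult_left_mono) auto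
    finally show ?case by (simp add: power2_eq_square mult_ac)
  qed
  moreover have "Q r = K r / deriv D r" by (simp add: Q_def G_def)
  ultimately show ?thesis by auto
qed

text \<open>The filled-in difference quotient is holomorphic; its Lipschitz estimate at r,
  multiplied by s - r, is the second-order remainder.\<close>

lemma holomorphic_second_order:
  fixes f :: "complex \<Rightarrow> complex"
  assumes S: "open S" "r \<in> S" and f: "f holomorphic_on S"
  obtains L where "0 \<le> L" "\<forall>\<^sub>F s in nhds r. norm (f s - f r - deriv f r * (s - r)) \<le> L * (norm (s - r))\<^sup>2"
proof -
  define G where "G z = (if z = r then deriv f r else (f z - f r) / (z - r))" for z
  have "G holomorphic_on S" unfolding G_def[abs_def] by (rule pole_lemma_open[OF f S(1)])
  then have "G field_differentiable (at r)" using S holomorphic_on_imp_differentiable_at by blast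
  then obtain L where L: "0 \<le> L" "\<forall>\<^sub>F s in nhds r. norm (G s - G r) \<le> L * norm (s - r)"
    by (rule difference_quotient_bound)
  have "f s - f r - deriv f r * (s - r) = (G s - G r) * (s - r)" for s
    by (auto simp: G_def field_simps)
  then have "norm (f s - f r - deriv f r * (s - r)) = norm (G s - G r) * norm (s - r)" for s
    by (metis norm_mult)
  moreover have "\<forall>\<^sub>F s in nhds r. norm (G s - G r) * norm (s - r) \<le> L * (norm (s - r))\<^sup>2"
    using L(2) by eventually_elim (auto simp: power2_eq_square mult.assoc[symmetric] intro: mult_right_mono)
  ultimately show thesis using L(1) that by simp
qed

section \<open>First-order expansions, uniformly on the half-line\<close>

text \<open>The range of small t does not depend on z, which makes the remainder uniform on the
  half-line. Boundedness of both coefficients is included so that the notion is stable under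
  products.\<close>

definition expands :: "(real \<Rightarrow> real \<Rightarrow> 'a::real_normed_vector) \<Rightarrow> (real \<Rightarrow> 'a) \<Rightarrow> (real \<Rightarrow> 'a) \<Rightarrow> bool" where
  "expands f f0 f1 \<longleftrightarrow> (\<exists>C. (\<forall>z\<ge>0. norm (f0 z) \<le> C \<and> norm (f1 z) \<le> C) \<and>
     (\<forall>\<^sub>F t in at_right 0. \<forall>z\<ge>0. norm (f t z - f0 z - t *\<^sub>R f1 z) \<le> C * t\<^sup>2))"

lemma expandsI:
  assumes "\<And>z. 0 \<le> z \<Longrightarrow> norm (f0 z) \<le> A" "\<And>z. 0 \<le> z \<Longrightarrow> norm (f1 z) \<le> B"
    and "\<forall>\<^sub>F t in at_right 0. \<forall>z\<ge>0. norm (f t z - f0 z - t *\<^sub>R f1 z) \<le> C * t\<^sup>2"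
  shows "expands f f0 f1"
  unfolding expands_def
proof (intro exI conjI)
  let ?C = "max A (max B C)"
  show "\<forall>z\<ge>0. norm (f0 z) \<le> ?C \<and> norm (f1 z) \<le> ?C" using assms(1,2) by (auto simp: le_max_iff_disj)
  show "\<forall>\<^sub>F t in at_right 0. \<forall>z\<ge>0. norm (f t z - f0 z - t *\<^sub>R f1 z) \<le> ?C * t\<^sup>2"
    using assms(3)
  proof eventually_elim
    case (elim t)
    have "C * t\<^sup>2 \<le> ?C * t\<^sup>2" by (intro mult_right_mono) auto
    with elim show ?case by (meson order_trans)
  qed
qed

lemma expandsE:
  assumes "expands f f0 f1"
  obtains C where "0 \<le> C" "\<And>z. 0 \<le> z \<Longrightarrow> norm (f0 z) \<le> C" "\<And>z. 0 \<le> z \<Longrightarrow> norm (f1 z) \<le> C"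
    "\<forall>\<^sub>F t in at_right 0. \<forall>z\<ge>0. norm (f t z - f0 z - t *\<^sub>R f1 z) \<le> C * t\<^sup>2"
proof -
  obtain C where C: "\<forall>z\<ge>0. norm (f0 z) \<le> C \<and> norm (f1 z) \<le> C"
    "\<forall>\<^sub>F t in at_right 0. \<forall>z\<ge>0. norm (f t z - f0 z - t *\<^sub>R f1 z) \<le> C * t\<^sup>2"
    using assms unfolding expands_def by blast
  have "0 \<le> C" using C(1) norm_ge_zero[of "f0 0"] by (meson order_refl order_trans)
  with C that show thesis by blast
qed

lemma eventually_at_right_0_between: "0 < (d::real) \<Longrightarrow> \<forall>\<^sub>F t in at_right 0. 0 < t \<and> t < d"
  by (auto simp: eventually_at_right[of 0 1] intro!: exI[of _ d])

lemma norm_triangle3: "norm (a + b + c) \<le> norm a + norm b + norm c"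
  and norm_triangle4: "norm (a + b + c + d) \<le> norm a + norm b + norm c + norm d"
  for a b c d :: "'a::real_normed_vector"
  by norm+

text \<open>Product rule: with remainders a and b of the factors, what is left beyond first order is
  p f0 b + t^2 p f1 g1 + t p f1 b + p a g.\<close>

lemma expands_bilinear:
  assumes "bounded_bilinear p" and f: "expands f f0 f1" and g: "expands g g0 g1"
  shows "expands (\<lambda>t z. p (f t z) (g t z)) (\<lambda>z. p (f0 z) (g0 z)) (\<lambda>z. p (f0 z) (g1 z) + p (f1 z) (g0 z))"
proof -
  interpret bounded_bilinear p by fact
  obtain K where "0 \<le> K" "\<forall>a b. norm (p a b) \<le> norm a * norm b * K" using nonneg_bounded by blast
  then have K: "0 \<le> K" "\<And>a b. norm (p a b) \<le> norm a * norm b * K" by auto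
  obtain A where A: "0 \<le> A" "\<And>z. 0 \<le> z \<Longrightarrow> norm (f0 z) \<le> A" "\<And>z. 0 \<le> z \<Longrightarrow> norm (f1 z) \<le> A"
    "\<forall>\<^sub>F t in at_right 0. \<forall>z\<ge>0. norm (f t z - f0 z - t *\<^sub>R f1 z) \<le> A * t\<^sup>2"
    by (rule expandsE[OF f]) (rule that; blast)
  obtain B where B: "0 \<le> B" "\<And>z. 0 \<le> z \<Longrightarrow> norm (g0 z) \<le> B" "\<And>z. 0 \<le> z \<Longrightarrow> norm (g1 z) \<le> B"
    "\<forall>\<^sub>F t in at_right 0. \<forall>z\<ge>0. norm (g t z - g0 z - t *\<^sub>R g1 z) \<le> B * t\<^sup>2"
    by (rule expandsE[OF g]) (rule that; blast)
  have bd: "norm (p a b) \<le> x * y * K" if "norm a \<le> x" "norm b \<le> y" for a b x y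
  proof -
    have "norm a * norm b * K \<le> x * y * K"
      using that K(1) by (intro mult_right_mono mult_mono) (auto intro: order_trans[OF norm_ge_zero])
    with K(2)[of a b] show ?thesis by linarith
  qed
  show ?thesis
  proof (rule expandsI)
    show "norm (p (f0 z) (g0 z)) \<le> A * B * K" if "0 \<le> z" for z by (rule bd[OF A(2)[OF that] B(2)[OF that]])
    show "norm (p (f0 z) (g1 z) + p (f1 z) (g0 z)) \<le> A * B * K + A * B * K" if "0 \<le> z" for z
      using bd[OF A(2) B(3)] bd[OF A(3) B(2)] that by (meson add_mono norm_triangle_le)
    show "\<forall>\<^sub>F t in at_right 0. \<forall>z\<ge>0. norm (p (f t z) (g t z) - p (f0 z) (g0 z)
        - t *\<^sub>R (p (f0 z) (g1 z) + p (f1 z) (g0 z))) \<le> (6 * (A * B * K)) * t\<^sup>2"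
      using A(4) B(4) eventually_at_right_0_between[of 1, simplified]
    proof eventually_elim
      case (elim t)
      have t: "0 < t" "t \<le> 1" using elim by auto
      have e2: "t\<^sup>2 \<le> 1" using t by (simp add: power_le_one)
      show ?case
      proof (intro allI impI)
        fix z :: real assume z: "0 \<le> z"
        define a where "a = f t z - f0 z - t *\<^sub>R f1 z"
        define b where "b = g t z - g0 z - t *\<^sub>R g1 z"
        have a: "norm a \<le> A * t\<^sup>2" and b: "norm b \<le> B * t\<^sup>2" using elim z by (auto simp: a_def b_def)
        have fz: "f t z = f0 z + t *\<^sub>R f1 z + a" and gz: "g t z = g0 z + t *\<^sub>R g1 z + b"
          by (simp_all add: a_def b_def)
        \<comment> \<open>For t <= 1 the value at 0, the linear term and the remainder are each at
          most \<open>B\<close>.\<close>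
        have gb: "norm (g t z) \<le> 3 * B"
        proof -
          have "norm (g t z) \<le> norm (g0 z) + norm (t *\<^sub>R g1 z) + norm b" unfolding gz by (rule norm_triangle3)
          also have "norm (t *\<^sub>R g1 z) \<le> 1 * B" unfolding norm_scaleR using t B(3)[OF z] by (intro mult_mono) auto
          also have "norm b \<le> B * 1" using b mult_left_mono[OF e2 B(1)] by linarith
          finally show ?thesis using B(2)[OF z] by simp
        qed
        have "p (f t z) (g t z) - p (f0 z) (g0 z) - t *\<^sub>R (p (f0 z) (g1 z) + p (f1 z) (g0 z))
            = p (f0 z) b + t\<^sup>2 *\<^sub>R p (f1 z) (g1 z) + t *\<^sub>R p (f1 z) b + p a (g t z)"
        proof -
          have "p (f t z) (g t z) = p (f0 z) (g t z) + t *\<^sub>R p (f1 z) (g t z) + p a (g t z)"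
            by (subst (1) fz) (simp add: add_left scaleR_left)
          then show ?thesis
            by (simp add: gz add_left add_right scaleR_left scaleR_right algebra_simps power2_eq_square)
        qed
        also have "norm \<dots> \<le> norm (p (f0 z) b) + norm (t\<^sup>2 *\<^sub>R p (f1 z) (g1 z)) + norm (t *\<^sub>R p (f1 z) b) + norm (p a (g t z))"
          by (rule norm_triangle4)
        \<comment> \<open>The terms contribute 1 + 1 + 1 + 3 times A B K t^2, hence the constant
          6.\<close>
        also have "\<dots> \<le> A * (B * t\<^sup>2) * K + t\<^sup>2 * (A * B * K) + 1 * (A * (B * t\<^sup>2) * K) + (A * t\<^sup>2) * (3 * B) * K"
          unfolding norm_scaleR using t A(2,3)[OF z] B(2,3)[OF z] a b gb
          by (intro add_mono mult_mono bd) auto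
        also have "\<dots> = (6 * (A * B * K)) * t\<^sup>2" by (simp add: algebra_simps)
        finally show "norm (p (f t z) (g t z) - p (f0 z) (g0 z)
          - t *\<^sub>R (p (f0 z) (g1 z) + p (f1 z) (g0 z))) \<le> (6 * (A * B * K)) * t\<^sup>2" .
      qed
    qed
  qed
qed

lemma expands_bounded_linear:
  assumes "bounded_linear h" and f: "expands f f0 f1"
  shows "expands (\<lambda>t z. h (f t z)) (\<lambda>z. h (f0 z)) (\<lambda>z. h (f1 z))"
proof -
  interpret bounded_linear h by fact
  obtain K where "0 \<le> K" "\<forall>a. norm (h a) \<le> norm a * K" using nonneg_bounded by blast
  then have K: "0 \<le> K" "\<And>a. norm (h a) \<le> norm a * K" by auto
  obtain A where A: "0 \<le> A" "\<And>z. 0 \<le> z \<Longrightarrow> norm (f0 z) \<le> A" "\<And>z. 0 \<le> z \<Longrightarrow> norm (f1 z) \<le> A"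
    "\<forall>\<^sub>F t in at_right 0. \<forall>z\<ge>0. norm (f t z - f0 z - t *\<^sub>R f1 z) \<le> A * t\<^sup>2"
    by (rule expandsE[OF f]) (rule that; blast)
  have bd: "norm (h a) \<le> x * K" if "norm a \<le> x" for a x
    using order_trans[OF K(2) mult_right_mono[OF that K(1)]] .
  show ?thesis
  proof (rule expandsI)
    show "\<forall>\<^sub>F t in at_right 0. \<forall>z\<ge>0. norm (h (f t z) - h (f0 z) - t *\<^sub>R h (f1 z)) \<le> (A * K) * t\<^sup>2"
      using A(4)
    proof eventually_elim
      case (elim t)
      show ?case
      proof (intro allI impI)
        fix z :: real assume "0 \<le> z"
        then have "norm (h (f t z - f0 z - t *\<^sub>R f1 z)) \<le> A * t\<^sup>2 * K" using elim bd by blast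
        then show "norm (h (f t z) - h (f0 z) - t *\<^sub>R h (f1 z)) \<le> (A * K) * t\<^sup>2"
          by (simp add: diff scaleR mult_ac)
      qed
    qed
  qed (use A bd in auto)
qed

lemma expands_add:
  assumes f: "expands f f0 f1" and g: "expands g g0 g1"
  shows "expands (\<lambda>t z. f t z + g t z) (\<lambda>z. f0 z + g0 z) (\<lambda>z. f1 z + g1 z)"
proof -
  obtain A where A: "0 \<le> A" "\<And>z. 0 \<le> z \<Longrightarrow> norm (f0 z) \<le> A" "\<And>z. 0 \<le> z \<Longrightarrow> norm (f1 z) \<le> A"
    "\<forall>\<^sub>F t in at_right 0. \<forall>z\<ge>0. norm (f t z - f0 z - t *\<^sub>R f1 z) \<le> A * t\<^sup>2"
    by (rule expandsE[OF f]) (rule that; blast)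
  obtain B where B: "0 \<le> B" "\<And>z. 0 \<le> z \<Longrightarrow> norm (g0 z) \<le> B" "\<And>z. 0 \<le> z \<Longrightarrow> norm (g1 z) \<le> B"
    "\<forall>\<^sub>F t in at_right 0. \<forall>z\<ge>0. norm (g t z - g0 z - t *\<^sub>R g1 z) \<le> B * t\<^sup>2"
    by (rule expandsE[OF g]) (rule that; blast)
  show ?thesis
  proof (rule expandsI)
    show "norm (f0 z + g0 z) \<le> A + B" if "0 \<le> z" for z using A(2)[OF that] B(2)[OF that] by norm
    show "norm (f1 z + g1 z) \<le> A + B" if "0 \<le> z" for z using A(3)[OF that] B(3)[OF that] by norm
    show "\<forall>\<^sub>F t in at_right 0. \<forall>z\<ge>0. norm (f t z + g t z - (f0 z + g0 z) - t *\<^sub>R (f1 z + g1 z)) \<le> (A + B) * t\<^sup>2"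
      using A(4) B(4)
    proof eventually_elim
      case (elim t)
      show ?case
      proof (intro allI impI)
        fix z :: real assume z: "0 \<le> z"
        have "f t z + g t z - (f0 z + g0 z) - t *\<^sub>R (f1 z + g1 z)
            = (f t z - f0 z - t *\<^sub>R f1 z) + (g t z - g0 z - t *\<^sub>R g1 z)" by (simp add: algebra_simps)
        also have "norm \<dots> \<le> A * t\<^sup>2 + B * t\<^sup>2" using elim z by (intro norm_triangle_mono) auto
        finally show "norm (f t z + g t z - (f0 z + g0 z) - t *\<^sub>R (f1 z + g1 z)) \<le> (A + B) * t\<^sup>2"
          by (simp add: distrib_right)
      qed
    qed
  qed
qed

lemma expands_zero: "expands (\<lambda>t z. 0) (\<lambda>z. 0) (\<lambda>z. 0)"
  by (rule expandsI[where A = 0 and B = 0 and C = 0]) auto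

lemma expands_sum:
  assumes "\<And>i. i \<in> I \<Longrightarrow> expands (f i) (f0 i) (f1 i)"
  shows "expands (\<lambda>t z. \<Sum>i\<in>I. f i t z) (\<lambda>z. \<Sum>i\<in>I. f0 i z) (\<lambda>z. \<Sum>i\<in>I. f1 i z)"
  using assms by (induction I rule: infinite_finite_induct) (auto intro: expands_zero expands_add)

lemma expands_diff:
  assumes "expands f f0 f1" "expands g g0 g1"
  shows "expands (\<lambda>t z. f t z - g t z) (\<lambda>z. f0 z - g0 z) (\<lambda>z. f1 z - g1 z)"
  using expands_add[OF assms(1) expands_bounded_linear[OF bounded_linear_minus[OF bounded_linear_ident] assms(2)]]
  by simp

lemma expands_cong:
  assumes "expands f f0 f1" "\<forall>\<^sub>F t in at_right 0. \<forall>z\<ge>0. f t z = g t z"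
    "\<And>z. 0 \<le> z \<Longrightarrow> f0 z = g0 z" "\<And>z. 0 \<le> z \<Longrightarrow> f1 z = g1 z"
  shows "expands g g0 g1"
proof -
  obtain A where A: "0 \<le> A" "\<And>z. 0 \<le> z \<Longrightarrow> norm (f0 z) \<le> A" "\<And>z. 0 \<le> z \<Longrightarrow> norm (f1 z) \<le> A"
    "\<forall>\<^sub>F t in at_right 0. \<forall>z\<ge>0. norm (f t z - f0 z - t *\<^sub>R f1 z) \<le> A * t\<^sup>2"
    by (rule expandsE[OF assms(1)]) (rule that; blast)
  have "\<forall>\<^sub>F t in at_right 0. \<forall>z\<ge>0. norm (g t z - g0 z - t *\<^sub>R g1 z) \<le> A * t\<^sup>2"
    using A(4) assms(2) by eventually_elim (use assms(3,4) in auto)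
  then show ?thesis by (rule expandsI[rotated 2]) (use A assms(3,4) in auto)
qed

text \<open>There are finitely many components, so their constants can be added and the eventual
  estimates intersected.\<close>

lemma expands_vecI:
  fixes f :: "real \<Rightarrow> real \<Rightarrow> ('a::real_normed_vector)^('n::finite)"
  assumes "\<And>i. expands (\<lambda>t z. f t z $ i) (\<lambda>z. f0 z $ i) (\<lambda>z. f1 z $ i)"
  shows "expands f f0 f1"
proof -
  let ?Q = "\<lambda>i C. (\<forall>z\<ge>0. norm (f0 z $ i) \<le> C \<and> norm (f1 z $ i) \<le> C) \<and>
     (\<forall>\<^sub>F t in at_right 0. \<forall>z\<ge>0. norm (f t z $ i - f0 z $ i - t *\<^sub>R f1 z $ i) \<le> C * t\<^sup>2)"
  have "\<forall>i. \<exists>C. ?Q i C" using assms unfolding expands_def by blast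
  then obtain C where C': "\<forall>i. ?Q i (C i)" by (rule choice[THEN exE])
  have C: "\<And>i z. 0 \<le> z \<Longrightarrow> norm (f0 z $ i) \<le> C i" "\<And>i z. 0 \<le> z \<Longrightarrow> norm (f1 z $ i) \<le> C i"
    "\<And>i. \<forall>\<^sub>F t in at_right 0. \<forall>z\<ge>0. norm (f t z $ i - f0 z $ i - t *\<^sub>R f1 z $ i) \<le> C i * t\<^sup>2"
    using C' by blast+
  have n: "norm x \<le> (\<Sum>i\<in>UNIV. b i)" if "\<And>i. norm (x $ i) \<le> b i" for x :: "'a^'n" and b
    unfolding norm_vec_def using that by (intro order_trans[OF L2_set_le_sum] sum_mono) auto
  show ?thesis
  proof (rule expandsI)
    have "\<forall>\<^sub>F t in at_right 0. \<forall>i. \<forall>z\<ge>0. norm (f t z $ i - f0 z $ i - t *\<^sub>R f1 z $ i) \<le> C i * t\<^sup>2"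
      using C(3) by (rule eventually_all_finite)
    then show "\<forall>\<^sub>F t in at_right 0. \<forall>z\<ge>0. norm (f t z - f0 z - t *\<^sub>R f1 z) \<le> (\<Sum>i\<in>UNIV. C i) * t\<^sup>2"
      by eventually_elim (auto simp: sum_distrib_right intro!: n)
    show "norm (f0 z) \<le> (\<Sum>i\<in>UNIV. C i)" "norm (f1 z) \<le> (\<Sum>i\<in>UNIV. C i)" if "0 \<le> z" for z
      by (rule n, rule C(1)[OF that]) (rule n, rule C(2)[OF that])
  qed
qed

section \<open>Matrix products and inverses\<close>

lemma bounded_bilinear_matrix_mult:
  "bounded_bilinear ((**) :: complex^('n::finite)^('m::finite) \<Rightarrow> complex^('k::finite)^'n \<Rightarrow> _)"
  unfolding bilinear_conv_bounded_bilinear[symmetric] bilinear_def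
  by (auto intro!: linearI simp: vec_eq_iff matrix_matrix_mult_def algebra_simps sum.distrib scaleR_sum_right)

text \<open>For the inverses X of L0 and Y of L t, one has X - Y = X (L t - L0) Y. This first bounds
  Y by absorption, then gives X - Y = O(t), and inserted into itself it isolates the linear term - X
  L1 X.\<close>

lemma expands_matrix_inv:
  fixes L :: "real \<Rightarrow> complex^('n::finite)^'n"
  assumes L: "expands (\<lambda>t z. L t) (\<lambda>z. L0) (\<lambda>z. L1)"
    and inv: "\<forall>\<^sub>F t in at_right 0. invertible (L t)" and inv0: "invertible L0"
  shows "expands (\<lambda>t z. matrix_inv (L t)) (\<lambda>z. matrix_inv L0) (\<lambda>z. - (matrix_inv L0 ** L1 ** matrix_inv L0))"
proof -
  interpret mm: bounded_bilinear "(**) :: complex^'n^'n \<Rightarrow> complex^'n^'n \<Rightarrow> _" by (rule bounded_bilinear_matrix_mult)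
  obtain K where "0 \<le> K" "\<forall>(a :: complex^'n^'n) (b :: complex^'n^'n). norm (a ** b) \<le> norm a * norm b * K"
    using mm.nonneg_bounded by blast
  then have K: "0 \<le> K" "\<And>(a :: complex^'n^'n) (b :: complex^'n^'n). norm (a ** b) \<le> norm a * norm b * K" by auto
  obtain A where A: "0 \<le> A" "norm L0 \<le> A" "norm L1 \<le> A"
    "\<forall>\<^sub>F t in at_right 0. norm (L t - L0 - t *\<^sub>R L1) \<le> A * t\<^sup>2"
  proof (rule expandsE[OF L])
    fix C
    assume C: "0 \<le> C" "\<And>z::real. 0 \<le> z \<Longrightarrow> norm L0 \<le> C" "\<And>z::real. 0 \<le> z \<Longrightarrow> norm L1 \<le> C"
      "\<forall>\<^sub>F t in at_right 0. \<forall>z\<ge>0::real. norm (L t - L0 - t *\<^sub>R L1) \<le> C * t\<^sup>2"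
    have "\<forall>\<^sub>F t in at_right 0. norm (L t - L0 - t *\<^sub>R L1) \<le> C * t\<^sup>2"
      using C(4) by eventually_elim blast
    then show thesis by (rule that[OF C(1) C(2)[OF order_refl] C(3)[OF order_refl]])
  qed
  \<comment> \<open>A product of three matrices costs the constant of the bilinear product
    twice.\<close>
  have bd: "norm (a ** b ** c) \<le> x * y * w * (K * K)"
    if "norm a \<le> x" "norm b \<le> y" "norm c \<le> w" for a b c :: "complex^'n^'n" and x y w
  proof -
    have x: "0 \<le> x" "0 \<le> y" "0 \<le> w" using that norm_ge_zero order_trans by blast+
    have "norm a * norm b * K \<le> x * y * K"
      using that K(1) x by (intro mult_right_mono mult_mono) auto
    then have "norm (a ** b) \<le> x * y * K" using K(2)[of a b] by linarith
    then have "norm (a ** b) * norm c * K \<le> (x * y * K) * w * K"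
      using that K(1) x by (intro mult_right_mono mult_mono) auto
    with K(2)[of "a ** b" c] show ?thesis by (simp add: mult_ac)
  qed
  define X where "X = matrix_inv L0"
  define x where "x = norm X"
  have x0: "0 \<le> x" by (simp add: x_def)
  \<comment> \<open>The bound of |X - Y| / t that results from |L t - L0| <= 2 A t and |Y| <= 2
    x.\<close>
  define B where "B = x * (2 * A) * (2 * x) * (K * K)"
  have B0: "0 \<le> B" using x0 A(1) K(1) by (simp add: B_def)
  \<comment> \<open>With P = x (4 A) K^2, t < d gives P t <= 1 and therefore |X - Y| <= |Y| / 2; the
    added 1 covers P = 0.\<close>
  define d where "d = 1 / (x * (4 * A) * (K * K) + 1)"
  have P0: "0 \<le> x * (4 * A) * (K * K)" using x0 A(1) K(1) by simp
  then have P1: "0 < x * (4 * A) * (K * K) + 1" by linarith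
  then have d: "0 < d" unfolding d_def by (rule divide_pos_pos[OF zero_less_one])
  have "\<forall>\<^sub>F t in at_right 0. norm (matrix_inv (L t) - X + t *\<^sub>R (X ** L1 ** X))
      \<le> (x * A * (2 * x) * (K * K) + x * A * B * (K * K)) * t\<^sup>2"
    using A(4) inv eventually_at_right_0_between[OF zero_less_one] eventually_at_right_0_between[OF d]
  proof eventually_elim
    case (elim t)
    define Y where "Y = matrix_inv (L t)"
    have t: "0 < t" "t \<le> 1" "t < d" using elim by auto
    have D: "norm (L t - L0) \<le> 2 * A * t"
    proof -
      have "norm (L t - L0) \<le> norm (L t - L0 - t *\<^sub>R L1) + norm (t *\<^sub>R L1)"
        using norm_triangle_sub[of "L t - L0" "t *\<^sub>R L1"] by simp
      also have "\<dots> \<le> A * t\<^sup>2 + t * A" using elim(1) A(3) t by (intro add_mono) auto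
      also have "A * t\<^sup>2 \<le> A * t" using t A(1) by (intro mult_left_mono) (auto simp: power2_eq_square mult_left_le_one_le)
      finally show ?thesis by simp
    qed
    have YX: "X - Y = X ** (L t - L0) ** Y"
    proof -
      have "X ** (L t - L0) ** Y = X ** (L t ** Y) - (X ** L0) ** Y"
        by (simp add: matrix_mult_diff_distrib matrix_mul_assoc)
      then show ?thesis using matrix_inv_right[OF elim(2)] matrix_inv_left[OF inv0] by (simp add: X_def Y_def)
    qed
    have "norm (X - Y) \<le> x * (2 * A * t) * norm Y * (K * K)"
      unfolding YX by (rule bd[OF _ D]) (auto simp: x_def)
    also have "\<dots> = (x * (4 * A) * (K * K)) * t * (norm Y / 2)" by simp
    also have "\<dots> \<le> 1 * (norm Y / 2)"
    proof (rule mult_right_mono)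
      have "(x * (4 * A) * (K * K)) * t \<le> (x * (4 * A) * (K * K) + 1) * d"
        using t P0 by (intro mult_mono) auto
      also have "\<dots> = 1" unfolding d_def using P1 by (metis less_irrefl nonzero_mult_div_cancel_left times_divide_eq_right mult.right_neutral)
      finally show "(x * (4 * A) * (K * K)) * t \<le> 1" .
    qed simp
    finally have "norm Y \<le> 2 * x" using norm_triangle_sub[of Y X] by (simp add: x_def norm_minus_commute)
    note nY = this
    have B: "norm (X - Y) \<le> B * t"
    proof -
      have "norm (X ** (L t - L0) ** Y) \<le> x * (2 * A * t) * (2 * x) * (K * K)"
        by (rule bd[OF _ D nY]) (simp add: x_def)
      then show ?thesis unfolding YX[symmetric] B_def by (simp add: mult_ac)
    qed
    have eq: "Y - X + t *\<^sub>R (X ** L1 ** X) = t *\<^sub>R (X ** L1 ** (X - Y)) - X ** (L t - L0 - t *\<^sub>R L1) ** Y"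
    proof -
      have "X ** (L t - L0 - t *\<^sub>R L1) ** Y = X ** (L t - L0) ** Y - t *\<^sub>R (X ** L1 ** Y)"
        by (simp only: mm.diff_left mm.diff_right mm.scaleR_left mm.scaleR_right)
      then show ?thesis unfolding YX[symmetric]
        by (simp add: mm.diff_right scaleR_diff_right)
    qed
    have "norm (Y - X + t *\<^sub>R (X ** L1 ** X)) \<le> norm (t *\<^sub>R (X ** L1 ** (X - Y))) + norm (X ** (L t - L0 - t *\<^sub>R L1) ** Y)"
      unfolding eq by (rule norm_triangle_ineq4)
    also have "\<dots> \<le> t * (x * A * (B * t) * (K * K)) + x * (A * t\<^sup>2) * (2 * x) * (K * K)"
    proof (rule add_mono)
      have "norm (X ** L1 ** (X - Y)) \<le> x * A * (B * t) * (K * K)"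
        by (rule bd[OF _ A(3) B]) (simp add: x_def)
      then show "norm (t *\<^sub>R (X ** L1 ** (X - Y))) \<le> t * (x * A * (B * t) * (K * K))"
        using t by simp
      show "norm (X ** (L t - L0 - t *\<^sub>R L1) ** Y) \<le> x * (A * t\<^sup>2) * (2 * x) * (K * K)"
        by (rule bd[OF _ elim(1) nY]) (simp add: x_def)
    qed
    also have "\<dots> = (x * A * (2 * x) * (K * K) + x * A * B * (K * K)) * t\<^sup>2"
      by (simp add: algebra_simps power2_eq_square)
    finally show ?case by (simp add: Y_def)
  qed
  then show ?thesis
    by (intro expandsI[where C = "x * A * (2 * x) * (K * K) + x * A * B * (K * K)", OF order_refl order_refl])
       (simp add: X_def)
qed

section \<open>Functions of a moving root\<close>

lemma expands_const_complex:
  fixes \<rho> :: "real \<Rightarrow> complex"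
  assumes "\<forall>\<^sub>F t in at_right 0. norm (\<rho> t - r - of_real t * \<delta>) \<le> C * t\<^sup>2"
  shows "expands (\<lambda>t z. \<rho> t) (\<lambda>z. r) (\<lambda>z. \<delta>)"
  by (rule expandsI[where C = C, OF order_refl order_refl]) (use assms in \<open>simp add: scaleR_conv_of_real\<close>)

lemma expansion_linear_bound:
  fixes \<rho> :: "real \<Rightarrow> complex"
  assumes "\<forall>\<^sub>F t in at_right 0. norm (\<rho> t - r - of_real t * \<delta>) \<le> C * t\<^sup>2"
  shows "\<forall>\<^sub>F t in at_right 0. norm (\<rho> t - r) \<le> (norm \<delta> + \<bar>C\<bar>) * t"
  using assms eventually_at_right_0_between[OF zero_less_one]
proof eventually_elim
  case (elim t)
  have "norm (\<rho> t - r) \<le> norm (of_real t * \<delta>) + norm (\<rho> t - r - of_real t * \<delta>)" by (rule norm_triangle_sub)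
  also have "\<dots> \<le> norm \<delta> * t + \<bar>C\<bar> * t"
  proof (rule add_mono)
    have "C * t\<^sup>2 \<le> \<bar>C\<bar> * t" using elim by (intro mult_mono) (auto simp: power2_eq_square mult_left_le_one_le)
    with elim(1) show "norm (\<rho> t - r - of_real t * \<delta>) \<le> \<bar>C\<bar> * t" by linarith
  qed (use elim in \<open>simp add: norm_mult\<close>)
  finally show ?case by (simp add: distrib_right)
qed

lemma expands_holomorphic:
  fixes \<rho> :: "real \<Rightarrow> complex"
  assumes f: "f holomorphic_on UNIV" and lim: "(\<rho> \<longlongrightarrow> r) (at_right 0)"
    and \<rho>: "\<forall>\<^sub>F t in at_right 0. norm (\<rho> t - r - of_real t * \<delta>) \<le> C * t\<^sup>2"
  shows "expands (\<lambda>t z. f (\<rho> t)) (\<lambda>z. f r) (\<lambda>z. \<delta> * deriv f r)"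
proof -
  obtain L where L: "0 \<le> L" "\<forall>\<^sub>F s in nhds r. norm (f s - f r - deriv f r * (s - r)) \<le> L * (norm (s - r))\<^sup>2"
    using holomorphic_second_order[OF open_UNIV UNIV_I f] by blast
  have e: "\<forall>\<^sub>F t in at_right 0. norm (f (\<rho> t) - f r - deriv f r * (\<rho> t - r)) \<le> L * (norm (\<rho> t - r))\<^sup>2"
    using L(2) lim by (rule eventually_compose_filterlim)
  define M where "M = norm \<delta> + \<bar>C\<bar>"
  have "\<forall>\<^sub>F t in at_right 0. norm (f (\<rho> t) - f r - of_real t * (\<delta> * deriv f r)) \<le> (L * M\<^sup>2 + norm (deriv f r) * C) * t\<^sup>2"
    using e \<rho> expansion_linear_bound[OF \<rho>, folded M_def]
  proof eventually_elim
    case (elim t)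
    have "f (\<rho> t) - f r - of_real t * (\<delta> * deriv f r)
        = (f (\<rho> t) - f r - deriv f r * (\<rho> t - r)) + deriv f r * (\<rho> t - r - of_real t * \<delta>)"
      by (simp add: algebra_simps)
    also have "norm \<dots> \<le> L * (norm (\<rho> t - r))\<^sup>2 + norm (deriv f r) * (C * t\<^sup>2)"
      using elim(1,2) by (intro norm_triangle_mono) (auto simp: norm_mult intro: mult_left_mono)
    also have "L * (norm (\<rho> t - r))\<^sup>2 \<le> L * (M * t)\<^sup>2"
      using elim(3) L(1) by (intro mult_left_mono power_mono) auto
    finally show ?case by (simp add: algebra_simps power_mult_distrib)
  qed
  then show ?thesis by (rule expands_const_complex)
qed

text \<open>Uniformity in z rests on c = Re r > 0: the factor z exp (- r z) of the linear term has
  norm at most 1 / c, and the quadratic remainder is bounded independently of z by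
  \<open>norm_exp_remainder\<close>.\<close>

lemma expands_exp:
  fixes \<rho> :: "real \<Rightarrow> complex"
  assumes r: "0 < Re r" and lim: "(\<rho> \<longlongrightarrow> r) (at_right 0)"
    and \<rho>: "\<forall>\<^sub>F t in at_right 0. norm (\<rho> t - r - of_real t * \<delta>) \<le> C * t\<^sup>2"
  shows "expands (\<lambda>t z. exp (- \<rho> t * of_real z)) (\<lambda>z. exp (- r * of_real z)) (\<lambda>z. - (\<delta> * of_real z * exp (- r * of_real z)))"
proof -
  define c where "c = Re r"
  have c: "0 < c" "c \<le> Re r" using r by (auto simp: c_def)
  have ne: "norm (exp (- r * of_real z)) = exp (- c * z)" for z by (simp add: c_def)
  have nz: "norm (of_real z * exp (- r * of_real z)) \<le> 1 / c" if "0 \<le> z" for z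
    using mult_exp_decay_bound[OF c(1), of z] that by (simp add: norm_mult c_def)
  define M where "M = norm \<delta> + \<bar>C\<bar>"
  have "((\<lambda>t. norm (\<rho> t - r)) \<longlongrightarrow> norm (r - r)) (at_right 0)" by (intro tendsto_intros lim)
  \<comment> \<open>Distance c / 2 is the range in which \<open>norm_exp_remainder\<close>
    applies.\<close>
  then have e3: "\<forall>\<^sub>F t in at_right 0. norm (\<rho> t - r) < c / 2" by (rule order_tendstoD) (use c in simp)
  show ?thesis
  proof (rule expandsI)
    fix z :: real assume z: "0 \<le> z"
    show "norm (exp (- r * of_real z)) \<le> 1" unfolding ne using c z by simp
    show "norm (- (\<delta> * of_real z * exp (- r * of_real z))) \<le> norm \<delta> * (1 / c)"
      using mult_left_mono[OF nz[OF z] norm_ge_zero[of \<delta>]] by (simp only: norm_minus_cancel mult.assoc norm_mult[of \<delta>])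
  next
    show "\<forall>\<^sub>F t in at_right 0. \<forall>z\<ge>0. norm (exp (- \<rho> t * of_real z) - exp (- r * of_real z)
        - t *\<^sub>R (- (\<delta> * of_real z * exp (- r * of_real z)))) \<le> (16 / c\<^sup>2 * M\<^sup>2 + C * (1 / c)) * t\<^sup>2"
      using e3 \<rho> expansion_linear_bound[OF \<rho>, folded M_def]
    proof eventually_elim
      case (elim t)
      show ?case
      proof (intro allI impI)
        fix z :: real assume z: "0 \<le> z"
        define w where "w = \<rho> t - r"
        have \<rho>w: "\<rho> t = r + w" by (simp add: w_def)
        have "norm (exp (- (r + w) * of_real z) - exp (- r * of_real z) + w * of_real z * exp (- r * of_real z))
            \<le> 16 / c\<^sup>2 * (norm w)\<^sup>2"
          by (rule norm_exp_remainder[OF c _ z]) (use elim(1) in \<open>simp add: w_def\<close>)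
        also have "\<dots> \<le> 16 / c\<^sup>2 * (M * t)\<^sup>2"
          using elim(3) by (intro mult_left_mono power_mono) (auto simp: w_def)
        finally have 1: "norm (exp (- (r + w) * of_real z) - exp (- r * of_real z) + w * of_real z * exp (- r * of_real z))
            \<le> 16 / c\<^sup>2 * (M * t)\<^sup>2" .
        \<comment> \<open>The cost of replacing the actual displacement w of the root by its linear
          part in the first-order term.\<close>
        have 2: "norm ((of_real t * \<delta> - w) * (of_real z * exp (- r * of_real z))) \<le> (C * t\<^sup>2) * (1 / c)"
          unfolding norm_mult[of "of_real t * \<delta> - w"]
          using elim(2) nz[OF z] by (intro mult_mono) (auto simp: w_def norm_minus_commute order_trans[OF norm_ge_zero])
        have "exp (- \<rho> t * of_real z) - exp (- r * of_real z) - t *\<^sub>R (- (\<delta> * of_real z * exp (- r * of_real z)))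
            = (exp (- (r + w) * of_real z) - exp (- r * of_real z) + w * of_real z * exp (- r * of_real z))
              + (of_real t * \<delta> - w) * (of_real z * exp (- r * of_real z))"
          unfolding \<rho>w by (simp add: scaleR_conv_of_real algebra_simps)
        also have "norm \<dots> \<le> 16 / c\<^sup>2 * (M * t)\<^sup>2 + (C * t\<^sup>2) * (1 / c)" by (rule norm_triangle_mono[OF 1 2])
        finally show "norm (exp (- \<rho> t * of_real z) - exp (- r * of_real z)
          - t *\<^sub>R (- (\<delta> * of_real z * exp (- r * of_real z)))) \<le> (16 / c\<^sup>2 * M\<^sup>2 + C * (1 / c)) * t\<^sup>2"
          by (simp add: algebra_simps power_mult_distrib)
      qed
    qed
  qed
qed

section \<open>Exponentials of diagonalised matrices\<close>

lemma mat_pow_similar: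
  fixes L Li D :: "'a::comm_ring_1^('n::finite)^'n"
  assumes "L ** Li = mat 1" "Li ** L = mat 1"
  shows "mat_pow (Li ** D ** L) n = Li ** mat_pow D n ** L"
proof (induction n)
  case 0
  then show ?case by (simp add: assms)
next
  case (Suc n)
  have "mat_pow (Li ** D ** L) (Suc n) = Li ** D ** (L ** Li) ** mat_pow D n ** L"
    by (simp add: Suc matrix_mul_assoc)
  then show ?case by (simp add: assms matrix_mul_assoc)
qed

lemma diag_mat_mult_left: "(diag_mat d ** A) $ i $ j = d $ i * A $ i $ j"
  for d :: "'a::comm_ring_1^('n::finite)"
  by (simp add: matrix_matrix_mult_def diag_mat_def if_distrib[of "\<lambda>x. x * _"] sum.delta cong: if_cong)

lemma mat_pow_diag: "mat_pow (diag_mat d) n = diag_mat (\<chi> i. d $ i ^ n)"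
  for d :: "'a::comm_ring_1^('n::finite)"
proof (induction n)
  case (Suc n)
  have "(diag_mat d ** mat_pow (diag_mat d) n) $ i $ j = diag_mat (\<chi> i. d $ i ^ Suc n) $ i $ j" for i j
    unfolding diag_mat_mult_left Suc by (simp add: diag_mat_def)
  then show ?case by (simp add: vec_eq_iff)
qed (simp add: diag_mat_def mat_def vec_eq_iff)

lemma similar_diag_entry: "(Li ** diag_mat d ** L) $ i $ j = (\<Sum>k\<in>UNIV. Li $ i $ k * d $ k * L $ k $ j)"
  for d :: "'a::comm_ring_1^('n::finite)"
proof -
  have "(Li ** diag_mat d ** L) $ i $ j = (Li ** (diag_mat d ** L)) $ i $ j" by (simp add: matrix_mul_assoc)
  also have "\<dots> = (\<Sum>k\<in>UNIV. Li $ i $ k * (diag_mat d ** L) $ k $ j)" by (simp add: matrix_matrix_mult_def)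
  finally show ?thesis unfolding diag_mat_mult_left by (simp add: mult.assoc)
qed

text \<open>All powers are diagonalised by the same pair, so each entry is a finite combination of
  scalar exponential series.\<close>

lemma mat_exp_similar_diag:
  fixes L Li :: "complex^('n::finite)^'n"
  assumes "L ** Li = mat 1" "Li ** L = mat 1"
  shows "mat_exp (Li ** diag_mat d ** L) = Li ** diag_mat (\<chi> i. exp (d $ i)) ** L"
proof -
  have "mat_exp (Li ** diag_mat d ** L) $ i $ j = (Li ** diag_mat (\<chi> i. exp (d $ i)) ** L) $ i $ j" for i j
  proof -
    have e: "mat_pow (Li ** diag_mat d ** L) n $ i $ j /\<^sub>R fact n
        = (\<Sum>k\<in>UNIV. Li $ i $ k * (d $ k ^ n /\<^sub>R fact n) * L $ k $ j)" for n
      unfolding mat_pow_similar[OF assms] mat_pow_diag similar_diag_entry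
      by (simp add: scaleR_sum_right)
    have "(\<lambda>n. \<Sum>k\<in>UNIV. Li $ i $ k * (d $ k ^ n /\<^sub>R fact n) * L $ k $ j) sums (\<Sum>k\<in>UNIV. Li $ i $ k * exp (d $ k) * L $ k $ j)"
      by (intro sums_sum sums_mult sums_mult2 exp_converges)
    then show ?thesis
      unfolding mat_exp_def vec_lambda_beta e similar_diag_entry by (rule sums_unique[symmetric])
  qed
  then show ?thesis by (simp add: vec_eq_iff)
qed

lemma scaleR_diag: "c *\<^sub>R diag_mat d = diag_mat (c *\<^sub>R d)" for d :: "complex^('n::finite)"
  by (simp add: diag_mat_def vec_eq_iff)

lemma scaleR_complex_component: "((- z) *\<^sub>R d) $ i = - (d $ i) * of_real z" for d :: "complex^('n::finite)"
  by (simp only: vector_scaleR_component) (simp add: scaleR_conv_of_real)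

lemma mat_exp_diag: "mat_exp ((- z) *\<^sub>R diag_mat d) = diag_mat (\<chi> i. exp (- (d $ i) * of_real z))" for d :: "complex^('n::finite)"
  using mat_exp_similar_diag[of "mat 1" "mat 1 :: complex^'n^'n" "(- z) *\<^sub>R d"]
  by (simp only: scaleR_diag[symmetric] scaleR_complex_component matrix_mul_lid matrix_mul_rid)

lemma mat_exp_R_mat:
  assumes "invertible (L_mat M r)"
  shows "mat_exp ((- z) *\<^sub>R R_mat M r)
    = matrix_inv (L_mat M r) ** diag_mat (\<chi> i. exp (- (r $ i) * of_real z)) ** L_mat M r"
proof -
  have "(- z) *\<^sub>R R_mat M r = matrix_inv (L_mat M r) ** diag_mat ((- z) *\<^sub>R r) ** L_mat M r"
    unfolding R_mat_def scaleR_diag[symmetric]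
    by (simp only: bounded_bilinear.scaleR_left[OF bounded_bilinear_matrix_mult]
        bounded_bilinear.scaleR_right[OF bounded_bilinear_matrix_mult])
  then show ?thesis
    using mat_exp_similar_diag[OF matrix_inv_right[OF assms] matrix_inv_left[OF assms], of "(- z) *\<^sub>R r"]
    by (simp only: scaleR_complex_component)
qed

section \<open>Expansion of the Gerber--Shiu kernel\<close>

context risk_scale
begin

text \<open>By \<open>det_exponent_eps\<close> a perturbed root solves D(s) = t s k(s) det (T + s I)
  with the unperturbed determinant D. The factor of t divided by the derivative of D, at the
  unperturbed root, is \<open>delta1\<close>.\<close>

lemma root_expansion:
  assumes roots0: "positive_simple_roots M q (\<rho> 0)"
    and roots: "\<forall>\<^sub>F t in at_right 0. det (exponent M t q (\<rho> t $ i)) = 0"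
    and lim: "((\<lambda>t. \<rho> t $ i) \<longlongrightarrow> \<rho> 0 $ i) (at_right 0)"
  shows "0 < Re (\<rho> 0 $ i)"
    and "\<exists>C. \<forall>\<^sub>F t in at_right 0. norm (\<rho> t $ i - \<rho> 0 $ i - of_real t * delta1 M q (\<rho> 0) $ i) \<le> C * t\<^sup>2"
proof -
  have "\<rho> 0 $ i \<in> range (\<lambda>i. \<rho> 0 $ i)" by blast
  then have r: "0 < Re (\<rho> 0 $ i)" "det (exponent M 0 q (\<rho> 0 $ i)) = 0"
    and d: "deriv (\<lambda>s. det (exponent M 0 q s)) (\<rho> 0 $ i) \<noteq> 0"
    using roots0 by (auto simp: positive_simple_roots_def)
  show "0 < Re (\<rho> 0 $ i)" by (rule r)
  let ?S = "{s. 0 < Re s}" and ?D = "\<lambda>s. det (exponent M 0 q s)" and ?K = "\<lambda>s. s * kfun M s * det (T_plus M s)"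
  have "\<forall>\<^sub>F t in at_right 0. ?D (\<rho> t $ i) = of_real t * ?K (\<rho> t $ i)"
    using roots by eventually_elim (subst (asm) det_exponent_eps, simp add: mult.assoc)
  moreover have "?K holomorphic_on ?S"
    by (intro holomorphic_intros kfun_holomorphic holomorphic_on_det T_plus_holomorphic)
  ultimately have "\<exists>C. \<forall>\<^sub>F t in at_right 0. norm (\<rho> t $ i - \<rho> 0 $ i - of_real t * (?K (\<rho> 0 $ i) / deriv ?D (\<rho> 0 $ i))) \<le> C * t\<^sup>2"
    using r d lim by (intro simple_root_expansion[of ?S]) (auto intro: det_exponent_holomorphic open_halfspace_Re_gt)
  then show "\<exists>C. \<forall>\<^sub>F t in at_right 0. norm (\<rho> t $ i - \<rho> 0 $ i - of_real t * delta1 M q (\<rho> 0) $ i) \<le> C * t\<^sup>2"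
    by (simp add: delta1_def)
qed

text \<open>Product rule for L^-1 exp (- \<Lambda> z) L. The three summands differentiate L, the
  exponential and the inverse; in the last one - L^-1 H L^-1 meets the remaining factors, which
  recombine to exp (- R z).\<close>

lemma expands_mat_exp_R:
  assumes roots0: "positive_simple_roots M q (\<rho> 0)"
    and roots: "\<And>i. \<forall>\<^sub>F t in at_right 0. det (exponent M t q (\<rho> t $ i)) = 0"
    and lim: "\<And>i. ((\<lambda>t. \<rho> t $ i) \<longlongrightarrow> \<rho> 0 $ i) (at_right 0)"
    and inv: "\<forall>\<^sub>F t in at_right 0. invertible (L_mat M (\<rho> t))" and inv0: "invertible (L_mat M (\<rho> 0))"
  defines "L \<equiv> L_mat M (\<rho> 0)" and "Li \<equiv> matrix_inv (L_mat M (\<rho> 0))" and "H \<equiv> H1_mat M q (\<rho> 0)"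
    and "\<Delta> \<equiv> diag_mat (delta1 M q (\<rho> 0))"
  shows "expands (\<lambda>t z. mat_exp ((- z) *\<^sub>R R_mat M (\<rho> t))) (\<lambda>z. mat_exp ((- z) *\<^sub>R R_mat M (\<rho> 0)))
    (\<lambda>z. Li ** mat_exp ((- z) *\<^sub>R diag_mat (\<rho> 0)) ** H - z *\<^sub>R (Li ** mat_exp ((- z) *\<^sub>R diag_mat (\<rho> 0)) ** \<Delta> ** L)
      - Li ** H ** mat_exp ((- z) *\<^sub>R R_mat M (\<rho> 0)))"
proof -
  let ?\<delta> = "delta1 M q (\<rho> 0)"
  define E where "E r z = diag_mat (\<chi> i. exp (- (r $ i) * of_real z))" for r :: "complex^'m option" and z
  define E1 where "E1 z = diag_mat (\<chi> i. - (?\<delta> $ i * of_real z * exp (- (\<rho> 0 $ i) * of_real z)))" for z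
  note re = root_expansion[OF roots0 roots lim]
  have L: "expands (\<lambda>t z. L_mat M (\<rho> t)) (\<lambda>z. L) (\<lambda>z. H)"
  proof (intro expands_vecI)
    fix i j
    obtain C where "\<forall>\<^sub>F t in at_right 0. norm (\<rho> t $ i - \<rho> 0 $ i - of_real t * ?\<delta> $ i) \<le> C * t\<^sup>2" using re(2) by blast
    from expands_holomorphic[OF wvec_holomorphic lim this, of M j]
    show "expands (\<lambda>t z. L_mat M (\<rho> t) $ i $ j) (\<lambda>z. L $ i $ j) (\<lambda>z. H $ i $ j)"
      by (simp add: L_mat_def L_def H_def H1_mat_def)
  qed
  have E: "expands (\<lambda>t z. E (\<rho> t) z) (E (\<rho> 0)) E1"
  proof (intro expands_vecI)
    fix i j
    obtain C where "\<forall>\<^sub>F t in at_right 0. norm (\<rho> t $ i - \<rho> 0 $ i - of_real t * ?\<delta> $ i) \<le> C * t\<^sup>2" using re(2) by blast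
    from expands_exp[OF re(1) lim this]
    show "expands (\<lambda>t z. E (\<rho> t) z $ i $ j) (\<lambda>z. E (\<rho> 0) z $ i $ j) (\<lambda>z. E1 z $ i $ j)"
      by (cases "i = j") (simp_all add: E_def E1_def diag_mat_def expands_zero)
  qed
  note bb = bounded_bilinear_matrix_mult
  interpret mm: bounded_bilinear "(**) :: complex^'m option^'m option \<Rightarrow> complex^'m option^'m option \<Rightarrow> _"
    by (rule bb)
  have Li: "expands (\<lambda>t z. matrix_inv (L_mat M (\<rho> t))) (\<lambda>z. Li) (\<lambda>z. - (Li ** H ** Li))"
    using expands_matrix_inv[OF L inv inv0[folded L_def]] by (simp add: Li_def L_def)
  note P = expands_bilinear[OF bb expands_bilinear[OF bb Li E] L]
  show ?thesis
  proof (rule expands_cong[OF P])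
    show "\<forall>\<^sub>F t in at_right 0. \<forall>z\<ge>0. matrix_inv (L_mat M (\<rho> t)) ** E (\<rho> t) z ** L_mat M (\<rho> t) = mat_exp ((- z) *\<^sub>R R_mat M (\<rho> t))"
      using inv by eventually_elim (simp only: mat_exp_R_mat E_def, simp)
    have eR: "mat_exp ((- z) *\<^sub>R R_mat M (\<rho> 0)) = Li ** E (\<rho> 0) z ** L" for z
      unfolding mat_exp_R_mat[OF inv0] by (simp add: E_def Li_def L_def)
    show "Li ** E (\<rho> 0) z ** L = mat_exp ((- z) *\<^sub>R R_mat M (\<rho> 0))" for z by (simp only: eR)
    have E1: "E1 z = - (z *\<^sub>R (E (\<rho> 0) z ** \<Delta>))" for z
      by (simp add: vec_eq_iff E_def E1_def \<Delta>_def diag_mat_mult_left) (simp add: diag_mat_def scaleR_conv_of_real)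
    show "Li ** E (\<rho> 0) z ** H + (Li ** E1 z + - (Li ** H ** Li) ** E (\<rho> 0) z) ** L
      = Li ** mat_exp ((- z) *\<^sub>R diag_mat (\<rho> 0)) ** H - z *\<^sub>R (Li ** mat_exp ((- z) *\<^sub>R diag_mat (\<rho> 0)) ** \<Delta> ** L)
        - Li ** H ** mat_exp ((- z) *\<^sub>R R_mat M (\<rho> 0))" for z
      unfolding eR mat_exp_diag E_def[symmetric] E1
      by (simp add: mm.add_left mm.diff_left mm.minus_left mm.minus_right mm.scaleR_left mm.scaleR_right matrix_mul_assoc algebra_simps)
  qed
qed

lemma halfline_bounded:
  assumes "exp_fun a f" obtains B where "\<And>x. x \<le> u \<Longrightarrow> \<bar>f x\<bar> \<le> B"
proof -
  obtain C where C: "0 \<le> C" "\<And>x. \<bar>f x\<bar> \<le> C * exp (a * x)" using exp_funE[OF assms] by blast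
  have "\<bar>f x\<bar> \<le> C * exp (\<bar>a\<bar> * \<bar>u\<bar>)" if "x \<le> u" for x
  proof (cases "x < 0")
    case False
    then have "a * x \<le> \<bar>a\<bar> * \<bar>u\<bar>"
    proof -
      have "a * x \<le> \<bar>a\<bar> * \<bar>x\<bar>" using abs_ge_self[of "a * x"] by (simp add: abs_mult)
      also have "\<dots> \<le> \<bar>a\<bar> * \<bar>u\<bar>" using that False by (intro mult_left_mono) auto
      finally show ?thesis .
    qed
    then have "C * exp (a * x) \<le> C * exp (\<bar>a\<bar> * \<bar>u\<bar>)" using C(1) by (intro mult_left_mono) auto
    with C(2)[of x] show ?thesis by linarith
  qed (use exp_funD(2)[OF assms] C in auto)
  then show thesis by (rule that)
qed

text \<open>Used with \<open>x z\<close> equal to u or to u - z. Both stay below u, so bounds on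
  compact sets become uniform over all z >= 0.\<close>

lemma expands_scale:
  assumes u: "0 \<le> u" and scale: "\<forall>\<^sub>F t in at_right 0. is_scale_matrix M t q (W t)"
    and x: "\<And>z. 0 \<le> z \<Longrightarrow> x z \<le> u"
  shows "expands (\<lambda>t z. complex_of_real (W t (x z) $ None $ j)) (\<lambda>z. of_real (W0 (x z) $ None $ j)) (\<lambda>z. of_real (corr j (x z)))"
proof -
  obtain C e where e: "0 < e" and C: "\<And>t W x. 0 \<le> t \<Longrightarrow> t \<le> e \<Longrightarrow> is_scale_matrix M t q W \<Longrightarrow> x \<le> u \<Longrightarrow>
    \<bar>W x $ None $ j - W0 x $ None $ j - t * corr j x\<bar> \<le> C * t\<^sup>2"
    using scale_expansion[OF u, of j] by blast
  obtain x0 where x0: "\<And>x. x \<le> u \<Longrightarrow> \<bar>W0 x $ None $ j\<bar> \<le> \<bar>W0 x0 $ None $ j\<bar>"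
    using scale_bounded[OF scale0 u] by blast
  obtain a where "exp_fun a (corr j)" using corr_exp_fun by blast
  then obtain B where B: "\<And>x. x \<le> u \<Longrightarrow> \<bar>corr j x\<bar> \<le> B" using halfline_bounded by blast
  show ?thesis
  proof (rule expandsI)
    show "norm (complex_of_real (W0 (x z) $ None $ j)) \<le> \<bar>W0 x0 $ None $ j\<bar>" if "0 \<le> z" for z using x0[OF x[OF that]] by simp
    show "norm (complex_of_real (corr j (x z))) \<le> B" if "0 \<le> z" for z using B[OF x[OF that]] by simp
    show "\<forall>\<^sub>F t in at_right 0. \<forall>z\<ge>0. norm (complex_of_real (W t (x z) $ None $ j) - of_real (W0 (x z) $ None $ j)
        - t *\<^sub>R of_real (corr j (x z))) \<le> C * t\<^sup>2"
      using scale eventually_at_right_0_between[OF e]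
    proof eventually_elim
      case (elim t)
      have "norm (complex_of_real (W t y $ None $ j) - of_real (W0 y $ None $ j) - t *\<^sub>R of_real (corr j y)) \<le> C * t\<^sup>2" if "y \<le> u" for y
      proof -
        have "complex_of_real (W t y $ None $ j) - of_real (W0 y $ None $ j) - t *\<^sub>R of_real (corr j y)
            = of_real (W t y $ None $ j - W0 y $ None $ j - t * corr j y)" by (simp add: scaleR_conv_of_real)
        then show ?thesis using C[of t "W t" y] elim that by (metis less_imp_le norm_of_real)
      qed
      then show ?case using x by blast
    qed
  qed
qed

lemma r_mat_None:
  "r_mat M W r u z $ None $ None
    = (\<Sum>j\<in>UNIV. complex_of_real (W u $ None $ j) * mat_exp ((- z) *\<^sub>R R_mat M r) $ j $ None) - of_real (W (u - z) $ None $ None)"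
  by (simp add: r_mat_def matrix_matrix_mult_def map_matrix_def)

text \<open>\<open>expands_mat_exp_R\<close> supplies the bracket of \<open>v_fun\<close>, and
  \<open>corr\<close> supplies its two convolution terms.\<close>

theorem expands_r_mat:
  assumes u: "0 \<le> u" and scale: "\<forall>\<^sub>F t in at_right 0. is_scale_matrix M t q (W t)" and W0: "W 0 = W0"
    and roots0: "positive_simple_roots M q (\<rho> 0)"
    and roots: "\<And>i. \<forall>\<^sub>F t in at_right 0. det (exponent M t q (\<rho> t $ i)) = 0"
    and lim: "\<And>i. ((\<lambda>t. \<rho> t $ i) \<longlongrightarrow> \<rho> 0 $ i) (at_right 0)"
    and inv: "\<forall>\<^sub>F t in at_right 0. invertible (L_mat M (\<rho> t))" and inv0: "invertible (L_mat M (\<rho> 0))"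
  shows "expands (\<lambda>t z. r_mat M (W t) (\<rho> t) u z $ None $ None) (\<lambda>z. r_mat M (W 0) (\<rho> 0) u z $ None $ None)
    (v_fun M q (W 0) Wd (\<rho> 0) u)"
proof -
  define L where "L = L_mat M (\<rho> 0)"
  define Li where "Li = matrix_inv (L_mat M (\<rho> 0))"
  have LiL: "matrix_inv L = Li" by (simp only: L_def Li_def)
  define H where "H = H1_mat M q (\<rho> 0)"
  define \<Delta> where "\<Delta> = diag_mat (delta1 M q (\<rho> 0))"
  define eL where "eL z = mat_exp ((- z) *\<^sub>R diag_mat (\<rho> 0))" for z
  define eR where "eR z = mat_exp ((- z) *\<^sub>R R_mat M (\<rho> 0))" for z
  have X: "expands (\<lambda>t z. mat_exp ((- z) *\<^sub>R R_mat M (\<rho> t))) eR (\<lambda>z. Li ** eL z ** H - z *\<^sub>R (Li ** eL z ** \<Delta> ** L) - Li ** H ** eR z)"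
    using expands_mat_exp_R[OF roots0 roots lim inv inv0] unfolding L_def Li_def H_def \<Delta>_def eL_def eR_def .
  have "bounded_linear (\<lambda>A :: complex^'m option^'m option. A $ j $ None)" for j
    by (rule bounded_linear_compose[OF bounded_linear_vec_nth bounded_linear_vec_nth])
  note X' = expands_bounded_linear[OF this X]
  have "expands (\<lambda>t z. (\<Sum>j\<in>UNIV. complex_of_real (W t u $ None $ j) * mat_exp ((- z) *\<^sub>R R_mat M (\<rho> t)) $ j $ None) - of_real (W t (u - z) $ None $ None))
    (\<lambda>z. (\<Sum>j\<in>UNIV. complex_of_real (W0 u $ None $ j) * eR z $ j $ None) - of_real (W0 (u - z) $ None $ None))
    (\<lambda>z. (\<Sum>j\<in>UNIV. complex_of_real (W0 u $ None $ j) * (Li ** eL z ** H - z *\<^sub>R (Li ** eL z ** \<Delta> ** L) - Li ** H ** eR z) $ j $ None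
            + complex_of_real (corr j u) * eR z $ j $ None) - of_real (corr None (u - z)))"
    by (intro expands_diff expands_sum expands_bilinear[OF bounded_bilinear_mult] X' expands_scale[OF u scale]) simp_all
  then show ?thesis
  proof (rule expands_cong)
    show "\<forall>\<^sub>F t in at_right 0. \<forall>z\<ge>0.
      (\<Sum>j\<in>UNIV. complex_of_real (W t u $ None $ j) * mat_exp ((- z) *\<^sub>R R_mat M (\<rho> t)) $ j $ None) - of_real (W t (u - z) $ None $ None)
        = r_mat M (W t) (\<rho> t) u z $ None $ None"
      by (simp only: r_mat_None) simp
    show "(\<Sum>j\<in>UNIV. complex_of_real (W0 u $ None $ j) * eR z $ j $ None) - of_real (W0 (u - z) $ None $ None)
        = r_mat M (W 0) (\<rho> 0) u z $ None $ None" for z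
      by (simp only: r_mat_None W0 eR_def)
    show "(\<Sum>j\<in>UNIV. complex_of_real (W0 u $ None $ j) * (Li ** eL z ** H - z *\<^sub>R (Li ** eL z ** \<Delta> ** L) - Li ** H ** eR z) $ j $ None
            + complex_of_real (corr j u) * eR z $ j $ None) - of_real (corr None (u - z)) = v_fun M q (W 0) Wd (\<rho> 0) u z" for z
      unfolding v_fun_def Let_def corr_def[symmetric]
      by (simp only: W0 Li_def[symmetric] L_def[symmetric] LiL H_def[symmetric] \<Delta>_def[symmetric] eL_def[symmetric] eR_def[symmetric] sum.distrib add.commute)
  qed
qed

end

section \<open>Integration against the penalty\<close>

text \<open>The value for \<open>z \<le> 0\<close>, where \<open>\<omega>\<close> is unconstrained, is set to \<open>0\<close>; this changes integrals over
  \<open>z\<close> only on a null set.\<close>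

definition claim_penalty :: "(real \<Rightarrow> real \<Rightarrow> real) \<Rightarrow> real measure \<Rightarrow> real \<Rightarrow> real" where
  "claim_penalty \<omega> F z = (if 0 < z then LINT y:{0..}|shifted F z. \<omega> y z else 0)"

locale penalty =
  fixes \<omega> :: "real \<Rightarrow> real \<Rightarrow> real" and B :: real
  assumes \<omega>_bounds: "\<And>y z. 0 < y \<Longrightarrow> 0 < z \<Longrightarrow> 0 \<le> \<omega> y z" "\<And>y z. 0 < y \<Longrightarrow> 0 < z \<Longrightarrow> \<omega> y z \<le> B"
    and \<omega>_meas: "(\<lambda>(y, z). \<omega> y z) \<in> borel_measurable (restrict_space borel ({0<..} \<times> {0<..}))"
begin

text \<open>Extension by 0 from the open quadrant, where alone measurability and bounds are assumed,
  to a bounded measurable function on the plane.\<close>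

definition pen :: "real \<Rightarrow> real \<Rightarrow> real" where
  "pen y z = (if 0 < y \<and> 0 < z then \<omega> y z else 0)"

lemma B_nonneg: "0 \<le> B"
  using \<omega>_bounds[of 1 1] by simp

lemma pen_measurable [measurable]: "(\<lambda>(y, z). pen y z) \<in> borel_measurable (borel \<Otimes>\<^sub>M borel)"
proof -
  let ?S = "{0<..} \<times> {0<..} :: (real \<times> real) set"
  have "?S \<in> sets borel" by (intro borel_open open_Times) auto
  then have "(\<lambda>x. indicator ?S x *\<^sub>R (case x of (y, z) \<Rightarrow> \<omega> y z)) \<in> borel_measurable borel"
    using \<omega>_meas by (subst (asm) borel_measurable_restrict_space_iff) auto
  also have "(\<lambda>x. indicator ?S x *\<^sub>R (case x of (y, z) \<Rightarrow> \<omega> y z)) = (\<lambda>(y, z). pen y z)"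
    by (auto simp: pen_def fun_eq_iff indicator_def)
  finally show ?thesis by (simp add: borel_prod)
qed

lemma pen_bounds: "0 \<le> pen y z" "pen y z \<le> B" "pen y z \<noteq> 0 \<Longrightarrow> 0 < y \<and> 0 < z"
  using \<omega>_bounds[of y z] B_nonneg by (auto simp: pen_def split: if_splits)

lemma claim_penalty_eq:
  assumes F [measurable_cong]: "sets F = sets borel" and z: "0 < z"
  shows "claim_penalty \<omega> F z = (LINT x|F. indicator {0..} (x - z) * \<omega> (x - z) z)"
    and "(\<lambda>x. indicator {0..} (x - z) * \<omega> (x - z) z) \<in> borel_measurable borel"
proof -
  \<comment> \<open>The closed half-line includes y = 0, where \<open>\<omega>\<close> is
    unconstrained. For fixed z this adds a multiple of the indicator of a point, so measurability is
    preserved.\<close>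
  have e: "(\<lambda>y. indicator {0..} y * \<omega> y z) = (\<lambda>y. pen y z + indicator {0} y * \<omega> 0 z)"
    using z by (auto simp: fun_eq_iff pen_def indicator_def)
  have m: "(\<lambda>y. indicator {0..} y * \<omega> y z) \<in> borel_measurable borel" unfolding e by measurable
  have "claim_penalty \<omega> F z = (LINT y|distr F borel (\<lambda>x. x - z). indicator {0..} y * \<omega> y z)"
    using z by (simp add: claim_penalty_def shifted_def set_lebesgue_integral_def)
  also have "\<dots> = (LINT x|F. indicator {0..} (x - z) * \<omega> (x - z) z)"
    by (rule integral_distr[OF _ m]) measurable
  finally show "claim_penalty \<omega> F z = (LINT x|F. indicator {0..} (x - z) * \<omega> (x - z) z)" .
  show "(\<lambda>x. indicator {0..} (x - z) * \<omega> (x - z) z) \<in> borel_measurable borel"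
    using measurable_compose[OF _ m, of "\<lambda>x. x - z"] by simp
qed

text \<open>The integrands differ only at x = z, that is at y = 0, and \<open>F\<close> has no atom
  there.\<close>

lemma claim_penalty_pen:
  assumes F: "ac_pos_distribution F"
  shows "claim_penalty \<omega> F z = (LINT x|F. pen (x - z) z)"
proof (cases "0 < z")
  case True
  note D = ac_posD[OF F]
  interpret real_distribution F by (rule D(1))
  have "{z} \<in> null_sets F" using D(4)[of z] by (intro null_setsI) (simp_all add: emeasure_eq_measure)
  then have "AE x in F. x \<noteq> z" by (rule AE_I') auto
  then have ae: "AE x in F. indicator {0..} (x - z) * \<omega> (x - z) z = pen (x - z) z"
    by eventually_elim (use True in \<open>auto simp: pen_def indicator_def\<close>)
  show ?thesis unfolding claim_penalty_eq(1)[OF D(2) True]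
    by (rule integral_cong_AE[OF _ _ ae]) (use claim_penalty_eq(2)[OF D(2) True] in measurable)
next
  case False
  then show ?thesis by (simp add: claim_penalty_def pen_def)
qed

lemma claim_penalty_measurable:
  assumes F: "ac_pos_distribution F" shows "claim_penalty \<omega> F \<in> borel_measurable borel"
proof -
  note D = ac_posD[OF F]
  interpret real_distribution F by (rule D(1))
  have [measurable_cong]: "sets F = sets borel" by (rule D(2))
  have "(\<lambda>z. LINT x|F. pen (x - z) z) \<in> borel_measurable borel"
    by (rule borel_measurable_lebesgue_integral) measurable
  then show ?thesis by (simp add: claim_penalty_pen[OF F, abs_def])
qed

text \<open>Provides the decay in z: the Gerber-Shiu kernel is only known to be bounded in z, and
  the tail is integrable over the infinite range.\<close>

lemma claim_penalty_bound:
  assumes F: "ac_pos_distribution F" shows "\<bar>claim_penalty \<omega> F z\<bar> \<le> B * tail F z"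
proof (cases "0 < z")
  case True
  note D = ac_posD[OF F]
  interpret real_distribution F by (rule D(1))
  have "\<bar>claim_penalty \<omega> F z\<bar> \<le> (LINT x|F. \<bar>pen (x - z) z\<bar>)"
    unfolding claim_penalty_pen[OF F] by (rule integral_abs_bound)
  also have "\<dots> \<le> (LINT x|F. B * indicator {z..} x)"
  proof (rule integral_mono')
    show "integrable F (\<lambda>x. B * indicator {z..} x)"
      by (intro integrable_mult_right integrable_real_indicator) (simp_all add: emeasure_eq_measure)
    show "\<bar>pen (x - z) z\<bar> \<le> B * indicator {z..} x" for x
      using pen_bounds[of "x - z" z] B_nonneg by (cases "z \<le> x") auto
  qed (simp add: B_nonneg)
  also have "\<dots> = B * tail F z" using True by (simp add: tail_eq[OF F])
  finally show ?thesis .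
qed (use B_nonneg tail_bounds(1)[OF F] in \<open>simp add: claim_penalty_def\<close>)

lemma claim_penalty_integrable:
  assumes F: "ac_pos_distribution F" shows "integrable lborel (claim_penalty \<omega> F)"
proof (rule Bochner_Integration.integrable_bound)
  show "integrable lborel (\<lambda>z. B * tail F z)" using tail_integrable(1)[OF F] by simp
  show "claim_penalty \<omega> F \<in> borel_measurable lborel" using claim_penalty_measurable[OF F] by simp
  show "AE z in lborel. norm (claim_penalty \<omega> F z) \<le> norm (B * tail F z)"
    using claim_penalty_bound[OF F] by (auto intro: order_trans[OF _ abs_ge_self])
qed

text \<open>Linearity is applied to the raw integrand of \<open>claim_penalty_eq\<close>, which asks
  only for Borel sets and therefore also describes the mixture.\<close>

lemma claim_penalty_lincomb:
  assumes F: "ac_pos_distribution F" and G: "ac_pos_distribution G" and ab: "0 \<le> a" "0 \<le> b"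
  shows "claim_penalty \<omega> (lincomb_measure a F b G) z = a * claim_penalty \<omega> F z + b * claim_penalty \<omega> G z"
proof (cases "0 < z")
  case True
  have i: "integrable F (\<lambda>x. indicator {0..} (x - z) * \<omega> (x - z) z)" if F: "ac_pos_distribution F" for F
  proof -
    interpret real_distribution F by (rule ac_posD(1)[OF F])
    show ?thesis
    \<comment> \<open>The maximum also covers the unconstrained value at y = 0.\<close>
    proof (rule integrable_const_bound[where B = "max B \<bar>\<omega> 0 z\<bar>"])
      show "AE x in F. norm (indicator {0..} (x - z) * \<omega> (x - z) z) \<le> max B \<bar>\<omega> 0 z\<bar>"
      proof (rule AE_I2)
        fix x
        show "norm (indicator {0..} (x - z) * \<omega> (x - z) z) \<le> max B \<bar>\<omega> 0 z\<bar>"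
          using \<omega>_bounds[of "x - z" z] True B_nonneg
          by (cases "x - z = 0"; cases "0 < x - z") (auto simp: indicator_def)
      qed
      show "(\<lambda>x. indicator {0..} (x - z) * \<omega> (x - z) z) \<in> borel_measurable F"
        using claim_penalty_eq(2)[OF ac_posD(2)[OF F] True] by simp
    qed
  qed
  show ?thesis
    unfolding claim_penalty_eq(1)[OF ac_posD(2)[OF F] True] claim_penalty_eq(1)[OF ac_posD(2)[OF G] True]
      claim_penalty_eq(1)[OF sets_lincomb True]
    by (rule integral_lincomb(2)[OF ac_posD(2)[OF F] ac_posD(2)[OF G] ab i[OF F] i[OF G]])
qed (simp add: claim_penalty_def)

lemma inner_integral:
  assumes "0 < z"
  shows "(LINT y:{0..}|shifted F z. complex_of_real (\<omega> y z) * c) = of_real (claim_penalty \<omega> F z) * c"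
proof -
  have "(LINT y:{0..}|shifted F z. complex_of_real (\<omega> y z) * c)
      = (LINT y|shifted F z. complex_of_real (indicator {0..} y * \<omega> y z) * c)"
    unfolding set_lebesgue_integral_def
    by (rule Bochner_Integration.integral_cong) (auto simp: scaleR_conv_of_real)
  also have "\<dots> = (LINT y|shifted F z. complex_of_real (indicator {0..} y * \<omega> y z)) * c"
    by (rule integral_mult_left_zero)
  also have "(LINT y|shifted F z. complex_of_real (indicator {0..} y * \<omega> y z)) = of_real (claim_penalty \<omega> F z)"
    using assms by (simp only: integral_complex_of_real) (simp add: claim_penalty_def set_lebesgue_integral_def)
  finally show ?thesis .
qed

text \<open>The relation between the integrands may fail at z = 0, where \<open>\<omega>\<close> is
  unconstrained; a single point does not affect the integral.\<close>

lemma outer_integral: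
  fixes f c :: "real \<Rightarrow> complex" and h :: "real \<Rightarrow> real"
  assumes "\<And>z. 0 < z \<Longrightarrow> f z = of_real (h z) * c z" and "\<And>z. z \<le> 0 \<Longrightarrow> h z = 0"
  shows "(LINT z:{0..}|lborel. f z) = (LINT z|lborel. complex_of_real (h z) * c z)"
  unfolding set_lebesgue_integral_def
proof (rule integral_discrete_difference[where X = "{0}"])
  fix z :: real assume "z \<notin> {0}"
  then show "indicator {0..} z *\<^sub>R f z = complex_of_real (h z) * c z"
    using assms by (cases "0 < z") auto
qed auto

end

section \<open>Measurability of the kernels in z\<close>

lemma mat_exp_diag_measurable:
  "(\<lambda>z. mat_exp ((- z) *\<^sub>R diag_mat r) $ i $ j) \<in> borel_measurable borel"
  for r :: "complex^('n::finite)"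
  unfolding mat_exp_diag by (cases "i = j") (simp_all add: diag_mat_def)

lemma mat_exp_R_measurable:
  assumes "invertible (L_mat M r)"
  shows "(\<lambda>z. mat_exp ((- z) *\<^sub>R R_mat M r) $ i $ j) \<in> borel_measurable borel"
  unfolding mat_exp_R_mat[OF assms] similar_diag_entry by simp

lemma matrix_mult_measurable:
  fixes A B :: "real \<Rightarrow> complex^('n::finite)^('n)"
  assumes "\<And>i j. (\<lambda>z. A z $ i $ j) \<in> borel_measurable borel" "\<And>i j. (\<lambda>z. B z $ i $ j) \<in> borel_measurable borel"
  shows "(\<lambda>z. (A z ** B z) $ i $ j) \<in> borel_measurable borel"
  unfolding matrix_matrix_mult_def vec_lambda_beta
  by (intro borel_measurable_sum borel_measurable_times assms)

context risk_scale
begin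

lemma r_mat_measurable:
  assumes W: "is_scale_matrix M \<epsilon> q W" and L: "invertible (L_mat M r)"
  shows "(\<lambda>z. r_mat M W r u z $ None $ None) \<in> borel_measurable borel"
proof -
  have [measurable]: "(\<lambda>x. W x $ None $ None) \<in> borel_measurable borel" by (rule scale_matrix_entry[OF W])
  have "(\<lambda>z. W (u - z) $ None $ None) \<in> borel_measurable borel" by measurable
  then show ?thesis unfolding r_mat_None using mat_exp_R_measurable[OF L] by simp
qed

lemma v_fun_measurable:
  assumes L: "invertible (L_mat M r)"
  shows "(\<lambda>z. v_fun M q W Wd r u z) \<in> borel_measurable borel"
proof -
  obtain a where "exp_fun a (corr None)" using corr_exp_fun by blast
  from exp_funD(1)[OF this] have [measurable]: "corr None \<in> borel_measurable borel" .
  have c: "(\<lambda>z. complex_of_real (corr None (u - z))) \<in> borel_measurable borel" by measurable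
  have k: "(\<lambda>z. (A :: complex^'m option^'m option) $ i $ j) \<in> borel_measurable (borel :: real measure)" for A i j by simp
  show ?thesis
    unfolding v_fun_def Let_def corr_def[symmetric] vector_minus_component vector_scaleR_component
    by (intro borel_measurable_add borel_measurable_diff borel_measurable_sum borel_measurable_times borel_measurable_scaleR
        matrix_mult_measurable mat_exp_R_measurable[OF L] mat_exp_diag_measurable k borel_measurable_const borel_measurable_of_real c
        measurable_ident_sets refl)
qed

end

section \<open>Integration of the expansion over z\<close>

lemma weighted_integrable:
  fixes J :: "real \<Rightarrow> real" and d :: "real \<Rightarrow> complex"
  assumes J: "integrable lborel J" "\<And>z. z < 0 \<Longrightarrow> J z = 0"
    and d: "d \<in> borel_measurable borel" "\<And>z. 0 \<le> z \<Longrightarrow> norm (d z) \<le> D"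
  shows "integrable lborel (\<lambda>z. complex_of_real (J z) * d z)"
proof (rule Bochner_Integration.integrable_bound)
  show "integrable lborel (\<lambda>z. D * J z)" using J(1) by simp
  show "(\<lambda>z. complex_of_real (J z) * d z) \<in> borel_measurable lborel"
    using borel_measurable_integrable[OF J(1)] d(1) by simp
  have "norm (complex_of_real (J z) * d z) \<le> norm (D * J z)" for z
  proof (cases "z < 0")
    case False
    then have "norm (d z) \<le> \<bar>D\<bar>" using d(2)[of z] by linarith
    then have "\<bar>J z\<bar> * norm (d z) \<le> \<bar>J z\<bar> * \<bar>D\<bar>" by (rule mult_left_mono) simp
    then show ?thesis by (simp add: norm_mult abs_mult mult.commute)
  qed (simp add: J)
  then show "AE z in lborel. norm (complex_of_real (J z) * d z) \<le> norm (D * J z)" by simp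
qed

theorem theorem5p1:
  fixes M :: "'m::finite risk_model"
    and \<alpha>p :: "real^'n" and Tp :: "real^'n^'n"
    and \<omega> :: "real \<Rightarrow> real \<Rightarrow> real"
    and q u \<epsilon>0 :: real
    and W :: "real \<Rightarrow> real \<Rightarrow> real^'m option^'m option"
    and Wd :: "signed_measure^'m option^'m option"
    and \<rho> :: "real \<Rightarrow> complex^'m option"
  assumes model: "valid_model M"
    and claim_p_phase_type: "phase_type \<alpha>p Tp (claim_p M)"
    and q: "0 < q" and u: "0 \<le> u"
    and eps0: "0 < \<epsilon>0" "\<epsilon>0 \<le> 1"
    and safety: "\<And>\<epsilon>. \<epsilon> \<in> {0..\<epsilon>0} \<Longrightarrow> safety_loading M \<epsilon>"
    and scale: "\<And>\<epsilon>. \<epsilon> \<in> {0..\<epsilon>0} \<Longrightarrow> is_scale_matrix M \<epsilon> q (W \<epsilon>)"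
    and scale_measure: "is_scale_measure M q Wd"
    and roots0: "positive_simple_roots M q (\<rho> 0)"
    and roots: "\<And>\<epsilon> i. \<epsilon> \<in> {0..\<epsilon>0} \<Longrightarrow> det (exponent M \<epsilon> q (\<rho> \<epsilon> $ i)) = 0"
    and roots_extend: "\<And>i. ((\<lambda>\<epsilon>. \<rho> \<epsilon> $ i) \<longlongrightarrow> \<rho> 0 $ i) (at_right 0)"
    and L_inv: "\<And>\<epsilon>. \<epsilon> \<in> {0..\<epsilon>0} \<Longrightarrow> invertible (L_mat M (\<rho> \<epsilon>))"
    and omega_bounded: "\<exists>B. \<forall>y>0. \<forall>z>0. 0 \<le> \<omega> y z \<and> \<omega> y z \<le> B"
    and omega_measurable:
      "(\<lambda>(y, z). \<omega> y z) \<in> borel_measurable (restrict_space borel ({0<..} \<times> {0<..}))"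
  shows "(\<lambda>\<epsilon>. GS M \<omega> u q \<epsilon> (W \<epsilon>) (\<rho> \<epsilon>) -
      (GS M \<omega> u q 0 (W 0) (\<rho> 0) + complex_of_real \<epsilon> * A_coef M 0 q * of_real (claim_rate M) *
        ((LINT z:{0..}|lborel.
            (LINT y:{0..}|shifted (claim_h M) z.
               complex_of_real (\<omega> y z) * r_mat M (W 0) (\<rho> 0) u z $ None $ None)
          - (LINT y:{0..}|shifted (claim_p M) z.
               complex_of_real (\<omega> y z) * r_mat M (W 0) (\<rho> 0) u z $ None $ None))
        + (LINT z:{0..}|lborel. LINT y:{0..}|shifted (claim_p M) z.
               complex_of_real (\<omega> y z) * v_fun M q (W 0) Wd (\<rho> 0) u z))))
    \<in> O[at_right 0](\<lambda>\<epsilon>. complex_of_real (\<epsilon>\<^sup>2))"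
proof -
  obtain B where B: "\<forall>y>0. \<forall>z>0. 0 \<le> \<omega> y z \<and> \<omega> y z \<le> B" using omega_bounded by blast
  interpret risk M by unfold_locales (rule model)
  interpret risk_scale M q "W 0" Wd
    by unfold_locales (use scale[of 0] scale_measure eps0 in auto)
  interpret penalty \<omega> B
    by unfold_locales (use B omega_measurable in auto)
  have ev: "\<forall>\<^sub>F t in at_right 0. t \<in> {0..\<epsilon>0}"
    using eventually_at_right_0_between[OF eps0(1)] by eventually_elim auto
  have L0: "invertible (L_mat M (\<rho> 0))" using L_inv[of 0] eps0 by simp
  define c where "c t z = r_mat M (W t) (\<rho> t) u z $ None $ None" for t z
  define v where "v = v_fun M q (W 0) Wd (\<rho> 0) u"
  have X: "expands c (c 0) v"
    unfolding c_def[abs_def] v_def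
  proof (rule expands_r_mat[where W = W and \<rho> = \<rho>])
    show "\<forall>\<^sub>F t in at_right 0. is_scale_matrix M t q (W t)" using ev by eventually_elim (rule scale)
    show "\<forall>\<^sub>F t in at_right 0. det (exponent M t q (\<rho> t $ i)) = 0" for i using ev by eventually_elim (rule roots)
    show "\<forall>\<^sub>F t in at_right 0. invertible (L_mat M (\<rho> t))" using ev by eventually_elim (rule L_inv)
  qed (rule u roots0 roots_extend L0 refl)+
  obtain C where C: "0 \<le> C" "\<And>z. 0 \<le> z \<Longrightarrow> norm (c 0 z) \<le> C" "\<And>z. 0 \<le> z \<Longrightarrow> norm (v z) \<le> C"
    "\<forall>\<^sub>F t in at_right 0. \<forall>z\<ge>0. norm (c t z - c 0 z - t *\<^sub>R v z) \<le> C * t\<^sup>2"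
    by (rule expandsE[OF X]) (rule that; blast)
  define Jp where "Jp = claim_penalty \<omega> (claim_p M)"
  define Jh where "Jh = claim_penalty \<omega> (claim_h M)"
  \<comment> \<open>The penalty integral of the mixture is affine in t, so all nonlinearity in t
    comes from the kernel \<open>c t\<close>.\<close>
  define J where "J t z = (1 - t) * Jp z + t * Jh z" for t z
  have Jz: "Jp z = 0" "Jh z = 0" if "z \<le> 0" for z using that by (auto simp: Jp_def Jh_def claim_penalty_def)
  have Ji: "integrable lborel Jp" "integrable lborel Jh"
    unfolding Jp_def Jh_def by (intro claim_penalty_integrable ac_p ac_h)+
  have JJ: "integrable lborel (J t)" for t unfolding J_def using Ji by simp
  define A where "A = A_coef M 0 q * of_real (claim_rate M)"
  have cm: "c t \<in> borel_measurable borel" if "t \<in> {0..\<epsilon>0}" for t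
    unfolding c_def[abs_def] by (rule r_mat_measurable[OF scale[OF that] L_inv[OF that]])
  have vm: "v \<in> borel_measurable borel" unfolding v_def using v_fun_measurable[OF L0] by simp
  have GS: "GS M \<omega> u q t (W t) (\<rho> t) = A * (LINT z|lborel. complex_of_real (J t z) * c t z)"
    if t: "t \<in> {0..\<epsilon>0}" for t
  proof -
    have "claim_penalty \<omega> (claim_dist M t) = J t"
      unfolding claim_dist_def J_def[abs_def] Jp_def Jh_def
      by (rule ext, rule claim_penalty_lincomb[OF ac_p ac_h]) (use t eps0 in auto)
    then have "(LINT z:{0..}|lborel. LINT y:{0..}|shifted (claim_dist M t) z. complex_of_real (\<omega> y z) * c t z)
        = (LINT z|lborel. complex_of_real (J t z) * c t z)"
      by (intro outer_integral) (simp_all only: inner_integral, simp add: J_def Jz)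
    then show ?thesis by (simp only: GS_def c_def A_def A_coef_indep[of M t])
  qed
  have I1: "(LINT z:{0..}|lborel. (LINT y:{0..}|shifted (claim_h M) z. complex_of_real (\<omega> y z) * c 0 z)
      - (LINT y:{0..}|shifted (claim_p M) z. complex_of_real (\<omega> y z) * c 0 z))
    = (LINT z|lborel. complex_of_real (Jh z - Jp z) * c 0 z)"
    by (rule outer_integral)
       (simp only: inner_integral Jp_def[symmetric] Jh_def[symmetric] of_real_diff left_diff_distrib, simp add: Jz)
  have I2: "(LINT z:{0..}|lborel. LINT y:{0..}|shifted (claim_p M) z. complex_of_real (\<omega> y z) * v z)
    = (LINT z|lborel. complex_of_real (Jp z) * v z)"
    by (rule outer_integral) (simp_all only: inner_integral Jp_def[symmetric] Jz)
  \<comment> \<open>The common L1 bound of the weights \<open>J t\<close>, for t in [0, 1], and of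
    the difference of \<open>Jh\<close> and \<open>Jp\<close>.\<close>
  define K where "K = (LINT z|lborel. \<bar>Jp z\<bar> + \<bar>Jh z\<bar>)"
  let ?f = "\<lambda>t. GS M \<omega> u q t (W t) (\<rho> t) - (GS M \<omega> u q 0 (W 0) (\<rho> 0) + complex_of_real t * A_coef M 0 q * of_real (claim_rate M) *
        ((LINT z|lborel. complex_of_real (Jh z - Jp z) * c 0 z) + (LINT z|lborel. complex_of_real (Jp z) * v z)))"
  \<comment> \<open>Two second-order terms remain, the remainder of the kernel and a cross term;
    each contributes C K.\<close>
  have "\<forall>\<^sub>F t in at_right 0. norm (?f t) \<le> (norm A * (2 * C * K)) * norm (complex_of_real (t\<^sup>2))"
    using ev C(4)
  proof eventually_elim
    case (elim t)
    have t: "0 \<le> t" "t \<le> 1" and z0: "(0::real) \<in> {0..\<epsilon>0}" using elim(1) eps0 by auto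
    let ?R = "\<lambda>z. c t z - c 0 z - t *\<^sub>R v z"
    have Rm: "?R \<in> borel_measurable borel" using cm[OF elim(1)] cm[OF z0] vm by simp
    have Jlz: "J t z = 0" "Jp z = 0" "Jh z - Jp z = 0" if "z < 0" for z using that by (simp_all add: J_def Jz)
    have i0: "integrable lborel (\<lambda>z. complex_of_real (J t z) * ?R z)"
      by (rule weighted_integrable[OF JJ Jlz(1) Rm]) (use elim(2) in auto)
    have i1: "integrable lborel (\<lambda>z. complex_of_real (Jp z) * c 0 z)"
      by (rule weighted_integrable[OF Ji(1) Jlz(2) cm[OF z0] C(2)])
    have i2: "integrable lborel (\<lambda>z. complex_of_real (Jh z - Jp z) * c 0 z)"
      by (rule weighted_integrable[OF _ Jlz(3) cm[OF z0] C(2)]) (use Ji in auto)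
    have i3: "integrable lborel (\<lambda>z. complex_of_real (Jp z) * v z)"
      by (rule weighted_integrable[OF Ji(1) Jlz(2) vm C(3)])
    have i4: "integrable lborel (\<lambda>z. complex_of_real (Jh z - Jp z) * v z)"
      by (rule weighted_integrable[OF _ Jlz(3) vm C(3)]) (use Ji in auto)
    \<comment> \<open>The weight Jp + t (Jh - Jp) is multiplied into c 0 + t v + R, with R kept
      against the full weight; the last summand is the cross term of order t^2.\<close>
    have split: "complex_of_real (J t z) * c t z
        = complex_of_real (J t z) * ?R z + complex_of_real (Jp z) * c 0 z
          + of_real t * (complex_of_real (Jh z - Jp z) * c 0 z) + of_real t * (complex_of_real (Jp z) * v z)
          + of_real (t\<^sup>2) * (complex_of_real (Jh z - Jp z) * v z)" for z
      by (simp add: J_def scaleR_conv_of_real algebra_simps power2_eq_square)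
    \<comment> \<open>Orders 0 and 1 cancel against the claimed expansion.\<close>
    have "?f t = A * ((LINT z|lborel. complex_of_real (J t z) * ?R z)
        + of_real (t\<^sup>2) * (LINT z|lborel. complex_of_real (Jh z - Jp z) * v z))"
    proof -
      have "(LINT z|lborel. complex_of_real (J t z) * c t z)
          = (LINT z|lborel. complex_of_real (J t z) * ?R z) + (LINT z|lborel. complex_of_real (Jp z) * c 0 z)
          + of_real t * (LINT z|lborel. complex_of_real (Jh z - Jp z) * c 0 z)
          + of_real t * (LINT z|lborel. complex_of_real (Jp z) * v z)
          + of_real (t\<^sup>2) * (LINT z|lborel. complex_of_real (Jh z - Jp z) * v z)"
        unfolding split using i0 i1 i2 i3 i4
        by (simp only: Bochner_Integration.integral_add Bochner_Integration.integrable_add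
            integral_mult_right_zero integrable_mult_right)
      moreover have "J 0 = Jp" by (simp add: J_def fun_eq_iff)
      ultimately show ?thesis
        unfolding GS[OF elim(1)] GS[OF z0] by (simp only: A_def) (simp add: algebra_simps)
    qed
    also have "norm \<dots> \<le> norm A * (C * t\<^sup>2 * K + t\<^sup>2 * (C * K))"
      unfolding norm_mult[of A]
    proof (intro mult_left_mono norm_triangle_mono norm_ge_zero)
      have Ki: "integrable lborel (\<lambda>z. D * (\<bar>Jp z\<bar> + \<bar>Jh z\<bar>))" for D using Ji by simp
      have bd: "norm (LINT z|lborel. complex_of_real (j z) * d z) \<le> D * K"
        if j: "\<And>z. \<bar>j z\<bar> \<le> \<bar>Jp z\<bar> + \<bar>Jh z\<bar>" and d: "\<And>z. 0 \<le> z \<Longrightarrow> norm (d z) \<le> D" for j d D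
      proof -
        have D: "0 \<le> D" using order_trans[OF norm_ge_zero d[OF order_refl]] .
        have "norm (LINT z|lborel. complex_of_real (j z) * d z) \<le> (LINT z|lborel. norm (complex_of_real (j z) * d z))"
          by (rule Bochner_Integration.integral_norm_bound)
        also have "\<dots> \<le> (LINT z|lborel. D * (\<bar>Jp z\<bar> + \<bar>Jh z\<bar>))"
        proof (rule integral_mono'[OF Ki])
          fix z :: real
          show "norm (complex_of_real (j z) * d z) \<le> D * (\<bar>Jp z\<bar> + \<bar>Jh z\<bar>)"
          proof (cases "z < 0")
            case True
            then have "j z = 0" using j[of z] Jz[of z] by simp
            then show ?thesis using D by simp
          next
            case False
            then have "\<bar>j z\<bar> * norm (d z) \<le> (\<bar>Jp z\<bar> + \<bar>Jh z\<bar>) * D" using j[of z] d[of z] by (intro mult_mono) auto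
            then show ?thesis by (simp add: norm_mult mult.commute)
          qed
          show "0 \<le> D * (\<bar>Jp z\<bar> + \<bar>Jh z\<bar>)" using D by simp
        qed
        finally show ?thesis by (simp add: K_def)
      qed
      show "norm (LINT z|lborel. complex_of_real (J t z) * ?R z) \<le> C * t\<^sup>2 * K"
      proof (rule bd)
        show "\<bar>J t z\<bar> \<le> \<bar>Jp z\<bar> + \<bar>Jh z\<bar>" for z
        proof -
          have "\<bar>J t z\<bar> \<le> (1 - t) * \<bar>Jp z\<bar> + t * \<bar>Jh z\<bar>"
            unfolding J_def using t by (intro order_trans[OF abs_triangle_ineq]) (simp add: abs_mult)
          also have "\<dots> \<le> 1 * \<bar>Jp z\<bar> + 1 * \<bar>Jh z\<bar>" using t by (intro add_mono mult_right_mono) auto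
          finally show ?thesis by simp
        qed
      qed (use elim(2) in auto)
      have "norm (LINT z|lborel. complex_of_real (Jh z - Jp z) * v z) \<le> C * K"
        by (rule bd[OF _ C(3)]) linarith
      then show "norm (of_real (t\<^sup>2) * (LINT z|lborel. complex_of_real (Jh z - Jp z) * v z)) \<le> t\<^sup>2 * (C * K)"
        unfolding norm_mult[of "of_real (t\<^sup>2)"] norm_of_real by (intro mult_mono) auto
    qed
    finally show ?case by (simp add: algebra_simps norm_power)
  qed
  then have "?f \<in> O[at_right 0](\<lambda>t. complex_of_real (t\<^sup>2))" by (rule bigoI)
  then show ?thesis unfolding I1[symmetric] I2[symmetric] unfolding c_def v_def .
qed

end
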